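(* Each variant (Any-Strict, Any-Non-strict, Simple-Strict, Simple-Non-strict, Proper, Happy) of Undirected Reachability Graph Realizability and of Directed Reachability Graph Realizability can be solved in $2^{O(|A|)}\cdot n^{O(1)}$ time, where $D=(V,A)$ is the input digraph and $n=|V|$.
   Context: An undirected (resp. directed) temporal graph is a pair $(H,\lambda)$ where $H$ is a simple undirected graph (resp. simple digraph) on vertex set $V$ and $\lambda$ assigns each edge (resp. arc) a finite, possibly empty, set of positive integer labels. A strict (resp. non-strict) temporal path from $u$ to $v$ is a sequence $(e_1,t_1),\dots,(e_\ell,t_\ell)$, $t_j\in\lambda(e_j)$, such that $e_1,\dots,e_\ell$ form a $u$-$v$ path (directed path in the directed case) and $t_1<\dots<t_\ell$ (resp. $t_1\le\dots\le t_\ell$). The strict (resp. non-strict) reachability graph is the digraph on $V$ with arc $(u,v)$, $u\ne v$, iff such a temporal path from $u$ to $v$ exists. A labeling is simple if every edge/arc with nonempty label set has exactly one label; proper if no two edges sharing an endpoint (in the directed case: no two arcs $(u,v),(v,w)$ forming a directed path) share a label; happy if proper and simple. Undirected (resp. Directed) Reachability Graph Realizability: given a simple digraph $D=(V,A)$, decide whether some undirected (resp. directed) temporal graph on $V$ has reachability graph equal to $D$. Variant "X-Strict"/"X-Non-strict" uses strict/non-strict reachability with arbitrary (X = Any) or simple (X = Simple) labelings; Proper and Happy require proper, resp. happy, labelings. *)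

theory Defs
  imports Complex_Main
begin

section \<open>Temporal graphs and their reachability graphs\<close>

definition simple_digraph :: "'a set \<Rightarrow> ('a \<times> 'a) set \<Rightarrow> bool" where
  "simple_digraph V A \<longleftrightarrow> finite V \<and> A \<subseteq> V \<times> V \<and> (\<forall>v. (v, v) \<notin> A)"

definition simple_ugraph :: "'a set \<Rightarrow> 'a set set \<Rightarrow> bool" where
  "simple_ugraph V E \<longleftrightarrow> finite V \<and> (\<forall>e\<in>E. e \<subseteq> V \<and> card e = 2)"

text \<open>
  Undirected edges have type \<^typ>\<open>'a set\<close>, arcs have type \<^typ>\<open>'a \<times> 'a\<close>.  Notions common to both
  cases are stated for an arbitrary edge type; where needed they take the map sending a pair of
  consecutive vertices to the edge traversed: \<open>uedge\<close> for undirected graphs, \<open>id\<close> for digraphs.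
\<close>

definition uedge :: "'a \<times> 'a \<Rightarrow> 'a set" where
  "uedge p = {fst p, snd p}"

definition labeling :: "'e set \<Rightarrow> ('e \<Rightarrow> nat set) \<Rightarrow> bool" where
  "labeling E lab \<longleftrightarrow> (\<forall>e\<in>E. finite (lab e) \<and> (\<forall>t\<in>lab e. 0 < t))"

definition temporal_path ::
  "('a \<times> 'a \<Rightarrow> 'e) \<Rightarrow> (nat \<Rightarrow> nat \<Rightarrow> bool) \<Rightarrow> 'e set \<Rightarrow> ('e \<Rightarrow> nat set) \<Rightarrow> 'a \<Rightarrow> 'a \<Rightarrow> ('e \<times> nat) list \<Rightarrow> bool"
where
  "temporal_path edge ord E lab u v es \<longleftrightarrow>
     (\<exists>vs. vs \<noteq> [] \<and> distinct vs \<and> hd vs = u \<and> last vs = v \<and>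
           map fst es = map edge (zip (butlast vs) (tl vs))) \<and>
     (\<forall>(e, t)\<in>set es. e \<in> E \<and> t \<in> lab e) \<and>
     sorted_wrt ord (map snd es)"

definition reachability_arcs ::
  "('a \<times> 'a \<Rightarrow> 'e) \<Rightarrow> (nat \<Rightarrow> nat \<Rightarrow> bool) \<Rightarrow> 'a set \<Rightarrow> 'e set \<Rightarrow> ('e \<Rightarrow> nat set) \<Rightarrow> ('a \<times> 'a) set"
where
  "reachability_arcs edge ord V E lab =
     {(u, v). u \<in> V \<and> v \<in> V \<and> u \<noteq> v \<and> (\<exists>es. temporal_path edge ord E lab u v es)}"

definition simple_labeling :: "'e set \<Rightarrow> ('e \<Rightarrow> nat set) \<Rightarrow> bool" where
  "simple_labeling E lab \<longleftrightarrow> (\<forall>e\<in>E. lab e \<noteq> {} \<longrightarrow> card (lab e) = 1)"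

definition proper_undirected :: "'a set set \<Rightarrow> ('a set \<Rightarrow> nat set) \<Rightarrow> bool" where
  "proper_undirected E lab \<longleftrightarrow>
     (\<forall>e\<in>E. \<forall>f\<in>E. e \<noteq> f \<and> e \<inter> f \<noteq> {} \<longrightarrow> lab e \<inter> lab f = {})"

text \<open>Antiparallel arcs do not form a directed path, hence \<^prop>\<open>u \<noteq> w\<close>.\<close>

definition proper_directed :: "('a \<times> 'a) set \<Rightarrow> ('a \<times> 'a \<Rightarrow> nat set) \<Rightarrow> bool" where
  "proper_directed E lab \<longleftrightarrow>
     (\<forall>u v w. (u, v) \<in> E \<and> (v, w) \<in> E \<and> u \<noteq> w \<longrightarrow> lab (u, v) \<inter> lab (v, w) = {})"


section \<open>The realizability problems\<close>

datatype variant = Any_Strict | Any_Nonstrict | Simple_Strict | Simple_Nonstrict | Proper | Happy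

text \<open>For proper labelings strict and non-strict temporal paths coincide (proved below).\<close>

primrec label_order :: "variant \<Rightarrow> nat \<Rightarrow> nat \<Rightarrow> bool" where
  "label_order Any_Strict = (<)"
| "label_order Any_Nonstrict = (\<le>)"
| "label_order Simple_Strict = (<)"
| "label_order Simple_Nonstrict = (\<le>)"
| "label_order Proper = (<)"
| "label_order Happy = (<)"

primrec admissible_undirected :: "variant \<Rightarrow> 'a set set \<Rightarrow> ('a set \<Rightarrow> nat set) \<Rightarrow> bool" where
  "admissible_undirected Any_Strict E lab \<longleftrightarrow> True"
| "admissible_undirected Any_Nonstrict E lab \<longleftrightarrow> True"
| "admissible_undirected Simple_Strict E lab \<longleftrightarrow> simple_labeling E lab"
| "admissible_undirected Simple_Nonstrict E lab \<longleftrightarrow> simple_labeling E lab"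
| "admissible_undirected Proper E lab \<longleftrightarrow> proper_undirected E lab"
| "admissible_undirected Happy E lab \<longleftrightarrow> proper_undirected E lab \<and> simple_labeling E lab"

primrec admissible_directed :: "variant \<Rightarrow> ('a \<times> 'a) set \<Rightarrow> ('a \<times> 'a \<Rightarrow> nat set) \<Rightarrow> bool" where
  "admissible_directed Any_Strict E lab \<longleftrightarrow> True"
| "admissible_directed Any_Nonstrict E lab \<longleftrightarrow> True"
| "admissible_directed Simple_Strict E lab \<longleftrightarrow> simple_labeling E lab"
| "admissible_directed Simple_Nonstrict E lab \<longleftrightarrow> simple_labeling E lab"
| "admissible_directed Proper E lab \<longleftrightarrow> proper_directed E lab"
| "admissible_directed Happy E lab \<longleftrightarrow> proper_directed E lab \<and> simple_labeling E lab"

definition undirected_realizable :: "variant \<Rightarrow> 'a set \<Rightarrow> ('a \<times> 'a) set \<Rightarrow> bool" where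
  "undirected_realizable X V A \<longleftrightarrow>
     (\<exists>E lab. simple_ugraph V E \<and> labeling E lab \<and> admissible_undirected X E lab \<and>
              reachability_arcs uedge (label_order X) V E lab = A)"

definition directed_realizable :: "variant \<Rightarrow> 'a set \<Rightarrow> ('a \<times> 'a) set \<Rightarrow> bool" where
  "directed_realizable X V A \<longleftrightarrow>
     (\<exists>E lab. simple_digraph V E \<and> labeling E lab \<and> admissible_directed X E lab \<and>
              reachability_arcs id (label_order X) V E lab = A)"

lemma strict_path_iff_nonstrict_path:
  assumes sep: "\<And>x y z. x \<noteq> y \<Longrightarrow> y \<noteq> z \<Longrightarrow> x \<noteq> z \<Longrightarrow> edge (x, y) \<in> E \<Longrightarrow> edge (y, z) \<in> E \<Longrightarrow>
                  lab (edge (x, y)) \<inter> lab (edge (y, z)) = {}"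
  shows "temporal_path edge (<) E lab u v es \<longleftrightarrow> temporal_path edge (\<le>) E lab u v es"
proof
  assume "temporal_path edge (<) E lab u v es"
  moreover from this have "sorted_wrt (<) (map snd es)"
    unfolding temporal_path_def by blast
  then have "sorted_wrt (\<le>) (map snd es)"
    by (rule sorted_wrt_mono_rel[rotated]) simp
  ultimately show "temporal_path edge (\<le>) E lab u v es"
    unfolding temporal_path_def by blast
next
  assume path: "temporal_path edge (\<le>) E lab u v es"
  then obtain vs where vs: "vs \<noteq> []" "distinct vs"
      and fst_es: "map fst es = map edge (zip (butlast vs) (tl vs))"
      and used: "\<And>e t. (e, t) \<in> set es \<Longrightarrow> e \<in> E \<and> t \<in> lab e"
      and srt: "sorted (map snd es)"
    unfolding temporal_path_def by blast
  have len: "length es = length vs - 1"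
    using arg_cong[OF fst_es, of length] by simp
  have edge_nth: "fst (es ! i) = edge (vs ! i, vs ! Suc i)" if "i < length es" for i
  proof -
    have "fst (es ! i) = map fst es ! i" using that by simp
    also have "\<dots> = edge (vs ! i, vs ! Suc i)"
      unfolding fst_es using that len by (simp add: nth_butlast nth_tl)
    finally show ?thesis .
  qed
  have used_nth: "fst (es ! i) \<in> E \<and> snd (es ! i) \<in> lab (fst (es ! i))" if "i < length es" for i
    using used[of "fst (es ! i)" "snd (es ! i)"] that by simp
  have "snd (es ! i) < snd (es ! Suc i)" if i: "Suc i < length es" for i
  proof -
    have "snd (es ! i) \<le> snd (es ! Suc i)"
      using sorted_nth_mono[OF srt, of i "Suc i"] i by simp
    moreover have "vs ! i \<noteq> vs ! Suc i" "vs ! Suc i \<noteq> vs ! Suc (Suc i)" "vs ! i \<noteq> vs ! Suc (Suc i)"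
      using vs(2) i len by (simp_all add: nth_eq_iff_index_eq)
    then have "lab (fst (es ! i)) \<inter> lab (fst (es ! Suc i)) = {}"
      using sep used_nth[of i] used_nth[of "Suc i"] edge_nth[of i] edge_nth[of "Suc i"] i by simp
    then have "snd (es ! i) \<noteq> snd (es ! Suc i)"
      using used_nth[of i] used_nth[of "Suc i"] i by auto
    ultimately show ?thesis by simp
  qed
  then have "sorted_wrt (<) (map snd es)"
    by (simp add: sorted_wrt_iff_nth_Suc_transp)
  then show "temporal_path edge (<) E lab u v es"
    using path unfolding temporal_path_def by blast
qed

lemma proper_undirected_reachability:
  assumes "proper_undirected E lab"
  shows "reachability_arcs uedge (<) V E lab = reachability_arcs uedge (\<le>) V E lab"
proof -
  have "lab (uedge (x, y)) \<inter> lab (uedge (y, z)) = {}"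
    if "x \<noteq> y" "y \<noteq> z" "x \<noteq> z" "uedge (x, y) \<in> E" "uedge (y, z) \<in> E" for x y z
  proof -
    have "uedge (x, y) \<noteq> uedge (y, z)" "uedge (x, y) \<inter> uedge (y, z) \<noteq> {}"
      using that by (auto simp: uedge_def)
    then show ?thesis using assms that unfolding proper_undirected_def by blast
  qed
  then have "temporal_path uedge (<) E lab u v es = temporal_path uedge (\<le>) E lab u v es" for u v es
    by (rule strict_path_iff_nonstrict_path)
  then show ?thesis
    by (simp only: reachability_arcs_def)
qed

lemma proper_directed_reachability:
  assumes "proper_directed E lab"
  shows "reachability_arcs id (<) V E lab = reachability_arcs id (\<le>) V E lab"
proof -
  have "lab (id (x, y)) \<inter> lab (id (y, z)) = {}"
    if "x \<noteq> z" "id (x, y) \<in> E" "id (y, z) \<in> E" for x y z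
    using assms that unfolding proper_directed_def id_apply by blast
  then have "temporal_path id (<) E lab u v es = temporal_path id (\<le>) E lab u v es" for u v es
    by (rule strict_path_iff_nonstrict_path)
  then show ?thesis
    by (simp only: reachability_arcs_def)
qed


section \<open>Random access machines\<close>

text \<open>
  Cells hold natural numbers, every instruction costs one time unit, and memory is addressed
  through registers.  Since the only arithmetic is addition and truncated subtraction, numbers
  grow by at most one bit per step, so that unit-cost time is polynomially related to Turing
  machine time.
\<close>

datatype instr =
    Const nat nat    \<comment> \<open>\<open>Const r c\<close>: \<open>r := c\<close>\<close>
  | Add nat nat nat  \<comment> \<open>\<open>Add r i j\<close>: \<open>r := i + j\<close>\<close>
  | Sub nat nat nat  \<comment> \<open>\<open>Sub r i j\<close>: \<open>r := i - j\<close>\<close>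
  | Load nat nat     \<comment> \<open>\<open>Load r i\<close>: \<open>r := mem[i]\<close>\<close>
  | Store nat nat    \<comment> \<open>\<open>Store i j\<close>: \<open>mem[i] := j\<close>\<close>
  | Jump nat         \<comment> \<open>\<open>Jump l\<close>: go to \<open>l\<close>\<close>
  | JumpZ nat nat    \<comment> \<open>\<open>JumpZ i l\<close>: go to \<open>l\<close> if \<open>i = 0\<close>\<close>

record config =
  pc :: nat
  regs :: "nat \<Rightarrow> nat"
  mem :: "nat \<Rightarrow> nat"

primrec exec :: "instr \<Rightarrow> config \<Rightarrow> config" where
  "exec (Const r c) s = s\<lparr>pc := pc s + 1, regs := (regs s)(r := c)\<rparr>"
| "exec (Add r i j) s = s\<lparr>pc := pc s + 1, regs := (regs s)(r := regs s i + regs s j)\<rparr>"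
| "exec (Sub r i j) s = s\<lparr>pc := pc s + 1, regs := (regs s)(r := regs s i - regs s j)\<rparr>"
| "exec (Load r i) s = s\<lparr>pc := pc s + 1, regs := (regs s)(r := mem s (regs s i))\<rparr>"
| "exec (Store i j) s = s\<lparr>pc := pc s + 1, mem := (mem s)(regs s i := regs s j)\<rparr>"
| "exec (Jump l) s = s\<lparr>pc := l\<rparr>"
| "exec (JumpZ i l) s = s\<lparr>pc := (if regs s i = 0 then l else pc s + 1)\<rparr>"

definition halted :: "instr list \<Rightarrow> config \<Rightarrow> bool" where
  "halted P s \<longleftrightarrow> length P \<le> pc s"

definition step :: "instr list \<Rightarrow> config \<Rightarrow> config" where
  "step P s = (if halted P s then s else exec (P ! pc s) s)"

definition initial :: "nat list \<Rightarrow> config" where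
  "initial xs = \<lparr>pc = 0, regs = (\<lambda>_. 0), mem = (\<lambda>a. if a < length xs then xs ! a else 0)\<rparr>"

text \<open>The answer of a halted machine is read off register 0.\<close>

definition answers_within :: "instr list \<Rightarrow> nat list \<Rightarrow> nat \<Rightarrow> bool \<Rightarrow> bool" where
  "answers_within P xs T b \<longleftrightarrow>
     (\<exists>t\<le>T. let s = (step P ^^ t) (initial xs) in halted P s \<and> regs s 0 = (if b then 1 else 0))"

text \<open>A digraph on \<open>{..<n}\<close> is given by \<open>n\<close> followed by its adjacency matrix, row by row.\<close>

definition encode_digraph :: "nat \<Rightarrow> (nat \<times> nat) set \<Rightarrow> nat list" where
  "encode_digraph n A = n # map (\<lambda>i. if (i div n, i mod n) \<in> A then 1 else 0) [0..<n * n]"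

text \<open>
  Running time \<open>2\<^bsup>O(|A|)\<^esup> \<cdot> n\<^bsup>O(1)\<^esup>\<close>.  The base \<^term>\<open>n + 1\<close> instead of \<^term>\<open>n\<close> only matters for
  \<open>n = 0\<close>, where the bound would otherwise vanish.
\<close>

definition solvable_single_exp_arcs :: "(nat set \<Rightarrow> (nat \<times> nat) set \<Rightarrow> bool) \<Rightarrow> bool" where
  "solvable_single_exp_arcs Q \<longleftrightarrow>
     (\<exists>P C c k. \<forall>n A. simple_digraph {..<n} A \<longrightarrow>
        answers_within P (encode_digraph n A) (C * 2 ^ (c * card A) * (n + 1) ^ k) (Q {..<n} A))"

end

theory Submission
  imports Defs
begin

text \<open>
  Let \<open>F\<^sub>t\<close> be the set of arcs (each undirected edge giving two) that carry label \<open>t\<close>.  The reachability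
  relation, made reflexive, is the product of the relations \<open>F\<^sub>1, F\<^sub>2, \<dots>\<close>, each replaced by its reflexive
  closure (strict paths) or its reflexive transitive closure (non-strict paths).  All partial products
  and all \<open>F\<^sub>t\<close> lie in \<open>A\<close>, and properness constrains each \<open>F\<^sub>t\<close> separately, while simplicity says that
  the \<open>F\<^sub>t\<close> are disjoint.  So \<open>D\<close> is realizable iff \<open>A\<close> is reachable in the graph whose states are pairs
  \<open>(R, U)\<close> of subsets of \<open>A\<close> (arcs realized, arcs already labelled) and whose steps add one snapshot.
  There are \<open>4\<^sup>m\<close> states and \<open>8\<^sup>m\<close> steps for \<open>m = |A|\<close>.  Steps do not decrease the natural bit code of a state,
  so a single pass over all steps in increasing order marks the reachable states.

  The random access machine is programmed in a small language with bounded loops, whose semantics is a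
  total function; expressions include bounded quantifiers, so that the tests on \<open>F\<^sub>t\<close> are formulas.
\<close>

section \<open>Reachability as a product of snapshots\<close>

text \<open>A labeling may use arbitrarily many labels, but the past matters only through the arcs
  realized and, for simple labelings, the arcs used up; this is why finitely many states suffice.
  \<open>F\<^sub>t\<close> lies in \<open>A\<close> because a single labelled arc is already a
  journey and all factors contain the identity; the same monotonicity keeps partial products in
  \<open>A\<close>. So \<open>V\<close> matters only while the input is read, and the exponent
  involves \<open>m\<close> alone. Temporal paths have distinct vertices whereas products describe
  walks; cutting a walk back at a repeated vertex closes this gap. A step from state
  \<open>s\<close> has number \<open>z = code F + 2 ^ m * s\<close>. The steps leaving
  \<open>s\<close> thus form a block, blocks are ordered by \<open>s\<close>, and a step that
  changes the code marks a state whose block is still to come; a step that keeps the code leads back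
  to \<open>s\<close>. This replaces a search queue by a counter. The running time of a program is
  polynomial in its loop bounds, which are at most \<open>n + 8 ^ m\<close>, and this is of the form
  \<open>2 ^ O(m) * n ^ O(1)\<close>. As the machine neither multiplies nor divides, numbers are
  composed by doubling and decomposed by table lookup.\<close>

definition layer :: "bool \<Rightarrow> ('a \<times> 'a) set \<Rightarrow> ('a \<times> 'a) set" where
  "layer ns F = (if ns then F\<^sup>* else F\<^sup>=)"

text \<open>The factors start at \<open>F 1\<close> because labels are positive; the index is the
  latest label that may be used.\<close>

primrec journeys :: "bool \<Rightarrow> (nat \<Rightarrow> ('a \<times> 'a) set) \<Rightarrow> nat \<Rightarrow> ('a \<times> 'a) set" where
  "journeys ns F 0 = Id"
| "journeys ns F (Suc t) = journeys ns F t O layer ns (F (Suc t))"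

definition snapshot :: "('a \<times> 'a \<Rightarrow> 'e) \<Rightarrow> 'e set \<Rightarrow> ('e \<Rightarrow> nat set) \<Rightarrow> nat \<Rightarrow> ('a \<times> 'a) set" where
  "snapshot edge E lab t = {(x, y). edge (x, y) \<in> E \<and> t \<in> lab (edge (x, y))}"

definition before :: "bool \<Rightarrow> nat \<Rightarrow> nat \<Rightarrow> bool" where
  "before ns = (if ns then (\<le>) else (<))"

lemma layer_refl: "Id \<subseteq> layer ns F"
  by (auto simp: layer_def)

lemma layer_super: "F \<subseteq> layer ns F"
  by (auto simp: layer_def)

lemma layer_empty [simp]: "layer ns {} = Id"
  by (auto simp: layer_def)

lemma journeys_step_mono: "journeys ns F t \<subseteq> journeys ns F (Suc t)"
  using layer_refl by fastforce

lemma journeys_mono: "t \<le> t' \<Longrightarrow> journeys ns F t \<subseteq> journeys ns F t'"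
  by (rule lift_Suc_mono_le[of "journeys ns F", OF journeys_step_mono])

lemma journeys_refl: "Id \<subseteq> journeys ns F t"
  using journeys_mono[of 0 t ns F] by simp

lemma layer_journeys: "0 < t \<Longrightarrow> F t \<subseteq> journeys ns F t"
  using journeys_refl[of ns F "t - 1"] layer_super[of "F t" ns]
  by (cases t) (auto simp: subset_iff relcomp_unfold)

lemma journeys_cong: "(\<And>i. 0 < i \<Longrightarrow> i \<le> t \<Longrightarrow> F i = G i) \<Longrightarrow> journeys ns F t = journeys ns G t"
  by (induction t) auto

text \<open>Every factor adds only pairs from \<open>V \<times> V\<close> to the identity; the
  identity itself ranges over the whole type, so the diagonal is removed.\<close>

lemma journeys_subset:
  assumes "\<And>t. F t \<subseteq> V \<times> V"
  shows "journeys ns F t - Id \<subseteq> V \<times> V"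
proof -
  have lay: "layer ns (F t) \<subseteq> Id \<union> V \<times> V" for t
  proof -
    have "(F t)\<^sup>+ \<subseteq> V \<times> V" using assms[of t] by (rule trancl_subset_Sigma)
    then show ?thesis using assms[of t] by (auto simp: layer_def rtrancl_eq_or_trancl)
  qed
  have "journeys ns F t \<subseteq> Id \<union> V \<times> V"
  proof (induction t)
    case (Suc t)
    then show ?case using lay[of "Suc t"] by fastforce
  qed simp
  then show ?thesis by blast
qed

section \<open>Temporal paths and products of snapshots\<close>

inductive snoc_path ::
  "('a \<times> 'a \<Rightarrow> 'e) \<Rightarrow> (nat \<Rightarrow> nat \<Rightarrow> bool) \<Rightarrow> 'e set \<Rightarrow> ('e \<Rightarrow> nat set) \<Rightarrow> 'a list \<Rightarrow> ('e \<times> nat) list \<Rightarrow> bool"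
  for edge ord E lab where
  start: "snoc_path edge ord E lab [u] []"
| snoc: "snoc_path edge ord E lab (vs @ [v]) (es @ [(edge (last vs, v), t)])"
  if "snoc_path edge ord E lab vs es" "v \<notin> set vs" "edge (last vs, v) \<in> E"
    "t \<in> lab (edge (last vs, v))" "\<forall>t'\<in>snd ` set es. ord t' t"

lemma snoc_path_nonempty: "snoc_path edge ord E lab vs es \<Longrightarrow> vs \<noteq> []"
  by (erule snoc_path.cases) auto

lemma zip_steps_snoc:
  assumes "vs \<noteq> []"
  shows "zip (butlast (vs @ [v])) (tl (vs @ [v])) = zip (butlast vs) (tl vs) @ [(last vs, v)]"
proof -
  have "zip (butlast (vs @ [v])) (tl (vs @ [v])) = zip (butlast vs @ [last vs]) (tl vs @ [v])"
    using assms by simp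
  also have "\<dots> = zip (butlast vs) (tl vs) @ [(last vs, v)]"
    by (rule zip_append[where ys = "[last vs]" and vs = "[v]", simplified]) simp
  finally show ?thesis .
qed

text \<open>\<open>snoc_path\<close> grows at the last vertex, just as \<open>journeys\<close>
  multiplies on the right, and compares a new label with all earlier ones, which is how
  \<open>sorted_wrt\<close> splits at the end of a list. Its explicit vertex list makes repetitions
  visible.\<close>

lemma temporal_path_iff_snoc_path:
  "temporal_path edge ord E lab u v es \<longleftrightarrow>
     (\<exists>vs. snoc_path edge ord E lab vs es \<and> hd vs = u \<and> last vs = v)"
proof
  assume "temporal_path edge ord E lab u v es"
  then obtain vs where vs: "vs \<noteq> []" "distinct vs" "hd vs = u" "last vs = v"
      "map fst es = map edge (zip (butlast vs) (tl vs))"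
      "\<forall>(e, t)\<in>set es. e \<in> E \<and> t \<in> lab e" "sorted_wrt ord (map snd es)"
    unfolding temporal_path_def by blast
  have "snoc_path edge ord E lab vs es"
    using vs(1,2,5-7)
  proof (induction vs arbitrary: es rule: rev_induct)
    case (snoc v vs)
    show ?case
    proof (cases "vs = []")
      case True
      then show ?thesis using snoc.prems by (auto intro: snoc_path.start)
    next
      case False
      then have eq: "map fst es = map edge (zip (butlast vs) (tl vs)) @ [edge (last vs, v)]"
        using snoc.prems(3) unfolding zip_steps_snoc[OF False] by simp
      then obtain es' e t where es: "es = es' @ [(e, t)]"
        by (cases es rule: rev_cases) auto
      then show ?thesis
        using eq snoc.prems False by (auto intro!: snoc_path.snoc snoc.IH simp: sorted_wrt_append)
    qed
  qed simp
  then show "\<exists>vs. snoc_path edge ord E lab vs es \<and> hd vs = u \<and> last vs = v" using vs by blast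
next
  assume "\<exists>vs. snoc_path edge ord E lab vs es \<and> hd vs = u \<and> last vs = v"
  then obtain vs where vs: "snoc_path edge ord E lab vs es" "hd vs = u" "last vs = v" by blast
  from vs(1) have "vs \<noteq> [] \<and> distinct vs \<and> map fst es = map edge (zip (butlast vs) (tl vs)) \<and>
      (\<forall>(e, t)\<in>set es. e \<in> E \<and> t \<in> lab e) \<and> sorted_wrt ord (map snd es)"
  proof induction
    case (snoc vs es v t)
    then show ?case using zip_steps_snoc[of vs v] by (auto simp: sorted_wrt_append)
  qed simp
  then show "temporal_path edge ord E lab u v es" using vs unfolding temporal_path_def by blast
qed

text \<open>The prefix that ends at \<open>v\<close> is itself a path and introduces no labels; this
  is the cut applied when a walk returns to a vertex.\<close>

lemma snoc_path_truncate:
  assumes "snoc_path edge ord E lab vs es" "v \<in> set vs"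
  shows "\<exists>vs' es'. snoc_path edge ord E lab vs' es' \<and> hd vs' = hd vs \<and> last vs' = v \<and> set es' \<subseteq> set es"
  using assms
proof (induction)
  case (start u)
  then show ?case using snoc_path.start by fastforce
next
  case (snoc vs es w t)
  show ?case
  proof (cases "v = w")
    case True
    then show ?thesis using snoc_path.snoc[OF snoc.hyps] by (intro exI conjI) auto
  next
    case False
    then obtain vs' es' where "snoc_path edge ord E lab vs' es'" "hd vs' = hd vs" "last vs' = v"
      "set es' \<subseteq> set es" using snoc by auto
    then show ?thesis using snoc_path_nonempty[OF snoc.hyps(1)] by (intro exI[of _ vs'] exI[of _ es']) auto
  qed
qed

text \<open>If \<open>v\<close> was visited before, the path is cut back to it and \<open>t\<close>
  is not consumed; therefore the label set is only bounded from above.\<close>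

lemma snoc_path_extend:
  assumes "snoc_path edge ord E lab vs es" "(last vs, v) \<in> snapshot edge E lab t"
    "\<forall>t'\<in>snd ` set es. ord t' t"
  shows "\<exists>vs' es'. snoc_path edge ord E lab vs' es' \<and> hd vs' = hd vs \<and> last vs' = v \<and>
           snd ` set es' \<subseteq> insert t (snd ` set es)"
proof (cases "v \<in> set vs")
  case True
  then show ?thesis using snoc_path_truncate[OF assms(1)] by blast
next
  case False
  have "snoc_path edge ord E lab (vs @ [v]) (es @ [(edge (last vs, v), t)])"
    using assms False by (intro snoc_path.snoc) (auto simp: snapshot_def)
  then show ?thesis using snoc_path_nonempty[OF assms(1)]
    by (intro exI[of _ "vs @ [v]"] exI[of _ "es @ [(edge (last vs, v), t)]"]) auto
qed

text \<open>The bound on the labels carries the induction: labels at most \<open>t\<close> may be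
  followed by \<open>Suc t\<close> in either order.\<close>

lemma journeys_imp_snoc_path:
  assumes "(u, v) \<in> journeys ns (snapshot edge E lab) t"
  shows "\<exists>vs es. snoc_path edge (before ns) E lab vs es \<and> hd vs = u \<and> last vs = v \<and> (\<forall>t'\<in>snd ` set es. t' \<le> t)"
  using assms
proof (induction t arbitrary: v)
  case 0
  then show ?case using snoc_path.start[of edge "before ns" E lab u] by (intro exI[of _ "[u]"] exI[of _ "[]"]) auto
next
  case (Suc t)
  then obtain x where x: "(u, x) \<in> journeys ns (snapshot edge E lab) t" "(x, v) \<in> layer ns (snapshot edge E lab (Suc t))"
    by auto
  obtain vs es where p: "snoc_path edge (before ns) E lab vs es" "hd vs = u" "last vs = x" "\<forall>t'\<in>snd ` set es. t' \<le> t"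
    using Suc.IH[OF x(1)] by blast
  show ?case
  proof (cases ns)
    case False
    show ?thesis
    proof (cases "x = v")
      case True
      then show ?thesis using p by (intro exI[of _ vs] exI[of _ es]) (auto intro: le_SucI)
    next
      case neq: False
      then have "(x, v) \<in> snapshot edge E lab (Suc t)" using x(2) False by (auto simp: layer_def)
      moreover have "\<forall>t'\<in>snd ` set es. before ns t' (Suc t)" using p(4) False by (auto simp: before_def less_Suc_eq_le)
      ultimately obtain vs' es' where "snoc_path edge (before ns) E lab vs' es'" "hd vs' = u" "last vs' = v"
          "snd ` set es' \<subseteq> insert (Suc t) (snd ` set es)"
        using snoc_path_extend[OF p(1), of v "Suc t"] p(2,3) by auto
      moreover have "\<forall>t'\<in>insert (Suc t) (snd ` set es). t' \<le> Suc t" using p(4) by (auto intro: le_SucI)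
      ultimately show ?thesis by (intro exI[of _ vs'] exI[of _ es']) blast
    qed
  next
    case True
    \<comment> \<open>Within one non-strict factor the label \<open>Suc t\<close> may repeat, so the
      inner induction carries the bound \<open>Suc t\<close> throughout.\<close>
    from x(2) True have "(x, v) \<in> (snapshot edge E lab (Suc t))\<^sup>*" by (simp add: layer_def)
    then show ?thesis
    proof (induction)
      case base
      then show ?case using p by (intro exI[of _ vs] exI[of _ es]) (auto intro: le_SucI)
    next
      case (step y z)
      then obtain vs es where q: "snoc_path edge (before ns) E lab vs es" "hd vs = u" "last vs = y"
        "\<forall>t'\<in>snd ` set es. t' \<le> Suc t" by blast
      then obtain vs' es' where "snoc_path edge (before ns) E lab vs' es'" "hd vs' = u" "last vs' = z"
          "snd ` set es' \<subseteq> insert (Suc t) (snd ` set es)"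
        using snoc_path_extend[OF q(1), of z "Suc t"] step.hyps True by (auto simp: before_def)
      moreover have "\<forall>t'\<in>insert (Suc t) (snd ` set es). t' \<le> Suc t" using q(4) by auto
      ultimately show ?case by (intro exI[of _ vs'] exI[of _ es']) blast
    qed
  qed
qed

text \<open>\<open>T\<close> is generalized because the prefix before a last label \<open>t\<close>
  is placed at time \<open>t - 1\<close> for strict paths and at time \<open>t\<close> for
  non-strict ones, where the star of the snapshot absorbs the last arc.\<close>

lemma snoc_path_imp_journeys:
  assumes "snoc_path edge (before ns) E lab vs es" "labeling E lab" "\<forall>t'\<in>snd ` set es. t' \<le> T"
  shows "(hd vs, last vs) \<in> journeys ns (snapshot edge E lab) T"
  using assms(1,3)
proof (induction arbitrary: T)
  case (start u)
  then show ?case using journeys_refl by fastforce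
next
  case (snoc vs es v t)
  let ?F = "snapshot edge E lab"
  have F: "(last vs, v) \<in> ?F t" using snoc.hyps by (simp add: snapshot_def)
  have t: "0 < t" "t \<le> T" using snoc.hyps snoc.prems assms(2) by (auto simp: labeling_def)
  have "(hd vs, v) \<in> journeys ns ?F t"
  proof (cases ns)
    case True
    have "(hd vs, last vs) \<in> journeys ns ?F t"
      using snoc.hyps(5) True by (intro snoc.IH) (auto simp: before_def)
    then have "(hd vs, v) \<in> journeys ns ?F t O (?F t)\<^sup>*" using F by blast
    moreover have "journeys ns ?F t O (?F t)\<^sup>* = journeys ns ?F t"
      using t(1) True by (cases t) (auto simp: layer_def O_assoc)
    ultimately show ?thesis by simp
  next
    case False
    have "(hd vs, last vs) \<in> journeys ns ?F (t - 1)"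
      using snoc.hyps(5) False by (intro snoc.IH) (auto simp: before_def)
    then have "(hd vs, v) \<in> journeys ns ?F (t - 1) O layer ns (?F t)" using F layer_super by fast
    then show ?thesis using t(1) by (cases t) auto
  qed
  then show ?case using journeys_mono[OF t(2)] snoc_path_nonempty[OF snoc.hyps(1)] by auto
qed

lemma reachability_arcs_eq_journeys:
  assumes "labeling E lab" "\<And>t. snapshot edge E lab t \<subseteq> V \<times> V"
    and all: "\<And>e. e \<in> E \<Longrightarrow> lab e \<subseteq> {..T}"
  shows "reachability_arcs edge (before ns) V E lab = journeys ns (snapshot edge E lab) T - Id"
proof -
  have "(\<exists>es. temporal_path edge (before ns) E lab u v es) \<longleftrightarrow> (u, v) \<in> journeys ns (snapshot edge E lab) T" for u v
  proof
    assume "\<exists>es. temporal_path edge (before ns) E lab u v es"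
    then obtain vs es where p: "snoc_path edge (before ns) E lab vs es" "hd vs = u" "last vs = v"
      "temporal_path edge (before ns) E lab u v es"
      by (auto simp: temporal_path_iff_snoc_path)
    from p(4) have "\<forall>t'\<in>snd ` set es. t' \<le> T" using all by (auto simp: temporal_path_def split_beta)
    then show "(u, v) \<in> journeys ns (snapshot edge E lab) T"
      using snoc_path_imp_journeys[OF p(1) assms(1)] p(2,3) by simp
  next
    assume "(u, v) \<in> journeys ns (snapshot edge E lab) T"
    then show "\<exists>es. temporal_path edge (before ns) E lab u v es"
      using journeys_imp_snoc_path[of u v] unfolding temporal_path_iff_snoc_path by blast
  qed
  then show ?thesis
    using journeys_subset[of "snapshot edge E lab" V ns T] assms(2) unfolding reachability_arcs_def by auto
qed

section \<open>The state graph\<close>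

definition nonstrict :: "variant \<Rightarrow> bool" where
  "nonstrict X \<longleftrightarrow> X = Any_Nonstrict \<or> X = Simple_Nonstrict"

definition once :: "variant \<Rightarrow> bool" where
  "once X \<longleftrightarrow> X = Simple_Strict \<or> X = Simple_Nonstrict \<or> X = Happy"

definition separated :: "variant \<Rightarrow> bool" where
  "separated X \<longleftrightarrow> X = Proper \<or> X = Happy"

lemma label_order_eq: "label_order X = before (nonstrict X)"
  by (cases X) (auto simp: nonstrict_def before_def)

text \<open>One condition expresses properness for both kinds of graph: in a symmetric snapshot, two
  distinct edges with a common endpoint give arcs \<open>(u, v)\<close> and \<open>(v, w)\<close>
  with \<open>u \<noteq> w\<close>, while a single edge, or a pair of antiparallel arcs, only allows
  \<open>u = w\<close>.\<close>

definition ok_snapshot :: "bool \<Rightarrow> variant \<Rightarrow> ('a \<times> 'a) set \<Rightarrow> bool" where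
  "ok_snapshot und X F \<longleftrightarrow> (und \<longrightarrow> sym F) \<and>
     (separated X \<longrightarrow> (\<forall>u v w. (u, v) \<in> F \<and> (v, w) \<in> F \<longrightarrow> u = w))"

definition realizable :: "bool \<Rightarrow> variant \<Rightarrow> 'a set \<Rightarrow> ('a \<times> 'a) set \<Rightarrow> bool" where
  "realizable und X V A \<longleftrightarrow> (if und then undirected_realizable X V A else directed_realizable X V A)"

definition schedule :: "bool \<Rightarrow> variant \<Rightarrow> (nat \<Rightarrow> ('a \<times> 'a) set) \<Rightarrow> nat \<Rightarrow> bool" where
  "schedule und X F T \<longleftrightarrow> (\<forall>t. ok_snapshot und X (F t)) \<and> (\<forall>t. t = 0 \<or> T < t \<longrightarrow> F t = {}) \<and>
     (once X \<longrightarrow> (\<forall>t t'. t \<noteq> t' \<longrightarrow> F t \<inter> F t' = {}))"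

text \<open>An arc of \<open>F t\<close> is a journey by itself, and journeys only accumulate;
  irreflexivity keeps it off the removed diagonal.\<close>

lemma schedule_subset:
  assumes "schedule und X F T" "journeys ns F T - Id = A" "irrefl (F t)"
  shows "F t \<subseteq> A"
proof (cases "t = 0 \<or> T < t")
  case True
  then show ?thesis using assms(1) by (auto simp: schedule_def)
next
  case False
  then have "F t \<subseteq> journeys ns F T" using layer_journeys[of t F ns] journeys_mono[of t T ns F] by auto
  then show ?thesis using assms(2,3) by (auto simp: irrefl_def)
qed

lemma labels_bounded:
  assumes "labeling E lab" "finite E"
  shows "\<exists>T. \<forall>e\<in>E. lab e \<subseteq> {..T}"
proof -
  have "finite (\<Union>e\<in>E. lab e)" using assms by (auto simp: labeling_def)
  then obtain T where "\<forall>t\<in>(\<Union>e\<in>E. lab e). t \<le> T" using finite_nat_set_iff_bounded_le by blast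
  then show ?thesis by blast
qed

lemma once_disjoint:
  assumes "simple_labeling E lab" "e \<in> E" "t \<in> lab e" "t' \<in> lab e"
  shows "t = t'"
  using assms by (auto simp: simple_labeling_def card_1_singleton_iff)

lemma directed_realizable_iff_schedule:
  assumes "finite V"
  shows "directed_realizable X V A \<longleftrightarrow>
    (\<exists>F T. schedule False X F T \<and> (\<forall>t. F t \<subseteq> V \<times> V - Id) \<and> journeys (nonstrict X) F T - Id = A)"
proof
  assume "directed_realizable X V A"
  then obtain E lab where E: "simple_digraph V E" "labeling E lab" "admissible_directed X E lab"
      "reachability_arcs id (label_order X) V E lab = A" unfolding directed_realizable_def by blast
  have "finite E" using E(1) finite_subset by (fastforce simp: simple_digraph_def)
  then obtain T where T: "\<And>e. e \<in> E \<Longrightarrow> lab e \<subseteq> {..T}" using labels_bounded[OF E(2)] by blast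
  let ?F = "snapshot id E lab"
  have V: "?F t \<subseteq> V \<times> V - Id" for t using E(1) by (auto simp: snapshot_def simple_digraph_def)
  have out: "?F t = {}" if "T < t" for t using T that by (fastforce simp: snapshot_def)
  have "journeys (nonstrict X) ?F T - Id = A"
    using reachability_arcs_eq_journeys[OF E(2), of id V T "nonstrict X"] out V T E(4)
    unfolding label_order_eq by blast
  moreover have "schedule False X ?F T"
    unfolding schedule_def ok_snapshot_def
  proof (intro conjI allI impI)
    fix t u v w assume "separated X" "(u, v) \<in> ?F t \<and> (v, w) \<in> ?F t"
    moreover have "proper_directed E lab" if "separated X"
      using E(3) that by (cases X) (auto simp: separated_def)
    ultimately show "u = w" unfolding proper_directed_def snapshot_def by auto
  next
    fix t assume "t = 0 \<or> T < t"
    then show "?F t = {}" using out E(2) by (auto simp: snapshot_def labeling_def)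
  next
    fix t t' :: nat assume "once X" "t \<noteq> t'"
    moreover have "simple_labeling E lab" if "once X"
      using E(3) that by (cases X) (auto simp: once_def)
    ultimately show "?F t \<inter> ?F t' = {}" by (auto simp: snapshot_def dest: once_disjoint)
  qed simp
  ultimately show "\<exists>F T. schedule False X F T \<and> (\<forall>t. F t \<subseteq> V \<times> V - Id) \<and> journeys (nonstrict X) F T - Id = A"
    using V by blast
next
  assume "\<exists>F T. schedule False X F T \<and> (\<forall>t. F t \<subseteq> V \<times> V - Id) \<and> journeys (nonstrict X) F T - Id = A"
  then obtain F T where F: "schedule False X F T" "\<And>t. F t \<subseteq> V \<times> V - Id" "journeys (nonstrict X) F T - Id = A"
    by blast
  \<comment> \<open>The complete digraph can host every schedule, since arcs that occur in no
    snapshot receive the empty label set.\<close>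
  define E where "E = V \<times> V - Id"
  define lab where "lab e = {t. e \<in> F t}" for e
  have snap: "snapshot id E lab = F"
    using F(2) by (auto simp: snapshot_def E_def lab_def fun_eq_iff)
  have lt: "t \<le> T" "0 < t" if "e \<in> F t" for e t
    using F(1) that unfolding schedule_def by (metis empty_iff not_less, metis empty_iff neq0_conv)
  have lab: "labeling E lab" using lt unfolding labeling_def lab_def
    by (auto intro!: finite_subset[of _ "{..T}"])
  have "simple_digraph V E" using assms by (auto simp: simple_digraph_def E_def)
  moreover have "reachability_arcs id (label_order X) V E lab = A"
    unfolding label_order_eq F(3)[symmetric] snap[symmetric]
    by (rule reachability_arcs_eq_journeys) (use F(2) lt lab in \<open>auto simp: snap lab_def dest: lt\<close>)
  moreover have "admissible_directed X E lab"
  proof -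
    have "proper_directed E lab" if "separated X"
      using F(1) that unfolding proper_directed_def schedule_def ok_snapshot_def lab_def by auto
    moreover have "simple_labeling E lab" if "once X"
      unfolding simple_labeling_def
    proof (intro ballI impI)
      fix e assume "lab e \<noteq> {}"
      then obtain t where t: "e \<in> F t" by (auto simp: lab_def)
      have "F t' \<inter> F t = {}" if "t' \<noteq> t" for t'
        using F(1) \<open>once X\<close> that unfolding schedule_def by simp
      then have "lab e = {t}" using t unfolding lab_def by blast
      then show "card (lab e) = 1" by simp
    qed
    ultimately show ?thesis by (cases X) (auto simp: separated_def once_def)
  qed
  ultimately show "directed_realizable X V A" unfolding directed_realizable_def using lab by blast
qed

lemma undirected_realizable_iff_schedule:
  assumes "finite V"
  shows "undirected_realizable X V A \<longleftrightarrow>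
    (\<exists>F T. schedule True X F T \<and> (\<forall>t. F t \<subseteq> V \<times> V - Id) \<and> journeys (nonstrict X) F T - Id = A)"
proof
  assume "undirected_realizable X V A"
  then obtain E lab where E: "simple_ugraph V E" "labeling E lab" "admissible_undirected X E lab"
      "reachability_arcs uedge (label_order X) V E lab = A" unfolding undirected_realizable_def by blast
  have "E \<subseteq> Pow V" "finite (Pow V)" using E(1) by (auto simp: simple_ugraph_def)
  then have "finite E" by (rule finite_subset)
  then obtain T where T: "\<And>e. e \<in> E \<Longrightarrow> lab e \<subseteq> {..T}" using labels_bounded[OF E(2)] by blast
  let ?F = "snapshot uedge E lab"
  have V: "?F t \<subseteq> V \<times> V - Id" for t using E(1) by (fastforce simp: snapshot_def simple_ugraph_def uedge_def)
  have out: "?F t = {}" if "T < t" for t using T that by (fastforce simp: snapshot_def)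
  have "journeys (nonstrict X) ?F T - Id = A"
    using reachability_arcs_eq_journeys[OF E(2), of uedge V T "nonstrict X"] out V T E(4)
    unfolding label_order_eq by blast
  moreover have "schedule True X ?F T"
    unfolding schedule_def ok_snapshot_def
  proof (intro conjI allI impI)
    fix t show "sym (?F t)" by (auto simp: sym_def snapshot_def uedge_def insert_commute)
  next
    fix t u v w assume sep: "separated X" and "(u, v) \<in> ?F t \<and> (v, w) \<in> ?F t"
    then have uv: "{u, v} \<in> E" "{v, w} \<in> E" "t \<in> lab {u, v} \<inter> lab {v, w}"
      by (auto simp: snapshot_def uedge_def)
    have "proper_undirected E lab"
      using E(3) sep by (cases X) (auto simp: separated_def)
    then have "{u, v} \<noteq> {v, w} \<and> {u, v} \<inter> {v, w} \<noteq> {} \<longrightarrow> lab {u, v} \<inter> lab {v, w} = {}"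
      using uv(1,2) unfolding proper_undirected_def by simp
    then have "{u, v} = {v, w}" using uv(3) by auto
    then show "u = w" by (auto simp: doubleton_eq_iff)
  next
    fix t assume "t = 0 \<or> T < t"
    then show "?F t = {}" using out E(2) by (auto simp: snapshot_def labeling_def)
  next
    fix t t' :: nat assume "once X" "t \<noteq> t'"
    moreover have "simple_labeling E lab" if "once X"
      using E(3) that by (cases X) (auto simp: once_def)
    ultimately show "?F t \<inter> ?F t' = {}" by (auto simp: snapshot_def dest: once_disjoint)
  qed
  ultimately show "\<exists>F T. schedule True X F T \<and> (\<forall>t. F t \<subseteq> V \<times> V - Id) \<and> journeys (nonstrict X) F T - Id = A"
    using V by blast
next
  assume "\<exists>F T. schedule True X F T \<and> (\<forall>t. F t \<subseteq> V \<times> V - Id) \<and> journeys (nonstrict X) F T - Id = A"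
  then obtain F T where F: "schedule True X F T" "\<And>t. F t \<subseteq> V \<times> V - Id" "journeys (nonstrict X) F T - Id = A"
    by blast
  define E where "E = uedge ` (V \<times> V - Id)"
  define lab where "lab e = {t. \<exists>p\<in>F t. e = uedge p}" for e
  have sym: "(y, x) \<in> F t" if "(x, y) \<in> F t" for x y t
    using F(1) that by (auto simp: schedule_def ok_snapshot_def sym_def)
  \<comment> \<open>Symmetry of the snapshots makes the label set of an edge independent of its
    orientation.\<close>
  have labF: "t \<in> lab (uedge (x, y)) \<longleftrightarrow> (x, y) \<in> F t" for x y t
    using sym[of _ _ t] by (auto simp: lab_def uedge_def doubleton_eq_iff intro!: bexI[of _ "(x, y)"])
  have snap: "snapshot uedge E lab = F"
    using F(2) by (auto simp: snapshot_def E_def labF fun_eq_iff)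
  have lt: "t \<le> T" "0 < t" if "e \<in> F t" for e t
    using F(1) that unfolding schedule_def by (metis empty_iff not_less, metis empty_iff neq0_conv)
  have lab: "labeling E lab" using lt unfolding labeling_def lab_def
    by (auto intro!: finite_subset[of _ "{..T}"])
  have "simple_ugraph V E" using assms by (auto simp: simple_ugraph_def E_def uedge_def)
  moreover have "reachability_arcs uedge (label_order X) V E lab = A"
    unfolding label_order_eq F(3)[symmetric] snap[symmetric]
    by (rule reachability_arcs_eq_journeys) (use F(2) lt lab in \<open>auto simp: snap lab_def dest: lt\<close>)
  moreover have "admissible_undirected X E lab"
  proof -
    have "proper_undirected E lab" if sep: "separated X"
      unfolding proper_undirected_def
    proof (intro ballI impI, rule ccontr)
      fix e f assume ef: "e \<in> E" "f \<in> E" "e \<noteq> f \<and> e \<inter> f \<noteq> {}" "lab e \<inter> lab f \<noteq> {}"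
      \<comment> \<open>Distinct edges with a common endpoint are oriented as a walk through it, the
        form in which \<open>ok_snapshot\<close> speaks of them.\<close>
      then obtain v u w where uvw: "e = uedge (u, v)" "f = uedge (v, w)"
        by (auto simp: E_def uedge_def) (metis insert_commute)+
      obtain t where "(u, v) \<in> F t" "(v, w) \<in> F t" using ef(4) uvw labF by auto
      then have "u = w" using F(1) sep unfolding schedule_def ok_snapshot_def by blast
      then show False using ef(3) uvw by (auto simp: uedge_def)
    qed
    moreover have "simple_labeling E lab" if "once X"
      unfolding simple_labeling_def
    proof (intro ballI impI)
      fix e assume "e \<in> E" "lab e \<noteq> {}"
      then obtain t x y where t: "e = uedge (x, y)" "(x, y) \<in> F t" by (auto simp: lab_def)
      have disj: "F t' \<inter> F t = {}" if "t' \<noteq> t" for t'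
        using F(1) \<open>once X\<close> that unfolding schedule_def by simp
      have uniq: "t' = t" if "(x, y) \<in> F t'" for t'
        using disj[of t'] t(2) that by blast
      have "lab e = {t'. (x, y) \<in> F t'}" unfolding t(1) using labF by blast
      then have "lab e = {t}" using uniq t(2) by blast
      then show "card (lab e) = 1" by simp
    qed
    ultimately show ?thesis by (cases X) (auto simp: separated_def once_def)
  qed
  ultimately show "undirected_realizable X V A" unfolding undirected_realizable_def using lab by blast
qed

text \<open>Confining the snapshots to \<open>A\<close> leaves \<open>2 ^ card A\<close> choices for
  each, whatever the size of \<open>V\<close>.\<close>

lemma realizable_iff_schedule:
  assumes "simple_digraph V A"
  shows "realizable und X V A \<longleftrightarrow>
    (\<exists>F T. schedule und X F T \<and> (\<forall>t. F t \<subseteq> A) \<and> journeys (nonstrict X) F T - Id = A)"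
proof -
  have fin: "finite V" and A: "A \<subseteq> V \<times> V - Id" using assms by (auto simp: simple_digraph_def)
  have "realizable und X V A \<longleftrightarrow>
      (\<exists>F T. schedule und X F T \<and> (\<forall>t. F t \<subseteq> V \<times> V - Id) \<and> journeys (nonstrict X) F T - Id = A)"
    unfolding realizable_def
    using undirected_realizable_iff_schedule[OF fin] directed_realizable_iff_schedule[OF fin] by (cases und) auto
  moreover have "(\<forall>t. F t \<subseteq> V \<times> V - Id) \<longleftrightarrow> (\<forall>t. F t \<subseteq> A)"
    if "schedule und X F T" "journeys (nonstrict X) F T - Id = A" for F T
  proof
    assume "\<forall>t. F t \<subseteq> V \<times> V - Id"
    then have "irrefl (F t)" for t by (auto simp: irrefl_def)
    then show "\<forall>t. F t \<subseteq> A" using schedule_subset[OF that] by blast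
  next
    assume "\<forall>t. F t \<subseteq> A"
    then show "\<forall>t. F t \<subseteq> V \<times> V - Id" using A by blast
  qed
  ultimately show ?thesis by blast
qed

text \<open>States hold off-diagonal pairs only, so that they can be subsets of \<open>A\<close>;
  the identity is restored for the product and removed again.\<close>

definition advance :: "bool \<Rightarrow> ('a \<times> 'a) set \<Rightarrow> ('a \<times> 'a) set \<Rightarrow> ('a \<times> 'a) set" where
  "advance ns F R = (R \<union> Id) O layer ns F - Id"

text \<open>Containment in \<open>A\<close> may be demanded at every step because realized arcs are
  never lost. Without \<open>once\<close> the second component stays empty, so the same pairs serve
  all variants.\<close>

inductive_set states :: "bool \<Rightarrow> variant \<Rightarrow> ('a \<times> 'a) set \<Rightarrow> (('a \<times> 'a) set \<times> ('a \<times> 'a) set) set"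
  for und X A where
  start: "({}, {}) \<in> states und X A"
| step: "(advance (nonstrict X) F R, if once X then U \<union> F else U) \<in> states und X A"
  if "(R, U) \<in> states und X A" "F \<subseteq> A" "ok_snapshot und X F" "once X \<longrightarrow> F \<inter> U = {}"
    "advance (nonstrict X) F R \<subseteq> A"

lemma states_subset: "(R, U) \<in> states und X A \<Longrightarrow> R \<subseteq> A \<and> U \<subseteq> A"
  by (induction rule: states.induct) auto

lemma journeys_Suc_advance:
  "journeys ns F (Suc t) - Id = advance ns (F (Suc t)) (journeys ns F t - Id)"
proof -
  have "journeys ns F t - Id \<union> Id = journeys ns F t" using journeys_refl[of ns F t] by blast
  then show ?thesis by (simp add: advance_def)
qed

text \<open>Along a schedule, \<open>U\<close> is the union of the snapshots so far. Conversely, a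
  derivation of a state is turned into a schedule by appending its snapshots one at a time.\<close>

lemma realizable_iff_states:
  assumes "simple_digraph V A"
  shows "realizable und X V A \<longleftrightarrow> (\<exists>U. (A, U) \<in> states und X A)"
proof
  assume "realizable und X V A"
  then obtain F T where F: "schedule und X F T" "\<And>t. F t \<subseteq> A" "journeys (nonstrict X) F T - Id = A"
    unfolding realizable_iff_schedule[OF assms] by blast
  have F0: "F 0 = {}" using F(1) by (auto simp: schedule_def)
  have "t \<le> T \<Longrightarrow> (journeys (nonstrict X) F t - Id, if once X then \<Union>i\<le>t. F i else {}) \<in> states und X A" for t
  proof (induction t)
    case 0
    then show ?case using F0 states.start by auto
  next
    case (Suc t)
    define J where "J = journeys (nonstrict X) F t - Id"
    have "journeys (nonstrict X) F (Suc t) - Id \<subseteq> A"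
      using journeys_mono[OF Suc.prems, of "nonstrict X" F] F(3) by blast
    then have sub: "advance (nonstrict X) (F (Suc t)) J \<subseteq> A"
      by (simp only: journeys_Suc_advance J_def)
    have "F (Suc t) \<inter> F i = {}" if "once X" "i \<le> t" for i
    proof -
      have "Suc t \<noteq> i" using that by simp
      then show ?thesis using F(1) that unfolding schedule_def by blast
    qed
    then have disj: "once X \<longrightarrow> F (Suc t) \<inter> (\<Union>i\<le>t. F i) = {}" by blast
    have UN: "(\<Union>i\<le>Suc t. F i) = (\<Union>i\<le>t. F i) \<union> F (Suc t)" by (auto simp: atMost_Suc)
    have ok: "ok_snapshot und X (F (Suc t))" using F(1) by (simp add: schedule_def)
    have IH: "(J, if once X then \<Union>i\<le>t. F i else {}) \<in> states und X A"
      using Suc unfolding J_def by simp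
    have "(advance (nonstrict X) (F (Suc t)) J, if once X then \<Union>i\<le>Suc t. F i else {}) \<in> states und X A"
      using states.step[OF IH F(2) ok _ sub] disj UN by (cases "once X") simp_all
    then show ?case unfolding journeys_Suc_advance J_def .
  qed
  from this[of T] show "\<exists>U. (A, U) \<in> states und X A" using F(3) by auto
next
  have "\<exists>F T. schedule und X F T \<and> (\<forall>t. F t \<subseteq> A) \<and> journeys (nonstrict X) F T - Id = R \<and> (once X \<longrightarrow> U = (\<Union>t. F t))"
    if "(R, U) \<in> states und X A" for R U
    using that
  proof (induction rule: states.induct)
    case start
    show ?case by (rule exI[of _ "\<lambda>_. {}"], rule exI[of _ 0]) (auto simp: schedule_def ok_snapshot_def sym_def)
  next
    case (step R U G)
    then obtain F T where F: "schedule und X F T" "\<And>t. F t \<subseteq> A" "journeys (nonstrict X) F T - Id = R"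
      "once X \<longrightarrow> U = (\<Union>t. F t)" by blast
    \<comment> \<open>The time \<open>Suc T\<close> is free, since a schedule of length
      \<open>T\<close> is empty beyond \<open>T\<close>.\<close>
    let ?F = "F(Suc T := G)"
    have e: "F (Suc T) = {}" using F(1) by (auto simp: schedule_def)
    have "schedule und X ?F (Suc T)"
      unfolding schedule_def
    proof (intro conjI allI impI)
      fix t show "ok_snapshot und X (?F t)" using F(1) step.hyps(3) by (simp add: schedule_def)
    next
      fix t assume "t = 0 \<or> Suc T < t"
      then show "?F t = {}" using F(1) by (auto simp: schedule_def)
    next
      fix t t' :: nat assume once: "once X" "t \<noteq> t'"
      then have "G \<inter> F i = {}" for i using F(4) step.hyps(4) by blast
      moreover have "F t \<inter> F t' = {}" using F(1) once by (simp add: schedule_def)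
      ultimately show "?F t \<inter> ?F t' = {}" using once(2) by (simp add: Int_commute)
    qed
    moreover have "\<forall>t. ?F t \<subseteq> A" using F(2) step.hyps(2) by simp
    moreover have "journeys (nonstrict X) ?F T = journeys (nonstrict X) F T" by (rule journeys_cong) auto
    then have "journeys (nonstrict X) ?F (Suc T) - Id = advance (nonstrict X) G R"
      unfolding journeys_Suc_advance using F(3) by simp
    moreover have "(\<Union>t. ?F t) = (\<Union>t. F t) \<union> G"
    proof -
      have "(\<Union>t. F t) = F (Suc T) \<union> (\<Union>t\<in>UNIV - {Suc T}. F t)" by blast
      then show ?thesis using e by (simp add: fun_upd_image Un_commute del: fun_upd_apply)
    qed
    then have "once X \<longrightarrow> (if once X then U \<union> G else U) = (\<Union>t. ?F t)" using F(4) by simp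
    ultimately show ?case by (intro exI[of _ ?F] exI[of _ "Suc T"] conjI)
  qed
  moreover assume "\<exists>U. (A, U) \<in> states und X A"
  ultimately show "realizable und X V A" unfolding realizable_iff_schedule[OF assms] by blast
qed

section \<open>Marking the reachable states\<close>

definition prolong :: "('a \<times> 'a) set \<Rightarrow> ('a \<times> 'a) set \<Rightarrow> ('a \<times> 'a) set" where
  "prolong F R = R \<union> F \<union> {(u, w). u \<noteq> w \<and> (\<exists>v. (u, v) \<in> R \<and> (v, w) \<in> F)}"

lemma prolong_mono: "R \<subseteq> prolong F R"
  by (auto simp: prolong_def)

lemma prolong_eq:
  assumes "irrefl F" "R \<inter> Id = {}"
  shows "prolong F R = (R \<union> Id) O F\<^sup>= - Id"
  using assms by (auto simp: prolong_def irrefl_def)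

text \<open>Dropping the diagonal in every round loses nothing: the product computed so far contains
  the identity, so restoring the diagonal recovers it completely.\<close>

lemma prolong_funpow:
  assumes "irrefl F" "R \<inter> Id = {}"
  shows "(prolong F ^^ k) R = (R \<union> Id) O (F\<^sup>=) ^^ k - Id"
proof (induction k)
  case 0
  then show ?case using assms(2) by auto
next
  case (Suc k)
  define M where "M = (R \<union> Id) O (F\<^sup>=) ^^ k"
  have "Id \<subseteq> (F\<^sup>=) ^^ k" by (induction k) auto
  then have "Id \<subseteq> M" by (auto simp: M_def)
  then have "M - Id \<union> Id = M" by blast
  moreover have "(prolong F ^^ Suc k) R = prolong F (M - Id)" using Suc by (simp add: M_def)
  ultimately have "(prolong F ^^ Suc k) R = M O F\<^sup>= - Id"
    using prolong_eq[OF assms(1), of "M - Id"] by auto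
  then show ?case by (simp add: M_def O_assoc)
qed

text \<open>Pairs in the star of a finite relation are joined by chains of at most
  \<open>card F\<close> arcs, and shorter chains are padded by reflexivity. A strict factor is a
  single round.\<close>

lemma advance_eq_prolong_funpow:
  assumes "irrefl F" "R \<inter> Id = {}" "finite F" "card F \<le> m"
  shows "advance ns F R = (prolong F ^^ (if ns then m else 1)) R"
proof -
  have "layer ns F = (F\<^sup>=) ^^ (if ns then m else 1)"
  proof (cases ns)
    case False
    then show ?thesis by (simp add: layer_def)
  next
    case True
    have "F\<^sup>* = (F\<^sup>=) ^^ m"
    proof
      have refl_mono: "(F\<^sup>=) ^^ i \<subseteq> (F\<^sup>=) ^^ j" if "i \<le> j" for i j
        by (rule lift_Suc_mono_le[OF _ that]) auto
      have "F ^^ i \<subseteq> (F\<^sup>=) ^^ i" for i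
        by (induction i) auto
      then have "F ^^ i \<subseteq> (F\<^sup>=) ^^ m" if "i \<le> card F" for i
        using refl_mono[of i m] that assms(4) by fastforce
      then show "F\<^sup>* \<subseteq> (F\<^sup>=) ^^ m"
        unfolding rtrancl_finite_eq_relpow[OF assms(3)] by blast
      show "(F\<^sup>=) ^^ m \<subseteq> F\<^sup>*"
        using relpow_imp_rtrancl[of _ m "F\<^sup>="] by auto
    qed
    then show ?thesis using True by (simp add: layer_def)
  qed
  then show ?thesis unfolding advance_def prolong_funpow[OF assms(1,2)] by simp
qed

section \<open>Bit codes of arc sets and states\<close>

locale arc_list =
  fixes as :: "('a \<times> 'a) list"
  assumes distinct: "distinct as" and loopfree: "(v, v) \<notin> set as"
begin

abbreviation m :: nat where "m \<equiv> length as"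
abbreviation A :: "('a \<times> 'a) set" where "A \<equiv> set as"

text \<open>Only the lowest \<open>m\<close> bits are read, which lets further fields of a packed
  number sit above them.\<close>

definition arcs_of :: "nat \<Rightarrow> ('a \<times> 'a) set" where
  "arcs_of x = {as ! i | i. i < m \<and> bit x i}"

definition code :: "('a \<times> 'a) set \<Rightarrow> nat" where
  "code N = horner_sum of_bool 2 (map (\<lambda>p. p \<in> N) as)"

lemma arcs_of_subset: "arcs_of x \<subseteq> A"
  by (auto simp: arcs_of_def)

lemma arcs_of_iff: "i < m \<Longrightarrow> as ! i \<in> arcs_of x \<longleftrightarrow> bit x i"
  using distinct by (auto simp: arcs_of_def nth_eq_iff_index_eq)

lemma arcs_of_0 [simp]: "arcs_of 0 = {}"
  by (simp add: arcs_of_def)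

text \<open>The Horner form gives access to bits; this form is what a loop with a doubling weight
  accumulates.\<close>

lemma code_sum: "code N = (\<Sum>i<m. of_bool (as ! i \<in> N) * 2 ^ i)"
  unfolding code_def horner_sum_eq_sum by (simp add: atLeast0LessThan)

lemma arcs_of_code: "N \<subseteq> A \<Longrightarrow> arcs_of (code N) = N"
proof -
  assume N: "N \<subseteq> A"
  have "arcs_of (code N) = {as ! i | i. i < m \<and> as ! i \<in> N}"
    by (auto simp: arcs_of_def code_def bit_horner_sum_bit_iff)
  then show ?thesis using N by (fastforce simp: in_set_conv_nth)
qed

lemma code_arcs_of: "code (arcs_of x) = x mod 2 ^ m"
proof -
  have "map (\<lambda>p. p \<in> arcs_of x) as = map (bit x) [0..<m]"
    by (rule nth_equalityI) (simp_all add: arcs_of_iff)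
  then show ?thesis by (simp add: code_def horner_sum_bit_eq_take_bit take_bit_eq_mod)
qed

lemma code_less: "code N < 2 ^ m"
  unfolding code_def using horner_sum_of_bool_2_less[of "map (\<lambda>p. p \<in> N) as"] by simp

lemma code_empty [simp]: "code {} = 0"
  by (simp add: code_sum)

lemma code_mono: "N \<subseteq> N' \<Longrightarrow> code N \<le> code N'"
  unfolding code_sum by (rule sum_mono) auto

text \<open>Reachable set, used arcs and the snapshot to be added occupy \<open>m\<close> bits each.\<close>

definition pair_code :: "('a \<times> 'a) set \<times> ('a \<times> 'a) set \<Rightarrow> nat" where
  "pair_code S = code (fst S) + 2 ^ m * code (snd S)"

definition state_of :: "nat \<Rightarrow> ('a \<times> 'a) set \<times> ('a \<times> 'a) set" where
  "state_of s = (arcs_of s, arcs_of (s div 2 ^ m))"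

lemma pair_code_less: "pair_code S < 4 ^ m"
proof -
  have "pair_code S < 2 ^ m + 2 ^ m * code (snd S)"
    using code_less unfolding pair_code_def by simp
  also have "\<dots> = 2 ^ m * (code (snd S) + 1)" by simp
  also have "\<dots> \<le> 2 ^ m * 2 ^ m" using code_less[of "snd S"] by (intro mult_le_mono2) simp
  finally show ?thesis by (simp add: power_mult_distrib[symmetric])
qed

lemma pair_code_mono: "R \<subseteq> R' \<Longrightarrow> U \<subseteq> U' \<Longrightarrow> pair_code (R, U) \<le> pair_code (R', U')"
  unfolding pair_code_def by (auto intro!: add_mono mult_le_mono2 code_mono)

lemma arcs_of_add: "x < 2 ^ m \<Longrightarrow> arcs_of (x + 2 ^ m * y) = arcs_of x"
  by (metis arcs_of_code arcs_of_subset code_arcs_of mod_mult_self2)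

lemma state_of_pair_code: "R \<subseteq> A \<Longrightarrow> U \<subseteq> A \<Longrightarrow> state_of (pair_code (R, U)) = (R, U)"
  using code_less[of R] by (simp add: state_of_def pair_code_def arcs_of_add arcs_of_code)

lemma pair_code_state_of: "s < 4 ^ m \<Longrightarrow> pair_code (state_of s) = s"
proof -
  assume "s < 4 ^ m"
  then have "s < 2 ^ m * 2 ^ m" by (simp add: power_mult_distrib[symmetric])
  then have "s div 2 ^ m < 2 ^ m" by (simp add: less_mult_imp_div_less)
  then show ?thesis by (simp add: pair_code_def state_of_def code_arcs_of)
qed

section \<open>The ascending pass over all steps\<close>

context
  fixes und :: bool and X :: variant
begin

text \<open>\<open>z\<close> numbers a step, with the snapshot in its low \<open>m\<close> bits and
  the source state above. With the state in the high part, all steps that leave it are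
  consecutive.\<close>

definition valid :: "nat \<Rightarrow> bool" where
  "valid z \<longleftrightarrow> ok_snapshot und X (arcs_of z) \<and>
     (once X \<longrightarrow> arcs_of z \<inter> snd (state_of (z div 2 ^ m)) = {}) \<and>
     advance (nonstrict X) (arcs_of z) (fst (state_of (z div 2 ^ m))) \<subseteq> A"

definition successor :: "nat \<Rightarrow> ('a \<times> 'a) set \<times> ('a \<times> 'a) set" where
  "successor z = (let (R, U) = state_of (z div 2 ^ m) in
     (advance (nonstrict X) (arcs_of z) R, if once X then U \<union> arcs_of z else U))"

text \<open>The code of a successor is at least the code of the state, so one ascending pass suffices.\<close>

primrec marked :: "nat \<Rightarrow> nat set" where
  "marked 0 = {0}"
| "marked (Suc z) = (if z div 2 ^ m \<in> marked z \<and> valid z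
     then insert (pair_code (successor z)) (marked z) else marked z)"

lemma marked_mono: "z \<le> z' \<Longrightarrow> marked z \<subseteq> marked z'"
  by (rule lift_Suc_mono_le[of marked]) auto

lemma marked_states: "s \<in> marked z \<Longrightarrow> state_of s \<in> states und X A"
proof (induction z arbitrary: s)
  case 0
  then show ?case using states.start[of und X A] by (simp add: state_of_def)
next
  case (Suc z)
  show ?case
  proof (cases "s \<in> marked z")
    case False
    then have z: "z div 2 ^ m \<in> marked z" "valid z" "s = pair_code (successor z)"
      using Suc.prems by (auto split: if_splits)
    obtain R U where RU: "state_of (z div 2 ^ m) = (R, U)" by fastforce
    have "(R, U) \<in> states und X A" using Suc.IH[OF z(1)] RU by simp
    then have succ: "successor z \<in> states und X A"
      using z(2) RU arcs_of_subset unfolding successor_def valid_def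
      by (simp only: Let_def split fst_conv snd_conv) (rule states.step; simp)
    then have "state_of s = successor z"
      using z(3) states_subset[of "fst (successor z)" "snd (successor z)"]
        state_of_pair_code[of "fst (successor z)" "snd (successor z)"] by simp
    then show ?thesis using succ by simp
  qed (use Suc.IH in blast)
qed

lemma advance_mono: "R \<inter> Id = {} \<Longrightarrow> R \<subseteq> advance ns F R"
  using layer_refl[of ns F] by (fastforce simp: advance_def)

lemma subset_loopfree: "N \<subseteq> A \<Longrightarrow> N \<inter> Id = {}" "N \<subseteq> A \<Longrightarrow> irrefl N"
  using loopfree by (auto simp: irrefl_def)

lemma div_bounds: "F \<subseteq> A \<Longrightarrow> (code F + 2 ^ m * s) div 2 ^ m = s"
  using code_less[of F] by simp

text \<open>The time \<open>2 ^ m * pair_code (R, U)\<close> is the beginning of the block of steps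
  that leave \<open>(R, U)\<close>. A step that raises the code lies in an earlier block than the
  steps of its target, so the target is marked in time; if the code stays the same, the induction
  hypothesis already covers it.\<close>

lemma states_marked: "(R, U) \<in> states und X A \<Longrightarrow> pair_code (R, U) \<in> marked (2 ^ m * pair_code (R, U))"
proof (induction rule: states.induct)
  case start
  then show ?case by (simp add: pair_code_def)
next
  case (step R U F)
  define s where "s = pair_code (R, U)"
  define z where "z = code F + 2 ^ m * s"
  have RU: "R \<subseteq> A" "U \<subseteq> A" using states_subset[OF step.hyps(1)] by auto
  have zs: "z div 2 ^ m = s" unfolding z_def using div_bounds step.hyps(2) by blast
  have st: "state_of s = (R, U)" using state_of_pair_code RU by (simp add: s_def)
  have F: "arcs_of z = F" using code_less[of F] arcs_of_code step.hyps(2) by (simp add: z_def arcs_of_add)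
  have succ: "successor z = (advance (nonstrict X) F R, if once X then U \<union> F else U)"
    by (simp add: successor_def zs st F)
  have "valid z" using step.hyps by (simp add: valid_def zs st F)
  moreover have "s \<in> marked z" using step.IH marked_mono[of "2 ^ m * s" z] by (auto simp: s_def z_def)
  ultimately have new: "pair_code (successor z) \<in> marked (Suc z)" by (simp add: zs)
  show ?case
  proof (cases "pair_code (successor z) = s")
    case True
    then show ?thesis using step.IH succ by (simp add: s_def)
  next
    case False
    have "s \<le> pair_code (successor z)"
      unfolding s_def succ using advance_mono[OF subset_loopfree(1)[OF RU(1)]] by (intro pair_code_mono) auto
    then have "s + 1 \<le> pair_code (successor z)" using False by simp
    then have "2 ^ m * (s + 1) \<le> 2 ^ m * pair_code (successor z)" by (rule mult_le_mono2)
    moreover have "Suc z \<le> 2 ^ m * (s + 1)" using code_less[of F] by (simp add: z_def)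
    ultimately have "Suc z \<le> 2 ^ m * pair_code (successor z)" by linarith
    then have "pair_code (successor z) \<in> marked (2 ^ m * pair_code (successor z))"
      using new marked_mono by blast
    then show ?thesis by (simp add: succ)
  qed
qed

text \<open>The pass inspects only targets of steps. The step with the empty snapshot is always
  admissible and makes a state with \<open>R = A\<close> its own target; this includes the start
  state when \<open>A\<close> is empty.\<close>

lemma realizable_iff_marked:
  assumes "simple_digraph V A"
  shows "realizable und X V A \<longleftrightarrow>
    (\<exists>z<8 ^ m. z div 2 ^ m \<in> marked z \<and> valid z \<and> fst (successor z) = A)"
proof
  assume "realizable und X V A"
  then obtain U where U: "(A, U) \<in> states und X A" unfolding realizable_iff_states[OF assms] by blast
  define s where "s = pair_code (A, U)"
  have UA: "U \<subseteq> A" using states_subset[OF U] by simp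
  have st: "state_of s = (A, U)" using state_of_pair_code UA by (simp add: s_def)
  have zs: "2 ^ m * s div 2 ^ m = s" by simp
  have F: "arcs_of (2 ^ m * s) = {}" using arcs_of_add[of 0 s] by simp
  have adv: "advance (nonstrict X) {} A = A"
    using subset_loopfree(1)[of A] by (auto simp: advance_def)
  have "s < 4 ^ m" unfolding s_def by (rule pair_code_less)
  then have "2 ^ m * s < 2 ^ m * 4 ^ m" by simp
  then have "2 ^ m * s < 8 ^ m" by (simp add: power_mult_distrib[symmetric])
  moreover have "valid (2 ^ m * s)" by (simp add: valid_def zs st F adv ok_snapshot_def)
  moreover have "fst (successor (2 ^ m * s)) = A" by (simp add: successor_def zs st F adv)
  moreover have "s \<in> marked (2 ^ m * s)" using states_marked[OF U] by (simp add: s_def)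
  ultimately show "\<exists>z<8 ^ m. z div 2 ^ m \<in> marked z \<and> valid z \<and> fst (successor z) = A"
    using zs by metis
next
  assume "\<exists>z<8 ^ m. z div 2 ^ m \<in> marked z \<and> valid z \<and> fst (successor z) = A"
  then obtain z where z: "z div 2 ^ m \<in> marked z" "valid z" "fst (successor z) = A" by blast
  obtain R U where RU: "state_of (z div 2 ^ m) = (R, U)" by fastforce
  have "(R, U) \<in> states und X A" using marked_states[OF z(1)] RU by simp
  then have "(advance (nonstrict X) (arcs_of z) R, if once X then U \<union> arcs_of z else U) \<in> states und X A"
    using z(2) RU arcs_of_subset unfolding valid_def by (intro states.step) simp_all
  moreover have "advance (nonstrict X) (arcs_of z) R = A"
    using z(3) RU by (simp add: successor_def)
  ultimately show "realizable und X V A" unfolding realizable_iff_states[OF assms] by auto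
qed

end

end

section \<open>A language with bounded loops\<close>

datatype exp =
    Num nat
  | Var nat
  | Bnd nat
  | Plus exp exp
  | Minus exp exp
  | Arr nat exp
  | Inp exp
  | Ex nat nat exp

datatype com =
    Skip
  | Set nat exp
  | Sto nat exp exp
  | Seq com com
  | If exp com com
  | For nat nat com

record st =
  vars :: "nat \<Rightarrow> nat"
  arrs :: "nat \<Rightarrow> nat \<Rightarrow> nat"
  inp :: "nat \<Rightarrow> nat"

primrec ev :: "exp \<Rightarrow> st \<Rightarrow> (nat \<Rightarrow> nat) \<Rightarrow> nat" where
  "ev (Num c) s \<rho> = c"
| "ev (Var x) s \<rho> = vars s x"
| "ev (Bnd k) s \<rho> = \<rho> k"
| "ev (Plus a b) s \<rho> = ev a s \<rho> + ev b s \<rho>"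
| "ev (Minus a b) s \<rho> = ev a s \<rho> - ev b s \<rho>"
| "ev (Arr a e) s \<rho> = arrs s a (ev e s \<rho>)"
| "ev (Inp e) s \<rho> = inp s (ev e s \<rho>)"
| "ev (Ex k b e) s \<rho> = of_bool (\<exists>i<vars s b. ev e s (\<rho>(k := i)) \<noteq> 0)"

abbreviation cev :: "exp \<Rightarrow> st \<Rightarrow> nat" where
  "cev e s \<equiv> ev e s (\<lambda>_. 0)"

definition upd :: "nat \<Rightarrow> nat \<Rightarrow> st \<Rightarrow> st" where
  "upd x v s = s\<lparr>vars := (vars s)(x := v)\<rparr>"

definition upda :: "nat \<Rightarrow> nat \<Rightarrow> nat \<Rightarrow> st \<Rightarrow> st" where
  "upda a i v s = s\<lparr>arrs := (arrs s)(a := (arrs s a)(i := v))\<rparr>"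

text \<open>The number of rounds is fixed on entry, so the semantics is total. Compiled code reads
  the bound again in each round; \<open>wf_com\<close> makes the two agree.\<close>

primrec den :: "com \<Rightarrow> st \<Rightarrow> st" where
  "den Skip s = s"
| "den (Set x e) s = upd x (cev e s) s"
| "den (Sto a e f) s = upda a (cev e s) (cev f s) s"
| "den (Seq c d) s = den d (den c s)"
| "den (If e c d) s = (if cev e s \<noteq> 0 then den c s else den d s)"
| "den (For i b c) s = ((\<lambda>s'. upd i (Suc (vars s' i)) (den c s')) ^^ vars s b) (upd i 0 s)"

lemma upd_simps [simp]:
  "vars (upd x v s) = (vars s)(x := v)" "arrs (upd x v s) = arrs s" "inp (upd x v s) = inp s"
  "vars (upda a i v s) = vars s" "arrs (upda a i v s) = (arrs s)(a := (arrs s a)(i := v))"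
  "inp (upda a i v s) = inp s"
  by (simp_all add: upd_def upda_def)

text \<open>Binders carry de Bruijn levels, so that nested quantifiers never overwrite each other's register.
  Loop bounds belong to \<open>B\<close> and active loop counters to \<open>L\<close>; neither may be assigned.\<close>

primrec wfe :: "nat set \<Rightarrow> nat \<Rightarrow> exp \<Rightarrow> bool" where
  "wfe B d (Num c) \<longleftrightarrow> True"
| "wfe B d (Var x) \<longleftrightarrow> True"
| "wfe B d (Bnd k) \<longleftrightarrow> k < d"
| "wfe B d (Plus a b) \<longleftrightarrow> wfe B d a \<and> wfe B d b"
| "wfe B d (Minus a b) \<longleftrightarrow> wfe B d a \<and> wfe B d b"
| "wfe B d (Arr a e) \<longleftrightarrow> 0 < a \<and> a < 16 \<and> wfe B d e"
| "wfe B d (Inp e) \<longleftrightarrow> wfe B d e"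
| "wfe B d (Ex k b e) \<longleftrightarrow> k = d \<and> b \<in> B \<and> wfe B (Suc k) e"

primrec wf_com :: "nat set \<Rightarrow> nat set \<Rightarrow> com \<Rightarrow> bool" where
  "wf_com B L Skip \<longleftrightarrow> True"
| "wf_com B L (Set x e) \<longleftrightarrow> x \<notin> B \<and> x \<notin> L \<and> wfe B 0 e"
| "wf_com B L (Sto a e f) \<longleftrightarrow> 0 < a \<and> a < 16 \<and> wfe B 0 e \<and> wfe B 0 f"
| "wf_com B L (Seq c d) \<longleftrightarrow> wf_com B L c \<and> wf_com B L d"
| "wf_com B L (If e c d) \<longleftrightarrow> wfe B 0 e \<and> wf_com B L c \<and> wf_com B L d"
| "wf_com B L (For i b c) \<longleftrightarrow> i \<notin> B \<and> i \<notin> L \<and> b \<in> B \<and> wf_com B (insert i L) c"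

lemma den_inp [simp]: "inp (den c s) = inp s"
proof (induction c arbitrary: s)
  case (For i b c)
  have "inp (((\<lambda>s'. upd i (Suc (vars s' i)) (den c s')) ^^ k) s') = inp s'" for k s'
    by (induction k) (simp_all add: For.IH)
  then show ?case by simp
qed simp_all

lemma den_protected: "wf_com B L c \<Longrightarrow> x \<in> B \<union> L \<Longrightarrow> vars (den c s) x = vars s x"
proof (induction c arbitrary: s L)
  case (For i b c)
  have "vars (((\<lambda>s'. upd i (Suc (vars s' i)) (den c s')) ^^ k) s') x = vars s' x" for k s'
    using For.prems by (induction k) (auto simp: For.IH[of "insert i L"])
  then show ?case using For.prems by auto
qed auto

text \<open>A round increments the value that the counter had before the body, so the counter equals
  the round number whatever \<open>c\<close> does to it.\<close>

lemma den_For_invariant: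
  assumes "I 0 (upd i 0 s)"
    and "\<And>k s'. k < vars s b \<Longrightarrow> I k s' \<Longrightarrow> vars s' i = k \<Longrightarrow> I (Suc k) (upd i (Suc k) (den c s'))"
  shows "I (vars s b) (den (For i b c) s)"
proof -
  have "k \<le> vars s b \<Longrightarrow>
      I k (((\<lambda>s'. upd i (Suc (vars s' i)) (den c s')) ^^ k) (upd i 0 s)) \<and>
      vars (((\<lambda>s'. upd i (Suc (vars s' i)) (den c s')) ^^ k) (upd i 0 s)) i = k" for k
  proof (induction k)
    case 0
    then show ?case using assms(1) by simp
  next
    case (Suc k)
    then show ?case using assms(2)[of k] by simp
  qed
  then show ?thesis by simp
qed

section \<open>Compilation to machine code\<close>

text \<open>The residues modulo 3 give three disjoint unbounded register banks: variables,
  quantified positions and temporaries. \<open>vr 0\<close> is register 0, where the answer is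
  expected.\<close>

definition vr :: "nat \<Rightarrow> nat" where "vr x = 3 * x"
definition br :: "nat \<Rightarrow> nat" where "br x = 3 * x + 1"
definition tr :: "nat \<Rightarrow> nat" where "tr x = 3 * x + 2"

lemma reg_eq [simp]:
  "vr x = vr y \<longleftrightarrow> x = y" "br x = br y \<longleftrightarrow> x = y" "tr x = tr y \<longleftrightarrow> x = y"
  "vr x \<noteq> br y" "vr x \<noteq> tr y" "br x \<noteq> vr y" "br x \<noteq> tr y" "tr x \<noteq> vr y" "tr x \<noteq> br y"
  unfolding vr_def br_def tr_def by presburger+

text \<open>Four doublings multiply the index by 16, since there is no multiplication. The arrays
  are interleaved with stride 16, so that each of them is unbounded, and start at the offset in
  \<open>tr 0\<close>.\<close>

definition address :: "nat \<Rightarrow> nat \<Rightarrow> nat \<Rightarrow> instr list" where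
  "address a j t =
     [Add (tr j) (tr j) (tr j), Add (tr j) (tr j) (tr j), Add (tr j) (tr j) (tr j),
      Add (tr j) (tr j) (tr j), Const (tr t) a, Add (tr j) (tr j) (tr t), Add (tr j) (tr j) (tr 0)]"

lemma length_address [simp]: "length (address a j t) = 7"
  by (simp add: address_def)

text \<open>The value of an expression ends up in \<open>tr j\<close>; registers \<open>tr j'\<close> with \<open>j' > j\<close> are scratch.  Input
  addresses are clamped to the offset in \<open>tr 0\<close>, where the memory contains \<open>0\<close>.\<close>

primrec ecode :: "exp \<Rightarrow> nat \<Rightarrow> nat \<Rightarrow> instr list" where
  "ecode (Num c) p j = [Const (tr j) c]"
| "ecode (Var x) p j = [Const (tr j) 0, Add (tr j) (tr j) (vr x)]"
| "ecode (Bnd k) p j = [Const (tr j) 0, Add (tr j) (tr j) (br k)]"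
| "ecode (Plus a b) p j =
     ecode a p j @ ecode b (p + length (ecode a p j)) (Suc j) @ [Add (tr j) (tr j) (tr (Suc j))]"
| "ecode (Minus a b) p j =
     ecode a p j @ ecode b (p + length (ecode a p j)) (Suc j) @ [Sub (tr j) (tr j) (tr (Suc j))]"
| "ecode (Arr a e) p j = ecode e p j @ address a j (Suc j) @ [Load (tr j) (tr j)]"
| "ecode (Inp e) p j =
     ecode e p j @ [Sub (tr (Suc j)) (tr j) (tr 0), Sub (tr j) (tr j) (tr (Suc j)), Load (tr j) (tr j)]"
| "ecode (Ex k b e) p j =
     (let q = Suc (Suc (Suc (Suc p))); body = ecode e q (Suc j); r = q + length body in
      [Const (tr j) 0, Const (br k) 0, Sub (tr (Suc j)) (vr b) (br k), JumpZ (tr (Suc j)) (r + 5)] @ body @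
      [JumpZ (tr (Suc j)) (Suc (Suc r)), Const (tr j) 1, Const (tr (Suc j)) 1,
       Add (br k) (br k) (tr (Suc j)), Jump (Suc (Suc p))])"

text \<open>Temporaries are taken from \<open>tr 1\<close> on, because \<open>tr 0\<close> holds the
  memory offset. Adding a zero register serves as a move.\<close>

primrec ccode :: "com \<Rightarrow> nat \<Rightarrow> instr list" where
  "ccode Skip p = []"
| "ccode (Set x e) p = ecode e p 1 @ [Const (tr 2) 0, Add (vr x) (tr 1) (tr 2)]"
| "ccode (Sto a e f) p =
     ecode e p 1 @ ecode f (p + length (ecode e p 1)) 2 @ address a 1 3 @ [Store (tr 1) (tr 2)]"
| "ccode (Seq c d) p = ccode c p @ ccode d (p + length (ccode c p))"
| "ccode (If e c d) p =
     (let q = p + length (ecode e p 1) + 1; C = ccode c q; D = ccode d (q + length C + 1) in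
      ecode e p 1 @ [JumpZ (tr 1) (q + length C + 1)] @ C @ [Jump (q + length C + 1 + length D)] @ D)"
| "ccode (For i b c) p =
     (let q = Suc (Suc (Suc p)); body = ccode c q; r = q + length body in
      [Const (vr i) 0, Sub (tr 1) (vr b) (vr i), JumpZ (tr 1) (r + 3)] @ body @
      [Const (tr 1) 1, Add (vr i) (vr i) (tr 1), Jump (Suc p)])"

section \<open>Executing code fragments within a time budget\<close>

definition code_at :: "instr list \<Rightarrow> nat \<Rightarrow> instr list \<Rightarrow> bool" where
  "code_at P p xs \<longleftrightarrow> (\<forall>i<length xs. p + i < length P \<and> P ! (p + i) = xs ! i)"

lemma code_at_Nil [simp]: "code_at P p []"
  by (simp add: code_at_def)

lemma code_at_Cons [simp]:
  "code_at P p (x # xs) \<longleftrightarrow> p < length P \<and> P ! p = x \<and> code_at P (Suc p) xs"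
  by (auto simp: code_at_def All_less_Suc2)

lemma code_at_append [simp]:
  "code_at P p (xs @ ys) \<longleftrightarrow> code_at P p xs \<and> code_at P (p + length xs) ys"
  by (induction xs arbitrary: p) auto

lemma code_at_middle: "code_at (xs @ ys @ zs) (length xs) ys"
  by (simp add: code_at_def nth_append)

lemma config_update_swap: "c\<lparr>regs := r, pc := p\<rparr> = c\<lparr>pc := p, regs := r\<rparr>"
  by simp

text \<open>A total-correctness judgement with costs: it composes sequentially by adding budgets, as
  in \<open>runs_trans\<close>.\<close>

definition runs :: "instr list \<Rightarrow> nat \<Rightarrow> config \<Rightarrow> (config \<Rightarrow> bool) \<Rightarrow> bool" where
  "runs P T c Q \<longleftrightarrow> (\<exists>t\<le>T. Q ((step P ^^ t) c))"

lemma runs_now: "Q c \<Longrightarrow> runs P T c Q"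
  unfolding runs_def by (rule exI[of _ 0]) simp

lemma runs_trans:
  assumes "runs P T c Q" "\<And>c'. Q c' \<Longrightarrow> runs P T' c' Q'" "T + T' \<le> T''"
  shows "runs P T'' c Q'"
proof -
  obtain t where t: "t \<le> T" "Q ((step P ^^ t) c)" using assms(1) unfolding runs_def by blast
  obtain t' where t': "t' \<le> T'" "Q' ((step P ^^ t') ((step P ^^ t) c))"
    using assms(2)[OF t(2)] unfolding runs_def by blast
  then show ?thesis unfolding runs_def using t(1) assms(3)
    by (intro exI[of _ "t' + t"]) (simp add: funpow_add)
qed

lemma runs_step:
  assumes "pc c < length P" "runs P T (exec (P ! pc c) c) Q" "Suc T \<le> T'"
  shows "runs P T' c Q"
proof -
  have "runs P 1 c (\<lambda>c'. c' = exec (P ! pc c) c)"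
    unfolding runs_def using assms(1) by (intro exI[of _ 1]) (simp add: step_def halted_def)
  then show ?thesis by (rule runs_trans[of _ _ _ _ T]) (use assms(2,3) in auto)
qed

section \<open>Correctness and cost of compiled code\<close>

primrec etime :: "exp \<Rightarrow> (nat \<Rightarrow> nat) \<Rightarrow> nat" where
  "etime (Num c) \<beta> = 1"
| "etime (Var x) \<beta> = 2"
| "etime (Bnd k) \<beta> = 2"
| "etime (Plus a b) \<beta> = etime a \<beta> + etime b \<beta> + 1"
| "etime (Minus a b) \<beta> = etime a \<beta> + etime b \<beta> + 1"
| "etime (Arr a e) \<beta> = etime e \<beta> + 8"
| "etime (Inp e) \<beta> = etime e \<beta> + 3"
| "etime (Ex k b e) \<beta> = \<beta> b * (etime e \<beta> + 7) + 4"

text \<open>Both branches of a conditional are charged, so the cost depends on the state through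
  loop bounds only, and these are constant during the command.\<close>

primrec ctime :: "com \<Rightarrow> (nat \<Rightarrow> nat) \<Rightarrow> nat" where
  "ctime Skip \<beta> = 0"
| "ctime (Set x e) \<beta> = etime e \<beta> + 2"
| "ctime (Sto a e f) \<beta> = etime e \<beta> + etime f \<beta> + 8"
| "ctime (Seq c d) \<beta> = ctime c \<beta> + ctime d \<beta>"
| "ctime (If e c d) \<beta> = etime e \<beta> + ctime c \<beta> + ctime d \<beta> + 2"
| "ctime (For i b c) \<beta> = \<beta> b * (ctime c \<beta> + 5) + 3"

text \<open>Array numbers are positive, so every array cell lies strictly above \<open>off\<close>.
  The cell at \<open>off\<close> therefore keeps the value 0, which is what clamped input reads
  return.\<close>

definition rel :: "nat \<Rightarrow> st \<Rightarrow> config \<Rightarrow> bool" where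
  "rel off s c \<longleftrightarrow> (\<forall>x. regs c (vr x) = vars s x) \<and> regs c (tr 0) = off \<and>
     (\<forall>a i. 0 < a \<and> a < 16 \<longrightarrow> mem c (off + (16 * i + a)) = arrs s a i) \<and>
     (\<forall>i\<le>off. mem c i = inp s i) \<and> (\<forall>i\<ge>off. inp s i = 0)"

lemma relD:
  assumes "rel off s c"
  shows "regs c (vr x) = vars s x" "regs c (tr 0) = off" "i \<le> off \<Longrightarrow> mem c i = inp s i"
    "0 < a \<Longrightarrow> a < 16 \<Longrightarrow> mem c (off + (16 * j + a)) = arrs s a j" "off \<le> i \<Longrightarrow> inp s i = 0"
  using assms unfolding rel_def by blast+

text \<open>The frame of an expression evaluated at depth \<open>d\<close> into \<open>tr j\<close>:
  operands held below \<open>j\<close> and positions of enclosing quantifiers survive.\<close>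

definition keeps :: "nat \<Rightarrow> nat \<Rightarrow> config \<Rightarrow> config \<Rightarrow> bool" where
  "keeps d j c c' \<longleftrightarrow> mem c' = mem c \<and> (\<forall>x. regs c' (vr x) = regs c (vr x)) \<and>
     (\<forall>i<j. regs c' (tr i) = regs c (tr i)) \<and> (\<forall>i<d. regs c' (br i) = regs c (br i))"

lemma keeps_rel: "keeps d j c c' \<Longrightarrow> 0 < j \<Longrightarrow> rel off s c \<Longrightarrow> rel off s c'"
  by (auto simp: keeps_def rel_def)

lemma keeps_trans: "keeps d j c c' \<Longrightarrow> keeps d' j' c' c'' \<Longrightarrow> d \<le> d' \<Longrightarrow> j \<le> j' \<Longrightarrow> keeps d j c c''"
  by (auto simp: keeps_def)

lemma address_correct:
  assumes "code_at P p (address a j t)" "pc c = p" "j \<noteq> t" "0 < j" "0 < t"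
  shows "runs P 7 c (\<lambda>c'. pc c' = p + 7 \<and> mem c' = mem c \<and>
           regs c' (tr j) = regs c (tr 0) + (16 * regs c (tr j) + a) \<and>
           (\<forall>r. r \<noteq> tr j \<and> r \<noteq> tr t \<longrightarrow> regs c' r = regs c r))"
  using assms unfolding address_def
  apply simp
  apply (rule runs_step[of _ _ 6], simp, simp)
  apply (rule runs_step[of _ _ 5], simp, simp)
  apply (rule runs_step[of _ _ 4], simp, simp)
  apply (rule runs_step[of _ _ 3], simp, simp)
  apply (rule runs_step[of _ _ 2], simp, simp)
  apply (rule runs_step[of _ _ 1], simp, simp)
  apply (rule runs_step[of _ _ 0], simp, simp)
  apply (rule runs_now)
  apply simp
  apply simp_all
  done

lemma ecode_correct:
  assumes "code_at P p (ecode e p j)" "pc c = p" "rel off s c" "wfe B d e" "0 < j"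
    "\<forall>k<d. regs c (br k) = \<rho> k"
  shows "runs P (etime e (vars s)) c (\<lambda>c'. pc c' = p + length (ecode e p j) \<and>
           regs c' (tr j) = ev e s \<rho> \<and> keeps d j c c')"
  using assms
proof (induction e arbitrary: p j d \<rho> c)
  case (Num k)
  then show ?case
    by (intro runs_step[of c P 0, OF _ runs_now]) (auto simp: keeps_def)
next
  case (Var x)
  then show ?case
    by (intro runs_step[of _ P 1, OF _ runs_step[of _ P 0, OF _ runs_now]])
      (auto simp: keeps_def rel_def)
next
  case (Bnd k)
  then show ?case
    by (intro runs_step[of _ P 1, OF _ runs_step[of _ P 0, OF _ runs_now]])
      (auto simp: keeps_def rel_def)
next
  case (Plus a b)
  show ?case
  proof (rule runs_trans[OF Plus.IH(1)[of p j c d \<rho>]])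
    fix c1 :: config assume c1: "pc c1 = p + length (ecode a p j) \<and> regs c1 (tr j) = ev a s \<rho> \<and> keeps d j c c1"
    then have r1: "rel off s c1" using Plus.prems keeps_rel by blast
    show "runs P (etime b (vars s) + 1) c1 (\<lambda>c'. pc c' = p + length (ecode (Plus a b) p j) \<and>
       regs c' (tr j) = ev (Plus a b) s \<rho> \<and> keeps d j c c')"
    proof (rule runs_trans[OF Plus.IH(2)[of "p + length (ecode a p j)" "Suc j" c1 d \<rho>]])
      fix c2 :: config assume c2: "pc c2 = p + length (ecode a p j) + length (ecode b (p + length (ecode a p j)) (Suc j)) \<and>
         regs c2 (tr (Suc j)) = ev b s \<rho> \<and> keeps d (Suc j) c1 c2"
      show "runs P 1 c2 (\<lambda>c'. pc c' = p + length (ecode (Plus a b) p j) \<and>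
         regs c' (tr j) = ev (Plus a b) s \<rho> \<and> keeps d j c c')"
        using Plus.prems c1 c2
        by (intro runs_step[of c2 P 0, OF _ runs_now]) (auto simp: keeps_def)
    qed (use Plus.prems c1 r1 in \<open>auto simp: keeps_def\<close>)
  qed (use Plus.prems in auto)
next
  case (Minus a b)
  show ?case
  proof (rule runs_trans[OF Minus.IH(1)[of p j c d \<rho>]])
    fix c1 :: config assume c1: "pc c1 = p + length (ecode a p j) \<and> regs c1 (tr j) = ev a s \<rho> \<and> keeps d j c c1"
    then have r1: "rel off s c1" using Minus.prems keeps_rel by blast
    show "runs P (etime b (vars s) + 1) c1 (\<lambda>c'. pc c' = p + length (ecode (Minus a b) p j) \<and>
       regs c' (tr j) = ev (Minus a b) s \<rho> \<and> keeps d j c c')"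
    proof (rule runs_trans[OF Minus.IH(2)[of "p + length (ecode a p j)" "Suc j" c1 d \<rho>]])
      fix c2 :: config assume c2: "pc c2 = p + length (ecode a p j) + length (ecode b (p + length (ecode a p j)) (Suc j)) \<and>
         regs c2 (tr (Suc j)) = ev b s \<rho> \<and> keeps d (Suc j) c1 c2"
      show "runs P 1 c2 (\<lambda>c'. pc c' = p + length (ecode (Minus a b) p j) \<and>
         regs c' (tr j) = ev (Minus a b) s \<rho> \<and> keeps d j c c')"
        using Minus.prems c1 c2
        by (intro runs_step[of c2 P 0, OF _ runs_now]) (auto simp: keeps_def)
    qed (use Minus.prems c1 r1 in \<open>auto simp: keeps_def\<close>)
  qed (use Minus.prems in auto)
next
  case (Arr a e)
  let ?q = "p + length (ecode e p j)"
  show ?case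
  proof (rule runs_trans[OF Arr.IH[of p j c d \<rho>]])
    fix c1 :: config assume c1: "pc c1 = ?q \<and> regs c1 (tr j) = ev e s \<rho> \<and> keeps d j c c1"
    then have r1: "rel off s c1" using Arr.prems keeps_rel by blast
    show "runs P 8 c1 (\<lambda>c'. pc c' = p + length (ecode (Arr a e) p j) \<and>
       regs c' (tr j) = ev (Arr a e) s \<rho> \<and> keeps d j c c')"
    proof (rule runs_trans[OF address_correct[of P ?q a j "Suc j" c1]])
      fix c2 :: config assume c2: "pc c2 = ?q + 7 \<and> mem c2 = mem c1 \<and>
           regs c2 (tr j) = regs c1 (tr 0) + (16 * regs c1 (tr j) + a) \<and>
           (\<forall>r. r \<noteq> tr j \<and> r \<noteq> tr (Suc j) \<longrightarrow> regs c2 r = regs c1 r)"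
      show "runs P 1 c2 (\<lambda>c'. pc c' = p + length (ecode (Arr a e) p j) \<and>
         regs c' (tr j) = ev (Arr a e) s \<rho> \<and> keeps d j c c')"
      proof -
        have "mem c2 (regs c2 (tr j)) = ev (Arr a e) s \<rho>"
          using c1 c2 r1 Arr.prems(4) by (simp add: rel_def)
        moreover have "keeps d j c1 c2"
          using c2 by (auto simp: keeps_def)
        then have "keeps d j c c2" using c1 keeps_trans by blast
        moreover have "pc c2 < length P" "P ! pc c2 = Load (tr j) (tr j)"
          "Suc (pc c2) = p + length (ecode (Arr a e) p j)"
          using Arr.prems(1) c2 by simp_all
        ultimately show ?thesis
          by (intro runs_step[of c2 P 0, OF _ runs_now]) (simp_all add: keeps_def)
      qed
    qed (use Arr.prems c1 in auto)
  qed (use Arr.prems in auto)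
next
  case (Inp e)
  let ?q = "p + length (ecode e p j)"
  show ?case
  proof (rule runs_trans[OF Inp.IH[of p j c d \<rho>]])
    fix c1 :: config assume c1: "pc c1 = ?q \<and> regs c1 (tr j) = ev e s \<rho> \<and> keeps d j c c1"
    then have r1: "rel off s c1" using Inp.prems keeps_rel by blast
    \<comment> \<open>\<open>x - (x - off)\<close> is the minimum of \<open>x\<close> and
      \<open>off\<close> under truncated subtraction; from \<open>off\<close> on, the input is 0,
      and so is the cell at \<open>off\<close>.\<close>
    have "mem c (ev e s \<rho> - (ev e s \<rho> - off)) = inp s (ev e s \<rho>)"
      using Inp.prems(3) by (cases "ev e s \<rho> \<le> off") (auto simp: rel_def)
    then show "runs P 3 c1 (\<lambda>c'. pc c' = p + length (ecode (Inp e) p j) \<and>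
       regs c' (tr j) = ev (Inp e) s \<rho> \<and> keeps d j c c')"
      using Inp.prems c1 r1
      by (intro runs_step[of _ P 2, OF _ runs_step[of _ P 1, OF _ runs_step[of _ P 0, OF _ runs_now]]])
        (auto simp: keeps_def rel_def)
  qed (use Inp.prems in auto)
next
  case (Ex k b e)
  define h where "h = Suc (Suc (Suc (Suc p)))"
  define q where "q = h + length (ecode e h (Suc j))"
  define Q where "Q = (\<lambda>c'. pc c' = q + 5 \<and> regs c' (tr j) = ev (Ex k b e) s \<rho> \<and> keeps d j c c')"
  have code: "code_at P p [Const (tr j) 0, Const (br k) 0, Sub (tr (Suc j)) (vr b) (br k),
       JumpZ (tr (Suc j)) (q + 5)]" "code_at P h (ecode e h (Suc j))"
      "code_at P q [JumpZ (tr (Suc j)) (Suc (Suc q)), Const (tr j) 1, Const (tr (Suc j)) 1,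
       Add (br k) (br k) (tr (Suc j)), Jump (Suc (Suc p))]"
    using Ex.prems(1) by (simp_all add: Let_def q_def h_def)
  define W where "W i = ev e s (\<rho>(k := i))" for i
  \<comment> \<open>The last two units pay for the final test. Each round pays for the body and at
    most seven more instructions, and \<open>tr j\<close> holds the disjunction over the positions
    seen so far.\<close>
  have loop: "runs P ((vars s b - i) * (etime e (vars s) + 7) + 2) c1 Q"
    if "i \<le> vars s b" "pc c1 = Suc (Suc p)" "keeps d j c c1" "regs c1 (br k) = i"
      "regs c1 (tr j) = of_bool (\<exists>i'<i. W i' \<noteq> 0)" for i c1
    using that
  proof (induction i arbitrary: c1 rule: inc_induct)
    case base
    then have b: "regs c1 (vr b) = vars s b" using Ex.prems(3) by (auto simp: keeps_def rel_def)
    have v: "regs c1 (tr j) = ev (Ex k b e) s \<rho>" using base by (simp add: W_def)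
    show ?case using b v base(1-3) code(1)
      by (intro runs_step[of c1 P 1, OF _ runs_step[of _ P 0, OF _ runs_now]])
         (simp_all add: Q_def keeps_def del: ev.simps)
  next
    case (step i)
    have b: "regs c1 (vr b) = vars s b" using Ex.prems(3) step.prems by (auto simp: keeps_def rel_def)
    have d: "d = k" and wfe: "wfe B (Suc k) e" using Ex.prems(4) by auto
    define c2 where "c2 = c1\<lparr>pc := h, regs := (regs c1)(tr (Suc j) := vars s b - i)\<rparr>"
    have k2: "keeps d j c c2" using step.prems by (auto simp: c2_def keeps_def)
    have r2: "rel off s c2" using k2 Ex.prems keeps_rel by blast
    have bk2: "\<forall>x<Suc k. regs c2 (br x) = (\<rho>(k := i)) x"
      using k2 Ex.prems d step.prems by (auto simp: keeps_def less_Suc_eq c2_def)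
    let ?T' = "(vars s b - Suc i) * (etime e (vars s) + 7) + 2"
    let ?T = "etime e (vars s) + (5 + ?T')"
    have T: "(vars s b - i) * (etime e (vars s) + 7) + 2 = Suc (Suc ?T)"
    proof -
      have "vars s b - i = Suc (vars s b - Suc i)" using step.hyps by simp
      then show ?thesis by simp
    qed
    have C2: "runs P ?T c2 Q"
    proof (rule runs_trans[OF Ex.IH[of h "Suc j" c2 "Suc k" "\<rho>(k := i)"]])
      fix c3 :: config assume c3: "pc c3 = h + length (ecode e h (Suc j)) \<and>
         regs c3 (tr (Suc j)) = ev e s (\<rho>(k := i)) \<and> keeps (Suc k) (Suc j) c2 c3"
      define v where "v = (of_bool (\<exists>i'<Suc i. W i' \<noteq> 0) :: nat)"
      define c4 where "c4 = c3\<lparr>pc := Suc (Suc p), regs := (regs c3)(tr j := v, tr (Suc j) := 1, br k := Suc i)\<rparr>"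
      have pc3: "pc c3 = q" and v3: "regs c3 (tr (Suc j)) = W i"
        using c3 by (simp_all add: q_def W_def)
      have old: "regs c3 (tr j) = of_bool (\<exists>i'<i. W i' \<noteq> 0)" "regs c3 (br k) = i"
        using c3 step.prems by (auto simp: keeps_def c2_def)
      have "keeps d j c c4"
        using c3 k2 d unfolding c4_def keeps_def by auto
      then have R4: "runs P ?T' c4 Q"
        by (intro step.IH) (auto simp: c4_def v_def)
      \<comment> \<open>Both outcomes of the test meet in \<open>c5\<close>: if the body is zero,
        the accumulator already contains \<open>v\<close>; otherwise it is set to 1, which is
        \<open>v\<close>.\<close>
      define c5 where "c5 = c3\<lparr>pc := Suc (Suc q), regs := (regs c3)(tr j := v)\<rparr>"
      have R5: "runs P (3 + ?T') c5 Q"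
      proof -
        have "(regs c5)(tr (Suc j) := 1, br k := Suc i) = regs c4"
          using old by (auto simp: c4_def c5_def)
        then have eq: "c5\<lparr>pc := Suc (Suc p), regs := (regs c5)(tr (Suc j) := 1, br k := Suc i)\<rparr> = c4"
          by (simp add: c4_def c5_def)
        show ?thesis
          apply (rule runs_step[where T = "2 + ?T'"])
          subgoal using code(3) by (simp add: c5_def)
           apply (rule runs_step[where T = "1 + ?T'"])
          subgoal using code(3) by (simp add: c5_def)
            apply (rule runs_step[where T = "?T'"])
          subgoal using code(3) by (simp add: c5_def)
          subgoal using code(3) R4 old unfolding eq[symmetric] by (simp add: c5_def config_update_swap)
          by simp_all
      qed
      show "runs P (5 + ?T') c3 Q"
      proof (cases "W i = 0")
        case True
        have "v = regs c3 (tr j)" using old True by (auto simp: less_Suc_eq v_def W_def)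
        then have "c5 = c3\<lparr>pc := Suc (Suc q)\<rparr>" by (simp add: c5_def fun_upd_idem)
        then show ?thesis using R5 code(3) pc3 v3 True
          by (intro runs_step[where c = c3 and T = "3 + ?T'"]) simp_all
      next
        case False
        then have "v = 1" by (auto simp: v_def W_def)
        then have "c5 = c3\<lparr>pc := Suc (Suc q), regs := (regs c3)(tr j := 1)\<rparr>" by (simp add: c5_def)
        then show ?thesis using R5 code(3) pc3 v3 False
          by (intro runs_step[where c = c3 and T = "4 + ?T'", OF _ runs_step[where T = "3 + ?T'"]]) simp_all
      qed
    qed (use r2 code(2) wfe Ex.prems(5) bk2 in \<open>simp_all add: c2_def\<close>)
    have "c2 = c1\<lparr>pc := Suc (Suc (Suc (Suc p))), regs := (regs c1)(tr (Suc j) := vars s b - i)\<rparr>"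
      by (simp add: c2_def h_def)
    then show ?case unfolding T using C2 code(1) step.prems step.hyps b
      by (intro runs_step[where c = c1 and T = "Suc ?T", OF _ runs_step[where T = "?T"]]) (simp_all add: config_update_swap)
  qed
  define c1 where "c1 = c\<lparr>pc := Suc (Suc p), regs := (regs c)(tr j := 0, br k := 0)\<rparr>"
  let ?T = "vars s b * (etime e (vars s) + 7) + 2"
  have C1: "runs P ?T c1 Q"
    using loop[of 0 c1] Ex.prems by (auto simp: c1_def keeps_def)
  have "runs P (Suc (Suc ?T)) c Q"
    using code(1) Ex.prems(2) C1
    by (intro runs_step[where c = c and T = "Suc ?T", OF _ runs_step[where T = "?T"]]) (simp_all add: c1_def)
  moreover have "Suc (Suc ?T) = etime (Ex k b e) (vars s)" "q + 5 = p + length (ecode (Ex k b e) p j)"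
    by (simp_all add: Let_def q_def h_def)
  ultimately show ?case unfolding Q_def by (simp only:)
qed

lemma rel_upd:
  assumes "rel off s c" "mem c' = mem c" "regs c' (vr x) = v" "\<And>y. y \<noteq> x \<Longrightarrow> regs c' (vr y) = regs c (vr y)"
    "regs c' (tr 0) = regs c (tr 0)"
  shows "rel off (upd x v s) c'"
  unfolding rel_def
proof (intro conjI allI impI)
  fix y show "regs c' (vr y) = vars (upd x v s) y"
    using relD(1)[OF assms(1)] assms(3,4) by (cases "y = x") simp_all
qed (simp_all add: assms(2,5) relD[OF assms(1)])

lemma rel_upda:
  assumes "rel off s c" "mem c' = (mem c)(off + (16 * i + a) := v)" "\<And>y. regs c' (vr y) = regs c (vr y)"
    "regs c' (tr 0) = regs c (tr 0)" "0 < a" "a < 16"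
  shows "rel off (upda a i v s) c'"
proof -
  \<comment> \<open>Quotient and remainder by 16 recover index and array from an address, so
    distinct cells do not overlap.\<close>
  have inj: "16 * i' + a' = 16 * i + a \<longleftrightarrow> i' = i \<and> a' = a" if "a' < 16" for a' i' :: nat
  proof -
    have "(16 * i' + a') div 16 = i'" "(16 * i' + a') mod 16 = a'"
      "(16 * i + a) div 16 = i" "(16 * i + a) mod 16 = a"
      using that assms(6) by simp_all
    then show ?thesis by metis
  qed
  show ?thesis unfolding rel_def
  proof (intro conjI allI impI)
    fix a' i' :: nat assume "0 < a' \<and> a' < 16"
    then show "mem c' (off + (16 * i' + a')) = arrs (upda a i v s) a' i'"
      using inj[of a' i'] relD(4)[OF assms(1)] by (simp add: assms(2))
  qed (use assms(5) in \<open>simp_all add: assms(2-4) relD[OF assms(1)]\<close>)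
qed

lemma ecode_correct_closed:
  assumes "code_at P p (ecode e p j)" "pc c = p" "rel off s c" "wfe B 0 e" "0 < j"
  shows "runs P (etime e (vars s)) c (\<lambda>c'. pc c' = p + length (ecode e p j) \<and>
           regs c' (tr j) = cev e s \<and> rel off s c' \<and> (\<forall>i<j. regs c' (tr i) = regs c (tr i)))"
proof (rule runs_trans[OF ecode_correct[OF assms, where \<rho> = "\<lambda>_. 0"], where T' = 0])
  fix c' :: config assume "pc c' = p + length (ecode e p j) \<and> regs c' (tr j) = cev e s \<and> keeps 0 j c c'"
  moreover from this have "rel off s c'" using keeps_rel assms(3,5) by blast
  ultimately show "runs P 0 c' (\<lambda>c'. pc c' = p + length (ecode e p j) \<and>
           regs c' (tr j) = cev e s \<and> rel off s c' \<and> (\<forall>i<j. regs c' (tr i) = regs c (tr i)))"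
    by (intro runs_now) (simp add: keeps_def)
qed simp_all

lemma etime_cong: "wfe B d e \<Longrightarrow> (\<And>x. x \<in> B \<Longrightarrow> \<beta> x = \<beta>' x) \<Longrightarrow> etime e \<beta> = etime e \<beta>'"
  by (induction e arbitrary: d) auto

text \<open>Together with \<open>den_protected\<close>, this prices the second of two commands, and
  every later round of a loop, in the initial state.\<close>

lemma ctime_cong:
  assumes "wf_com B L c" and eq: "\<And>x. x \<in> B \<Longrightarrow> \<beta> x = \<beta>' x"
  shows "ctime c \<beta> = ctime c \<beta>'"
proof -
  have "etime e \<beta> = etime e \<beta>'" if "wfe B d e" for d e
    using that eq by (rule etime_cong)
  then show ?thesis using assms(1)
    by (induction c arbitrary: L) (auto simp: eq)
qed

lemma ccode_correct:
  assumes "code_at P p (ccode com p)" "pc c = p" "rel off s c" "wf_com B L com"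
  shows "runs P (ctime com (vars s)) c (\<lambda>c'. pc c' = p + length (ccode com p) \<and> rel off (den com s) c')"
  using assms
proof (induction com arbitrary: p c s L)
  case Skip
  then show ?case by (auto intro: runs_now)
next
  case (Set x e)
  show ?case
  proof (rule runs_trans[OF ecode_correct_closed[of P p e 1 c off s B]])
    fix c1 :: config assume c1: "pc c1 = p + length (ecode e p 1) \<and> regs c1 (tr 1) = cev e s \<and>
      rel off s c1 \<and> (\<forall>i<1. regs c1 (tr i) = regs c (tr i))"
    show "runs P 2 c1 (\<lambda>c'. pc c' = p + length (ccode (Set x e) p) \<and> rel off (den (Set x e) s) c')"
      using Set.prems c1
      by (intro runs_step[of c1 P 1, OF _ runs_step[of _ P 0, OF _ runs_now]])
        (auto intro!: rel_upd[of off s c1])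
  qed (use Set.prems in simp_all)
next
  case (Sto a e f)
  let ?q = "p + length (ecode e p 1)"
  let ?r = "?q + length (ecode f ?q 2)"
  let ?Q = "\<lambda>c'. pc c' = p + length (ccode (Sto a e f) p) \<and> rel off (den (Sto a e f) s) c'"
  show ?case
  proof (rule runs_trans[OF ecode_correct_closed[of P p e 1 c off s B]])
    fix c1 :: config assume c1: "pc c1 = ?q \<and> regs c1 (tr 1) = cev e s \<and>
      rel off s c1 \<and> (\<forall>i<1. regs c1 (tr i) = regs c (tr i))"
    show "runs P (etime f (vars s) + 8) c1 ?Q"
    proof (rule runs_trans[OF ecode_correct_closed[of P ?q f 2 c1 off s B]])
      fix c2 :: config assume c2: "pc c2 = ?r \<and> regs c2 (tr 2) = cev f s \<and>
        rel off s c2 \<and> (\<forall>i<2. regs c2 (tr i) = regs c1 (tr i))"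
      have t1: "regs c2 (tr 1) = cev e s" using c1 c2 by simp
      show "runs P 8 c2 ?Q"
      proof (rule runs_trans[OF address_correct[of P ?r a 1 3 c2]])
        fix c3 :: config assume c3: "pc c3 = ?r + 7 \<and> mem c3 = mem c2 \<and>
           regs c3 (tr 1) = regs c2 (tr 0) + (16 * regs c2 (tr 1) + a) \<and>
           (\<forall>r. r \<noteq> tr 1 \<and> r \<noteq> tr 3 \<longrightarrow> regs c3 r = regs c2 r)"
        define c4 where "c4 = c3\<lparr>pc := Suc (?r + 7), mem := (mem c3)(regs c3 (tr 1) := regs c3 (tr 2))\<rparr>"
        have off: "regs c2 (tr 0) = off" using c2 by (simp add: rel_def)
        have "rel off (upda a (cev e s) (cev f s) s) c4"
          by (rule rel_upda[of off s c2]) (use c2 c3 t1 off Sto.prems in \<open>simp_all add: c4_def\<close>)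
        then show "runs P 1 c3 ?Q"
          using Sto.prems(1) c3 
          by (intro runs_step[of c3 P 0, OF _ runs_now]) (simp_all add: c4_def add_ac)
      qed (use Sto.prems c2 in simp_all)
    qed (use Sto.prems c1 in simp_all)
  qed (use Sto.prems in simp_all)
next
  case (Seq com1 com2)
  let ?q = "p + length (ccode com1 p)"
  show ?case
  proof (rule runs_trans[OF Seq.IH(1)[of p c s L]])
    fix c1 :: config assume c1: "pc c1 = ?q \<and> rel off (den com1 s) c1"
    have "ctime com2 (vars s) = ctime com2 (vars (den com1 s))"
      using Seq.prems by (intro ctime_cong[of B L]) (auto simp: den_protected)
    then show "runs P (ctime com2 (vars s)) c1
       (\<lambda>c'. pc c' = p + length (ccode (Seq com1 com2) p) \<and> rel off (den (Seq com1 com2) s) c')"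
      using Seq.IH(2)[of ?q c1 "den com1 s" L] Seq.prems c1 by (simp add: add_ac)
  qed (use Seq.prems in simp_all)
next
  case (If e com1 com2)
  define q where "q = p + length (ecode e p 1)"
  define r where "r = Suc q + length (ccode com1 (Suc q))"
  have code: "code_at P p (ecode e p 1)" "q < length P" "P ! q = JumpZ (tr 1) (Suc r)"
      "code_at P (Suc q) (ccode com1 (Suc q))" "r < length P"
      "P ! r = Jump (Suc r + length (ccode com2 (Suc r)))" "code_at P (Suc r) (ccode com2 (Suc r))"
      and len: "p + length (ccode (If e com1 com2) p) = Suc r + length (ccode com2 (Suc r))"
    using If.prems(1) by (simp_all add: Let_def q_def r_def)
  show ?case unfolding len
  proof (rule runs_trans[OF ecode_correct_closed[of P p e 1 c off s B]])
    fix c1 :: config assume c1: "pc c1 = p + length (ecode e p 1) \<and> regs c1 (tr 1) = cev e s \<and>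
      rel off s c1 \<and> (\<forall>i<1. regs c1 (tr i) = regs c (tr i))"
    have pc1: "pc c1 = q" using c1 by (simp add: q_def)
    show "runs P (ctime com1 (vars s) + ctime com2 (vars s) + 2) c1
       (\<lambda>c'. pc c' = Suc r + length (ccode com2 (Suc r)) \<and> rel off (den (If e com1 com2) s) c')"
    proof (cases "cev e s = 0")
      case True
      have "runs P (ctime com2 (vars s)) (c1\<lparr>pc := Suc r\<rparr>)
         (\<lambda>c'. pc c' = Suc r + length (ccode com2 (Suc r)) \<and> rel off (den com2 s) c')"
        by (rule If.IH(2)) (use If.prems code c1 in \<open>auto simp: rel_def\<close>)
      then show ?thesis using True code c1 pc1
        by (intro runs_step[of c1 P "ctime com2 (vars s)"]) simp_all
    next
      case False
      have "runs P (ctime com1 (vars s)) (c1\<lparr>pc := Suc q\<rparr>)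
         (\<lambda>c'. pc c' = Suc q + length (ccode com1 (Suc q)) \<and> rel off (den com1 s) c')"
        by (rule If.IH(1)) (use If.prems code c1 in \<open>auto simp: rel_def\<close>)
      then have "runs P (ctime com1 (vars s) + 1) (c1\<lparr>pc := Suc q\<rparr>)
         (\<lambda>c'. pc c' = Suc r + length (ccode com2 (Suc r)) \<and> rel off (den com1 s) c')"
      proof (rule runs_trans)
        fix c2 :: config assume "pc c2 = Suc q + length (ccode com1 (Suc q)) \<and> rel off (den com1 s) c2"
        then have "pc c2 = r" "rel off (den com1 s) c2" by (simp_all add: r_def)
        then show "runs P 1 c2 (\<lambda>c'. pc c' = Suc r + length (ccode com2 (Suc r)) \<and> rel off (den com1 s) c')"
          using code(5,6) by (intro runs_step[of c2 P 0, OF _ runs_now]) (simp_all add: rel_def)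
      qed simp
      then show ?thesis using False code c1 pc1
        by (intro runs_step[of c1 P "ctime com1 (vars s) + 1"]) simp_all
    qed
  qed (use If.prems code in simp_all)
next
  case (For i b com)
  define h where "h = Suc (Suc (Suc p))"
  define q where "q = h + length (ccode com h)"
  have code: "code_at P p [Const (vr i) 0, Sub (tr 1) (vr b) (vr i), JumpZ (tr 1) (q + 3)]"
      "code_at P h (ccode com h)" "code_at P q [Const (tr 1) 1, Add (vr i) (vr i) (tr 1), Jump (Suc p)]"
      and len: "p + length (ccode (For i b com) p) = q + 3"
    using For.prems(1) by (simp_all add: Let_def q_def h_def)
  define F where "F = (\<lambda>s'. upd i (Suc (vars s' i)) (den com s'))"
  let ?T = "ctime com (vars s) + 5"
  have wf: "wf_com B (insert i L) com" "i \<noteq> b" "b \<in> B" using For.prems by auto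
  have F: "vars (F s') x = vars s' x" if "x \<in> B" for s' x
    using that For.prems by (auto simp: F_def den_protected[OF wf(1)])
  have Fi: "vars (F s') i = Suc (vars s' i)" for s'
    by (simp add: F_def)
  \<comment> \<open>Generalized to the \<open>k\<close> rounds still to run; agreement with
    \<open>s\<close> on \<open>B\<close> gives all of them the same price.\<close>
  have loop: "runs P (k * ?T + 2) c1 (\<lambda>c'. pc c' = q + 3 \<and> rel off ((F ^^ k) s1) c')"
    if "pc c1 = Suc p" "rel off s1 c1" "\<forall>x\<in>B. vars s1 x = vars s x" "vars s b = vars s1 i + k" for k s1 c1
    using that
  proof (induction k arbitrary: s1 c1)
    case 0
    then have "regs c1 (vr b) = regs c1 (vr i)" using wf by (simp add: rel_def)
    then show ?case using 0 code(1)
      by (intro runs_step[of _ P 1, OF _ runs_step[of _ P 0, OF _ runs_now]]) (auto simp: rel_def)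
  next
    case (Suc k)
    define c2 where "c2 = c1\<lparr>pc := h, regs := (regs c1)(tr 1 := vars s b - vars s1 i)\<rparr>"
    have bi: "regs c1 (vr b) = vars s b" "regs c1 (vr i) = vars s1 i" using Suc.prems wf by (simp_all add: rel_def)
    have "ctime com (vars s1) = ctime com (vars s)"
      using wf Suc.prems by (intro ctime_cong) auto
    moreover have "runs P (ctime com (vars s1)) c2 (\<lambda>c'. pc c' = h + length (ccode com h) \<and> rel off (den com s1) c')"
      by (rule For.IH[of _ _ _ "insert i L"]) (use code wf Suc.prems in \<open>auto simp: c2_def rel_def\<close>)
    ultimately have body: "runs P (ctime com (vars s)) c2 (\<lambda>c'. pc c' = q \<and> rel off (den com s1) c')"
      by (simp add: q_def)
    have "runs P (ctime com (vars s) + (3 + (k * ?T + 2))) c2 (\<lambda>c'. pc c' = q + 3 \<and> rel off ((F ^^ Suc k) s1) c')"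
    proof (rule runs_trans[OF body])
      fix c3 :: config assume c3: "pc c3 = q \<and> rel off (den com s1) c3"
      define c4 where "c4 = c3\<lparr>pc := Suc p, regs := (regs c3)(tr 1 := 1, vr i := Suc (regs c3 (vr i)))\<rparr>"
      have "regs c3 (vr i) = vars (den com s1) i" using c3 by (simp add: rel_def)
      also have "\<dots> = vars s1 i" using den_protected[OF wf(1)] by simp
      finally have "rel off (F s1) c4" unfolding F_def using c3
        by (intro rel_upd[of off _ c3]) (auto simp: c4_def)
      then have "runs P (k * ?T + 2) c4 (\<lambda>c'. pc c' = q + 3 \<and> rel off ((F ^^ k) (F s1)) c')"
        by (rule Suc.IH[rotated]) (use F Fi Suc.prems in \<open>auto simp: c4_def\<close>)
      then show "runs P (3 + (k * ?T + 2)) c3 (\<lambda>c'. pc c' = q + 3 \<and> rel off ((F ^^ Suc k) s1) c')"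
        using code(3) c3
        by (intro runs_step[of c3 P "2 + (k * ?T + 2)", OF _ runs_step[of _ P "1 + (k * ?T + 2)", OF _ runs_step[of _ P "k * ?T + 2"]]]) (simp_all add: c4_def funpow_swap1 config_update_swap)
    qed simp
    then show ?case using code(1) Suc.prems bi
      by (intro runs_step[of c1 P "1 + (ctime com (vars s) + (3 + (k * ?T + 2)))", OF _ runs_step[of _ P "ctime com (vars s) + (3 + (k * ?T + 2))"]]) (simp_all add: c2_def h_def config_update_swap)
  qed
  define c1 where "c1 = c\<lparr>pc := Suc p, regs := (regs c)(vr i := 0)\<rparr>"
  have "rel off (upd i 0 s) c1" using For.prems by (intro rel_upd[of off s c]) (auto simp: c1_def)
  then have "runs P (vars s b * ?T + 2) c1 (\<lambda>c'. pc c' = q + 3 \<and> rel off ((F ^^ vars s b) (upd i 0 s)) c')"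
    by (intro loop) (use For.prems in \<open>auto simp: c1_def\<close>)
  then have "runs P (vars s b * ?T + 2) c1 (\<lambda>c'. pc c' = q + 3 \<and> rel off (den (For i b com) s) c')"
    by (simp add: F_def)
  then show ?case unfolding len using code(1) For.prems(2)
    by (intro runs_step[of c P "vars s b * ?T + 2"]) (simp_all add: c1_def del: den.simps)
qed

section \<open>Polynomial bounds on costs\<close>

lemma poly_bound_add:
  fixes f g :: "'a \<Rightarrow> nat \<Rightarrow> nat"
  assumes "\<exists>C d. \<forall>\<beta> M. R \<beta> M \<longrightarrow> f \<beta> M \<le> C * (M + 1) ^ d"
    and "\<exists>C d. \<forall>\<beta> M. R \<beta> M \<longrightarrow> g \<beta> M \<le> C * (M + 1) ^ d"
  shows "\<exists>C d. \<forall>\<beta> M. R \<beta> M \<longrightarrow> f \<beta> M + g \<beta> M \<le> C * (M + 1) ^ d"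
proof -
  obtain C d C' d' where
    f: "\<And>\<beta> M. R \<beta> M \<Longrightarrow> f \<beta> M \<le> C * (M + 1) ^ d" and
    g: "\<And>\<beta> M. R \<beta> M \<Longrightarrow> g \<beta> M \<le> C' * (M + 1) ^ d'"
    using assms by blast
  have "f \<beta> M + g \<beta> M \<le> (C + C') * (M + 1) ^ (d + d')" if "R \<beta> M" for \<beta> M
  proof -
    have "C * (M + 1) ^ d \<le> C * (M + 1) ^ (d + d')" "C' * (M + 1) ^ d' \<le> C' * (M + 1) ^ (d + d')"
      by (auto intro!: mult_le_mono2 power_increasing)
    then show ?thesis using f[OF that] g[OF that] unfolding distrib_right by linarith
  qed
  then show ?thesis by blast
qed

lemma poly_bound_mult:
  fixes f :: "'a \<Rightarrow> nat \<Rightarrow> nat"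
  assumes "\<exists>C d. \<forall>\<beta> M. R \<beta> M \<longrightarrow> f \<beta> M \<le> C * (M + 1) ^ d" and "\<And>\<beta> M. R \<beta> M \<Longrightarrow> h \<beta> \<le> M"
  shows "\<exists>C d. \<forall>\<beta> M. R \<beta> M \<longrightarrow> h \<beta> * f \<beta> M \<le> C * (M + 1) ^ d"
proof -
  obtain C d where f: "\<And>\<beta> M. R \<beta> M \<Longrightarrow> f \<beta> M \<le> C * (M + 1) ^ d"
    using assms by blast
  have "h \<beta> * f \<beta> M \<le> C * (M + 1) ^ Suc d" if "R \<beta> M" for \<beta> M
    using mult_le_mono[of "h \<beta>" "M + 1" "f \<beta> M" "C * (M + 1) ^ d"] f[OF that] assms(2)[OF that]
    by (simp add: mult_ac)
  then show ?thesis by blast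
qed

lemma poly_bound_const: "\<exists>C d. \<forall>\<beta> M. R \<beta> M \<longrightarrow> (k :: nat) \<le> C * (M + 1 :: nat) ^ d"
  by (rule exI[of _ k], rule exI[of _ 0]) simp

lemmas poly_bound = poly_bound_add poly_bound_mult poly_bound_const

text \<open>\<open>C\<close> and \<open>d\<close> are chosen before the valuation, so they depend on
  the program text alone. The recursion for the cost uses only sums, constants and products with a
  loop bound.\<close>

lemma etime_bound:
  assumes "wfe B d e"
  shows "\<exists>C d. \<forall>\<beta> M. (\<forall>b\<in>B. \<beta> b \<le> M) \<longrightarrow> etime e \<beta> \<le> C * (M + 1) ^ d"
  using assms by (induction e arbitrary: d) (auto simp del: add_Suc_right One_nat_def intro!: poly_bound)

lemma ctime_bound:
  assumes "wf_com B L c"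
  shows "\<exists>C d. \<forall>\<beta> M. (\<forall>b\<in>B. \<beta> b \<le> M) \<longrightarrow> ctime c \<beta> \<le> C * (M + 1) ^ d"
  using assms by (induction c arbitrary: L) (auto simp del: add_Suc_right One_nat_def add_2_eq_Suc' intro!: poly_bound etime_bound)

text \<open>Work memory has to begin behind the input, which has length \<open>n * n + 1\<close>.
  This offset is formed in \<open>tr 0\<close> by adding \<open>n\<close> to 1 exactly
  \<open>n\<close> times; the first load finds \<open>n\<close> because \<open>tr 0\<close> is
  initially 0.\<close>

definition prelude :: "instr list" where
  "prelude = [Load (tr 1) (tr 0), Const (tr 3) 1, Const (tr 0) 1, Add (tr 2) (tr 2) (tr 1),
     JumpZ (tr 2) 8, Add (tr 0) (tr 0) (tr 1), Sub (tr 2) (tr 2) (tr 3), Jump 4]"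

lemma length_prelude [simp]: "length prelude = 8"
  by (simp add: prelude_def)

definition start_state :: "nat list \<Rightarrow> st" where
  "start_state xs = \<lparr>vars = \<lambda>_. 0, arrs = \<lambda>_ _. 0, inp = \<lambda>a. if a < length xs then xs ! a else 0\<rparr>"

lemma prelude_correct:
  assumes P: "code_at P 0 prelude" and xs: "xs = n # ys" "length xs = n * n + 1"
  shows "runs P (4 * n + 5) (initial xs) (\<lambda>c. pc c = 8 \<and> rel (n * n + 1) (start_state xs) c)"
proof -
  have code: "length P > 7" "P ! 0 = Load (tr 1) (tr 0)" "P ! 1 = Const (tr 3) 1" "P ! 2 = Const (tr 0) 1"
    "P ! 3 = Add (tr 2) (tr 2) (tr 1)" "P ! 4 = JumpZ (tr 2) 8" "P ! 5 = Add (tr 0) (tr 0) (tr 1)"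
    "P ! 6 = Sub (tr 2) (tr 2) (tr 3)" "P ! 7 = Jump 4"
    using P by (simp_all add: prelude_def eval_nat_numeral)
  have code': "P \<noteq> []" "Suc 0 < length P" "Suc (Suc 0) < length P" "Suc (Suc (Suc 0)) < length P"
    "P ! Suc (Suc 0) = Const (tr 0) 1" "P ! Suc (Suc (Suc 0)) = Add (tr 2) (tr 2) (tr 1)"
    using P by (simp_all add: prelude_def)
  \<comment> \<open>\<open>k\<close> counts the additions of \<open>n\<close> that are still due, so
    \<open>tr 0\<close> plus \<open>k * n\<close> is constant.\<close>
  define ok where "ok k c \<longleftrightarrow> pc c = 4 \<and> mem c = mem (initial xs) \<and> (\<forall>x. regs c (vr x) = 0) \<and>
    regs c (tr 1) = n \<and> regs c (tr 2) = k \<and> regs c (tr 3) = 1 \<and> regs c (tr 0) + k * n = n * n + 1"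
    for k and c :: config
  let ?Q = "\<lambda>c. pc c = 8 \<and> rel (n * n + 1) (start_state xs) c"
  have loop: "runs P (4 * k + 1) c ?Q" if "ok k c" for k c
    using that
  proof (induction k arbitrary: c)
    case 0
    then have "rel (n * n + 1) (start_state xs) (c\<lparr>pc := 8\<rparr>)"
      using xs(2) by (auto simp: ok_def rel_def start_state_def initial_def)
    then show ?case using 0 code
      by (intro runs_step[of c P 0, OF _ runs_now]) (simp_all add: ok_def)
  next
    case (Suc k)
    define c' where "c' = c\<lparr>pc := 4, regs := (regs c)(tr 0 := regs c (tr 0) + n, tr 2 := k)\<rparr>"
    have "ok k c'" using Suc.prems by (simp add: ok_def c'_def)
    then have "runs P (4 * k + 1) c' ?Q" by (rule Suc.IH)
    then show ?case using Suc.prems code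
      by (intro runs_step[of c P "4 * k + 4", OF _ runs_step[of _ P "4 * k + 3", OF _
              runs_step[of _ P "4 * k + 2", OF _ runs_step[of _ P "4 * k + 1"]]]])
        (simp_all add: ok_def c'_def config_update_swap)
  qed
  define c0 where "c0 = \<lparr>pc = Suc (Suc (Suc (Suc 0))), regs = (\<lambda>_. 0)(tr 1 := n, tr 3 := 1, tr 0 := 1, tr 2 := n), mem = mem (initial xs)\<rparr>"
  have "ok n c0" by (simp add: ok_def c0_def)
  then have "runs P (4 * n + 1) c0 ?Q" by (rule loop)
  then show ?thesis using code(2,3) code' xs(1)
    by (intro runs_step[of "initial xs" P "4 * n + 4", OF _ runs_step[of _ P "4 * n + 3", OF _
          runs_step[of _ P "4 * n + 2", OF _ runs_step[of _ P "4 * n + 1"]]]])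
      (simp_all add: c0_def initial_def)
qed

text \<open>A phase is a command together with its loop bounds, which earlier phases have computed.\<close>

type_synonym phases = "(nat set \<times> com) list"

primrec run_phases :: "phases \<Rightarrow> st \<Rightarrow> st" where
  "run_phases [] s = s"
| "run_phases (ph # phs) s = run_phases phs (den (snd ph) s)"

primrec phases_time :: "phases \<Rightarrow> st \<Rightarrow> nat" where
  "phases_time [] s = 0"
| "phases_time (ph # phs) s = ctime (snd ph) (vars s) + phases_time phs (den (snd ph) s)"

primrec phases_code :: "phases \<Rightarrow> nat \<Rightarrow> instr list" where
  "phases_code [] p = []"
| "phases_code (ph # phs) p = ccode (snd ph) p @ phases_code phs (p + length (ccode (snd ph) p))"

primrec bounded :: "nat \<Rightarrow> phases \<Rightarrow> st \<Rightarrow> bool" where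
  "bounded M [] s \<longleftrightarrow> True"
| "bounded M (ph # phs) s \<longleftrightarrow> (\<forall>b\<in>fst ph. vars s b \<le> M) \<and> bounded M phs (den (snd ph) s)"

definition wf_phases :: "phases \<Rightarrow> bool" where
  "wf_phases phs \<longleftrightarrow> (\<forall>(B, c)\<in>set phs. wf_com B {} c)"

lemma phases_correct:
  assumes "code_at P p (phases_code phs p)" "pc c = p" "rel off s c" "wf_phases phs"
  shows "runs P (phases_time phs s) c
           (\<lambda>c'. pc c' = p + length (phases_code phs p) \<and> rel off (run_phases phs s) c')"
  using assms
proof (induction phs arbitrary: p c s)
  case Nil
  then show ?case by (auto intro: runs_now)
next
  case (Cons ph phs)
  show ?case
  proof (rule runs_trans[OF ccode_correct[of P p "snd ph" c off s "fst ph" "{}"]])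
    fix c' :: config assume "pc c' = p + length (ccode (snd ph) p) \<and> rel off (den (snd ph) s) c'"
    then show "runs P (phases_time phs (den (snd ph) s)) c'
      (\<lambda>c'. pc c' = p + length (phases_code (ph # phs) p) \<and> rel off (run_phases (ph # phs) s) c')"
      using Cons.IH[of "p + length (ccode (snd ph) p)" c' "den (snd ph) s"] Cons.prems
      by (simp add: wf_phases_def add_ac)
  qed (use Cons.prems in \<open>auto simp: wf_phases_def\<close>)
qed

lemma phases_time_bound:
  assumes "wf_phases phs"
  shows "\<exists>C d. \<forall>s M. bounded M phs s \<longrightarrow> phases_time phs s \<le> C * (M + 1) ^ d"
  using assms
proof (induction phs)
  case Nil
  then show ?case by auto
next
  case (Cons ph phs)
  have "\<exists>C d. \<forall>\<beta> M. (\<forall>b\<in>fst ph. \<beta> b \<le> M) \<longrightarrow> ctime (snd ph) \<beta> \<le> C * (M + 1) ^ d"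
    using Cons.prems by (intro ctime_bound[of _ "{}"]) (auto simp: wf_phases_def)
  then have "\<exists>C d. \<forall>s M. bounded M (ph # phs) s \<longrightarrow> ctime (snd ph) (vars s) \<le> C * (M + 1) ^ d"
    by (metis bounded.simps(2))
  moreover have "\<exists>C d. \<forall>s M. bounded M (ph # phs) s \<longrightarrow> phases_time phs (den (snd ph) s) \<le> C * (M + 1) ^ d"
    using Cons by (auto simp: wf_phases_def) (metis)
  ultimately show ?case
    unfolding phases_time.simps by (rule poly_bound_add)
qed

definition program :: "phases \<Rightarrow> instr list" where
  "program phs = prelude @ phases_code phs 8"

text \<open>A polynomial in \<open>n + 8 ^ m\<close> has the required form because
  \<open>n + 8 ^ m + 1 \<le> 2 * ((n + 1) * 8 ^ m)\<close>.\<close>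

lemma solvable_single_exp_arcsI:
  assumes wf: "wf_phases phs"
    and bnd: "\<And>n A. simple_digraph {..<n} A \<Longrightarrow>
      bounded (n + 8 ^ card A) phs (start_state (encode_digraph n A))"
    and ans: "\<And>n A. simple_digraph {..<n} A \<Longrightarrow>
      vars (run_phases phs (start_state (encode_digraph n A))) 0 = of_bool (Q {..<n} A)"
  shows "solvable_single_exp_arcs Q"
proof -
  obtain C d where Cd: "\<And>s M. bounded M phs s \<Longrightarrow> phases_time phs s \<le> C * (M + 1) ^ d"
    using phases_time_bound[OF wf] by blast
  let ?P = "program phs"
  \<comment> \<open>\<open>2 ^ d\<close> and the exponent \<open>3 * d\<close> come from the
    \<open>d\<close>-th power of \<open>2 * ((n + 1) * 8 ^ m)\<close>; the summand 5 and the extra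
    factor \<open>n + 1\<close> absorb the \<open>4 * n + 5\<close> steps of the prelude.\<close>
  have "answers_within ?P (encode_digraph n A) ((C * 2 ^ d + 5) * 2 ^ (3 * d * card A) * (n + 1) ^ (d + 1)) (Q {..<n} A)"
    if D: "simple_digraph {..<n} A" for n A
  proof -
    let ?xs = "encode_digraph n A" and ?m = "card A"
    let ?T = "(C * 2 ^ d + 5) * 2 ^ (3 * d * ?m) * (n + 1) ^ (d + 1)"
    let ?t = "phases_time phs (start_state ?xs)"
    let ?Q = "\<lambda>c. pc c = length ?P \<and> rel (n * n + 1) (run_phases phs (start_state ?xs)) c"
    have "runs ?P (4 * n + 5 + ?t) (initial ?xs) ?Q"
    proof (rule runs_trans[OF prelude_correct[of ?P ?xs n]])
      fix c :: config assume c: "pc c = 8 \<and> rel (n * n + 1) (start_state ?xs) c"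
      have "code_at ?P 8 (phases_code phs 8)"
        using code_at_middle[of prelude _ "[]"] by (simp add: program_def)
      then show "runs ?P ?t c ?Q"
        using phases_correct[of ?P 8 phs c _ "start_state ?xs"] c wf
        by (simp add: program_def)
    qed (use code_at_middle[of "[]"] in \<open>auto simp: program_def encode_digraph_def\<close>)
    then obtain k where k: "k \<le> 4 * n + 5 + ?t" "?Q ((step ?P ^^ k) (initial ?xs))"
      unfolding runs_def by blast
    have "4 * n + 5 + ?t \<le> ?T"
    proof -
      have pos: "1 \<le> (2::nat) ^ (3 * d * ?m)" "1 \<le> (n + 1) ^ d" by simp_all
      have "?t \<le> C * (n + 8 ^ ?m + 1) ^ d" by (rule Cd) (rule bnd[OF D])
      also have "\<dots> \<le> C * (2 * ((n + 1) * 8 ^ ?m)) ^ d"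
      proof -
        define y where "y = (n + 1) * 8 ^ ?m"
        have "(n + 1) * 1 \<le> y" "1 * 8 ^ ?m \<le> y"
          unfolding y_def by (intro mult_le_mono; simp)+
        then have "n + 8 ^ ?m + 1 \<le> 2 * y" by simp
        then show ?thesis unfolding y_def by (intro mult_le_mono2 power_mono) auto
      qed
      also have "\<dots> = C * 2 ^ d * 2 ^ (3 * d * ?m) * (n + 1) ^ d"
      proof -
        have "((8::nat) ^ ?m) ^ d = ((2 ^ 3) ^ ?m) ^ d" by simp
        also have "\<dots> = 2 ^ (3 * d * ?m)" by (simp only: power_mult[symmetric] mult_ac)
        finally show ?thesis by (simp only: power_mult_distrib mult_ac)
      qed
      also have "\<dots> \<le> C * 2 ^ d * 2 ^ (3 * d * ?m) * (n + 1) ^ (d + 1)"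
        by (intro mult_le_mono2 power_increasing) auto
      finally have t: "?t \<le> C * 2 ^ d * 2 ^ (3 * d * ?m) * (n + 1) ^ (d + 1)" .
      have "4 * n + 5 \<le> 5 * (n + 1)" by simp
      also have "\<dots> \<le> 5 * (2 ^ (3 * d * ?m) * (n + 1) ^ (d + 1))"
        using mult_le_mono[OF pos(1), of "n + 1" "(n + 1) ^ (d + 1)"] mult_le_mono[OF pos(2), of "n + 1" "n + 1"]
        by (simp add: mult_ac)
      finally show ?thesis using t by (simp add: distrib_right mult.assoc)
    qed
    moreover have "halted ?P ((step ?P ^^ k) (initial ?xs))" using k(2) by (simp add: halted_def)
    moreover have "regs ((step ?P ^^ k) (initial ?xs)) 0 = vars (run_phases phs (start_state ?xs)) 0"
      using relD(1)[of _ _ _ 0] k(2) by (auto simp: vr_def)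
    ultimately show ?thesis using k(1) ans[OF D]
      unfolding answers_within_def Let_def by (intro exI[of _ k]) auto
  qed
  then show ?thesis unfolding solvable_single_exp_arcs_def by (intro exI[of _ ?P] exI) blast
qed

section \<open>The algorithm\<close>

primrec wv :: "com \<Rightarrow> nat set" where
  "wv Skip = {}"
| "wv (Set x e) = {x}"
| "wv (Sto a e f) = {}"
| "wv (Seq c d) = wv c \<union> wv d"
| "wv (If e c d) = wv c \<union> wv d"
| "wv (For i b c) = insert i (wv c)"

primrec wa :: "com \<Rightarrow> nat set" where
  "wa Skip = {}"
| "wa (Set x e) = {}"
| "wa (Sto a e f) = {a}"
| "wa (Seq c d) = wa c \<union> wa d"
| "wa (If e c d) = wa c \<union> wa d"
| "wa (For i b c) = wa c"

lemma den_wv: "x \<notin> wv c \<Longrightarrow> vars (den c s) x = vars s x"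
proof (induction c arbitrary: s)
  case (For i b c)
  have "vars (((\<lambda>s'. upd i (Suc (vars s' i)) (den c s')) ^^ k) s') x = vars s' x" for k s'
    using For by (induction k) auto
  then show ?case using For.prems by auto
qed auto

lemma den_wa: "a \<notin> wa c \<Longrightarrow> arrs (den c s) a = arrs s a"
proof (induction c arbitrary: s)
  case (For i b c)
  have "arrs (((\<lambda>s'. upd i (Suc (vars s' i)) (den c s')) ^^ k) s') a = arrs s' a" for k s'
    using For by (induction k) auto
  then show ?case using For.prems by auto
qed auto

declare den.simps(6) [simp del]

text \<open>In round \<open>k\<close> the cells below \<open>k\<close> have been rewritten while
  cell \<open>k\<close> still has its old value, so \<open>e\<close> may read the cell about to be
  overwritten, as the update of \<open>USED\<close> does.\<close>

lemma den_For_Sto: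
  assumes "\<And>k f. k < vars s b \<Longrightarrow> f k = arrs s a k \<Longrightarrow>
    cev e (s\<lparr>vars := (vars s)(i := k), arrs := (arrs s)(a := f)\<rparr>) = g k"
  shows "den (For i b (Sto a (Var i) e)) s = s\<lparr>vars := (vars s)(i := vars s b),
    arrs := (arrs s)(a := \<lambda>j. if j < vars s b then g j else arrs s a j)\<rparr>"
proof -
  define I where "I k s' \<longleftrightarrow> s' = s\<lparr>vars := (vars s)(i := k),
    arrs := (arrs s)(a := \<lambda>j. if j < k then g j else arrs s a j)\<rparr>" for k s'
  have "I (vars s b) (den (For i b (Sto a (Var i) e)) s)"
  proof (rule den_For_invariant)
    show "I 0 (upd i 0 s)" by (simp add: I_def upd_def)
  next
    fix k s' assume "k < vars s b" "I k s'"
    then show "I (Suc k) (upd i (Suc k) (den (Sto a (Var i) e) s'))"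
      using assms[of k "\<lambda>j. if j < k then g j else arrs s a j"]
      by (auto simp: I_def upd_def upda_def fun_eq_iff less_Suc_eq)
  qed
  then show ?thesis by (simp add: I_def)
qed

text \<open>Under truncated subtraction \<open>1 - a\<close> tests \<open>a\<close> for zero. Hence
  connectives are arithmetic without branching, any nonzero value counts as true, and results are 0
  or 1.\<close>

definition conj_e :: "exp \<Rightarrow> exp \<Rightarrow> exp" where
  "conj_e a b = Minus (Num 1) (Plus (Minus (Num 1) a) (Minus (Num 1) b))"

definition neg_e :: "exp \<Rightarrow> exp" where
  "neg_e a = Minus (Num 1) a"

definition disj_e :: "exp \<Rightarrow> exp \<Rightarrow> exp" where
  "disj_e a b = neg_e (conj_e (neg_e a) (neg_e b))"

definition eq_e :: "exp \<Rightarrow> exp \<Rightarrow> exp" where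
  "eq_e a b = neg_e (Plus (Minus a b) (Minus b a))"

lemma ev_connectives [simp]:
  "ev (conj_e a b) s \<rho> = of_bool (ev a s \<rho> \<noteq> 0 \<and> ev b s \<rho> \<noteq> 0)"
  "ev (neg_e a) s \<rho> = of_bool (ev a s \<rho> = 0)"
  "ev (disj_e a b) s \<rho> = of_bool (ev a s \<rho> \<noteq> 0 \<or> ev b s \<rho> \<noteq> 0)"
  "ev (eq_e a b) s \<rho> = of_bool (ev a s \<rho> = ev b s \<rho>)"
  by (auto simp: conj_e_def neg_e_def disj_e_def eq_e_def)

lemma wfe_connectives [simp]:
  "wfe B d (conj_e a b) \<longleftrightarrow> wfe B d a \<and> wfe B d b"
  "wfe B d (neg_e a) \<longleftrightarrow> wfe B d a"
  "wfe B d (disj_e a b) \<longleftrightarrow> wfe B d a \<and> wfe B d b"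
  "wfe B d (eq_e a b) \<longleftrightarrow> wfe B d a \<and> wfe B d b"
  by (auto simp: conj_e_def neg_e_def disj_e_def eq_e_def)

notation Seq (infixr \<open>;;\<close> 60)

text \<open>\<open>ANS\<close> is variable 0, hence machine register 0. \<open>VM\<close>,
  \<open>M3\<close>, \<open>KK\<close> and \<open>KAP\<close> hold \<open>m\<close>,
  \<open>3 * m\<close>, \<open>8 ^ m\<close> and the number of rounds per snapshot.
  \<open>VZ\<close> is the current step, \<open>VS\<close> its source state, \<open>VX\<close> the
  number being decoded; \<open>VW\<close> and \<open>VT\<close> are weight and total during
  encoding. \<open>SNAP\<close>, \<open>NEW\<close>, \<open>USED\<close> and \<open>OLD\<close> are
  0/1 vectors over the arc list.\<close>

abbreviation (input) "ANS \<equiv> (0::nat)"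
abbreviation (input) "VN \<equiv> (18::nat)"
abbreviation (input) "PTR \<equiv> (2::nat)"
abbreviation (input) "VU \<equiv> (3::nat)"
abbreviation (input) "VV \<equiv> (4::nat)"
abbreviation (input) "VM \<equiv> (5::nat)"
abbreviation (input) "M3 \<equiv> (6::nat)"
abbreviation (input) "KK \<equiv> (7::nat)"
abbreviation (input) "KAP \<equiv> (8::nat)"
abbreviation (input) "VI \<equiv> (9::nat)"
abbreviation (input) "VZ \<equiv> (10::nat)"
abbreviation (input) "VX \<equiv> (11::nat)"
abbreviation (input) "VS \<equiv> (12::nat)"
abbreviation (input) "OK \<equiv> (13::nat)"
abbreviation (input) "VQ \<equiv> (14::nat)"
abbreviation (input) "VW \<equiv> (15::nat)"
abbreviation (input) "VT \<equiv> (16::nat)"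
abbreviation (input) "VY \<equiv> (17::nat)"

abbreviation (input) "SRC \<equiv> (2::nat)"
abbreviation (input) "DST \<equiv> (3::nat)"
abbreviation (input) "HALF \<equiv> (4::nat)"
abbreviation (input) "PAR \<equiv> (5::nat)"
abbreviation (input) "SNAP \<equiv> (6::nat)"
abbreviation (input) "NEW \<equiv> (7::nat)"
abbreviation (input) "USED \<equiv> (8::nat)"
abbreviation (input) "OLD \<equiv> (9::nat)"
abbreviation (input) "MARK \<equiv> (10::nat)"

text \<open>The machine cannot divide, so \<open>HALF\<close> and \<open>PAR\<close> tabulate quotients and remainders by 2.  Each snapshot
  is applied \<open>KAP\<close> times: once for strict paths, \<open>m\<close> times to reach its transitive closure.\<close>

definition decode :: "nat \<Rightarrow> com" where
  "decode a = For VI VM (Sto a (Var VI) (Arr PAR (Var VX)) ;; Set VX (Arr HALF (Var VX)))"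

text \<open>Decoding consumes \<open>m\<close> low bits. What is left after \<open>SNAP\<close> is
  the code of the source state, saved for the lookup in \<open>MARK\<close>.\<close>

definition unpack :: com where
  "unpack = Set VX (Var VZ) ;; decode SNAP ;; Set VS (Var VX) ;; decode NEW ;; decode USED"

definition unused_e :: exp where
  "unused_e = neg_e (Ex 0 VM (conj_e (Arr SNAP (Bnd 0)) (Arr USED (Bnd 0))))"

definition sym_e :: exp where
  "sym_e = neg_e (Ex 0 VM (conj_e (Arr SNAP (Bnd 0)) (neg_e (Ex 1 VM (conj_e (Arr SNAP (Bnd 1))
     (conj_e (eq_e (Arr SRC (Bnd 1)) (Arr DST (Bnd 0))) (eq_e (Arr DST (Bnd 1)) (Arr SRC (Bnd 0)))))))))"

definition separated_e :: exp where
  "separated_e = neg_e (Ex 0 VM (conj_e (Arr SNAP (Bnd 0)) (Ex 1 VM (conj_e (Arr SNAP (Bnd 1))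
     (conj_e (eq_e (Arr DST (Bnd 0)) (Arr SRC (Bnd 1))) (neg_e (eq_e (Arr SRC (Bnd 0)) (Arr DST (Bnd 1)))))))))"

definition guard :: "bool \<Rightarrow> variant \<Rightarrow> exp" where
  "guard und X = conj_e (Arr MARK (Var VS)) (conj_e (if once X then unused_e else Num 1)
     (conj_e (if und then sym_e else Num 1) (if separated X then separated_e else Num 1)))"

text \<open>The arrays cannot represent pairs outside \<open>A\<close>, so an escape from
  \<open>A\<close> is recorded in \<open>OK\<close>. Old arcs and snapshot arcs lie in
  \<open>A\<close>, so only their compositions are tested; the conjunct \<open>Var OK\<close> makes
  a rejection permanent.\<close>

definition contained_e :: exp where
  "contained_e = conj_e (Var OK) (neg_e (Ex 0 VM (conj_e (Arr OLD (Bnd 0)) (Ex 1 VM (conj_e (Arr SNAP (Bnd 1))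
     (conj_e (eq_e (Arr DST (Bnd 0)) (Arr SRC (Bnd 1)))
       (conj_e (neg_e (eq_e (Arr SRC (Bnd 0)) (Arr DST (Bnd 1))))
         (neg_e (Ex 2 VM (conj_e (eq_e (Arr SRC (Bnd 2)) (Arr SRC (Bnd 0)))
           (eq_e (Arr DST (Bnd 2)) (Arr DST (Bnd 1)))))))))))))"

definition prolong_e :: exp where
  "prolong_e = disj_e (Arr OLD (Var VI)) (disj_e (Arr SNAP (Var VI))
     (Ex 0 VM (conj_e (Arr OLD (Bnd 0)) (Ex 1 VM (conj_e (Arr SNAP (Bnd 1))
       (conj_e (eq_e (Arr DST (Bnd 0)) (Arr SRC (Bnd 1)))
         (conj_e (eq_e (Arr SRC (Bnd 0)) (Arr SRC (Var VI))) (eq_e (Arr DST (Bnd 1)) (Arr DST (Var VI))))))))))"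

text \<open>The copy in \<open>OLD\<close> isolates the rounds: with updates in place, a strict
  round could traverse two arcs of the same snapshot.\<close>

definition pass :: com where
  "pass = For VI VM (Sto OLD (Var VI) (Arr NEW (Var VI))) ;; Set OK contained_e ;;
     For VI VM (Sto NEW (Var VI) prolong_e)"

definition encode :: "nat \<Rightarrow> com" where
  "encode a = For VI VM
     (If (Arr a (Var VI)) (Set VT (Plus (Var VT) (Var VW))) Skip ;; Set VW (Plus (Var VW) (Var VW)))"

definition use :: "variant \<Rightarrow> com" where
  "use X = (if once X then For VI VM (Sto USED (Var VI) (disj_e (Arr USED (Var VI)) (Arr SNAP (Var VI)))) else Skip)"

text \<open>Encoding \<open>NEW\<close> leaves the weight at \<open>2 ^ m\<close>, which is the
  factor of the second field in \<open>pair_code\<close>.\<close>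

definition pack :: com where
  "pack = Set VW (Num 1) ;; Set VT (Num 0) ;; encode NEW ;; encode USED"

definition mark :: com where
  "mark = If (Var OK) (Sto MARK (Var VT) (Num 1) ;; If (Ex 0 VM (neg_e (Arr NEW (Bnd 0)))) Skip (Set ANS (Num 1))) Skip"

definition body :: "bool \<Rightarrow> variant \<Rightarrow> com" where
  "body und X = unpack ;; Set OK (guard und X) ;; For VQ KAP pass ;; use X ;; pack ;; mark"

definition cell :: com where
  "cell = If (Inp (Var PTR))
       (Sto SRC (Var VM) (Var VU) ;; Sto DST (Var VM) (Var VV) ;; Set VM (Plus (Var VM) (Num 1))) Skip ;;
     Set PTR (Plus (Var PTR) (Num 1))"

text \<open>Round \<open>y\<close> fills the cells at \<open>2 * y\<close> and
  \<open>2 * y + 1\<close>; even cells of \<open>PAR\<close> keep their initial 0.\<close>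

definition tables :: com where
  "tables = For VY KK (Sto HALF (Plus (Var VY) (Var VY)) (Var VY) ;;
     Sto HALF (Plus (Plus (Var VY) (Var VY)) (Num 1)) (Var VY) ;;
     Sto PAR (Plus (Plus (Var VY) (Var VY)) (Num 1)) (Num 1))"

text \<open>A phase ends where the next loop bound becomes known: \<open>n\<close> from the input,
  \<open>3 * m\<close> from the scan, and \<open>8 ^ m\<close> by \<open>3 * m\<close>
  doublings.\<close>

definition realizer :: "bool \<Rightarrow> variant \<Rightarrow> phases" where
  "realizer und X =
     [({}, Set VN (Inp (Num 0)) ;; Set PTR (Num 1)),
      ({VN}, For VU VN (For VV VN cell)),
      ({}, Set M3 (Plus (Var VM) (Plus (Var VM) (Var VM))) ;; Set KK (Num 1) ;;
           Set KAP (if nonstrict X then Var VM else Num 1)),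
      ({M3}, For VI M3 (Set KK (Plus (Var KK) (Var KK)))),
      ({VM, KK, KAP}, tables ;; Sto MARK (Num 0) (Num 1) ;; For VZ KK (body und X))]"

lemma wf_realizer: "wf_phases (realizer und X)"
  by (simp add: wf_phases_def realizer_def cell_def tables_def body_def unpack_def decode_def
      guard_def unused_e_def sym_e_def separated_e_def pass_def contained_e_def prolong_e_def use_def pack_def encode_def mark_def)

lemma written [simp]:
  "wv (decode a) = {VI, VX}" "wa (decode a) = {a}"
  "wv pass = {VI, OK}" "wa pass = {OLD, NEW}"
  "wv (encode a) = {VI, VT, VW}" "wa (encode a) = {}"
  "wv unpack = {VI, VX, VS}" "wa unpack = {SNAP, NEW, USED}"
  "wv pack = {VI, VT, VW}" "wa pack = {}"
  by (auto simp: decode_def pass_def encode_def unpack_def pack_def)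

lemma written_use: "wv (use X) \<subseteq> {VI}" "wa (use X) \<subseteq> {USED}"
  by (auto simp: use_def)

lemma written_body: "wv (body und X) \<subseteq> {ANS, VI, VX, VS, OK, VQ, VW, VT}"
    "wa (body und X) \<subseteq> {SNAP, NEW, USED, OLD, MARK}"
  using written_use[of X] by (auto simp: body_def mark_def)

section \<open>Correctness of the search loop\<close>

locale nat_arc_list = arc_list as for as :: "(nat \<times> nat) list" +
  fixes und :: bool and X :: variant
begin

text \<open>What the loop body reads but never writes. Table entries below \<open>8 ^ m\<close>
  suffice, as only step numbers and their quotients are looked up.\<close>

definition env :: "st \<Rightarrow> bool" where
  "env s \<longleftrightarrow> vars s VM = m \<and> vars s KK = 8 ^ m \<and> vars s KAP = (if nonstrict X then m else 1) \<and>
     (\<forall>i<m. arrs s SRC i = fst (as ! i) \<and> arrs s DST i = snd (as ! i)) \<and>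
     (\<forall>y<8 ^ m. arrs s HALF y = y div 2 \<and> arrs s PAR y = y mod 2)"

definition rep :: "st \<Rightarrow> nat \<Rightarrow> (nat \<times> nat) set \<Rightarrow> bool" where
  "rep s a N \<longleftrightarrow> (\<forall>i<m. arrs s a i = of_bool (as ! i \<in> N))"

lemma env_den:
  "env s \<Longrightarrow> {VM, KK, KAP} \<inter> wv c = {} \<Longrightarrow> {SRC, DST, HALF, PAR} \<inter> wa c = {} \<Longrightarrow> env (den c s)"
  by (simp add: env_def den_wv den_wa)

lemma rep_den: "rep s a N \<Longrightarrow> a \<notin> wa c \<Longrightarrow> rep (den c s) a N"
  by (simp add: rep_def den_wa)

lemma rep_upd [simp]: "rep (upd x v s) a N \<longleftrightarrow> rep s a N"
  by (simp add: rep_def)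

lemma env_upd [simp]: "x \<notin> {VM, KK, KAP} \<Longrightarrow> env (upd x v s) \<longleftrightarrow> env s"
  by (auto simp: env_def)

text \<open>Translates quantifiers over array positions into quantifiers over arcs; by
  \<open>N \<subseteq> A\<close> every element of \<open>N\<close> has a position.\<close>

lemma ex_arc: "N \<subseteq> A \<Longrightarrow> (\<exists>i<m. as ! i \<in> N \<and> P (as ! i)) \<longleftrightarrow> (\<exists>p\<in>N. P p)"
  by (auto simp: in_set_conv_nth subset_iff) (metis in_set_conv_nth)

lemma ex_arc_arc:
  assumes "N \<subseteq> A" "F \<subseteq> A"
  shows "(\<exists>i<m. as ! i \<in> N \<and> (\<exists>j<m. as ! j \<in> F \<and> Q (as ! i) (as ! j))) \<longleftrightarrow>
    (\<exists>p\<in>N. \<exists>q\<in>F. Q p q)"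
  using ex_arc[OF assms(1), of "\<lambda>p. \<exists>q\<in>F. Q p q"] ex_arc[OF assms(2), of "Q (as ! i)" for i]
  by simp

lemma ex_pair_pair:
  "(\<exists>p\<in>N. \<exists>q\<in>F. snd p = fst q \<and> Q (fst p) (snd q)) \<longleftrightarrow> (\<exists>u w. (\<exists>v. (u, v) \<in> N \<and> (v, w) \<in> F) \<and> Q u w)"
proof -
  have "(\<exists>p\<in>N. \<exists>q\<in>F. snd p = fst q \<and> Q (fst p) (snd q)) \<longleftrightarrow>
      (\<exists>a b. (a, b) \<in> N \<and> (\<exists>c d. (c, d) \<in> F \<and> b = c \<and> Q a d))"
    unfolding Bex_def split_paired_Ex fst_conv snd_conv ..
  also have "\<dots> \<longleftrightarrow> (\<exists>u w. (\<exists>v. (u, v) \<in> N \<and> (v, w) \<in> F) \<and> Q u w)" by blast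
  finally show ?thesis .
qed

lemma ex_pair: "(\<exists>p\<in>N. fst p = u \<and> snd p = v) \<longleftrightarrow> (u, v) \<in> N"
  by force

lemma ex_arc': "(\<exists>i<m. fst (as ! i) = u \<and> snd (as ! i) = v) \<longleftrightarrow> (u, v) \<in> A"
  by (auto simp: in_set_conv_nth prod_eq_iff)

lemma decode_correct:
  assumes "env s" "vars s VX = x" "x < 8 ^ m" "a \<notin> {HALF, PAR}"
  shows "rep (den (decode a) s) a (arcs_of x)" "vars (den (decode a) s) VX = x div 2 ^ m"
proof -
  define I where "I k s' \<longleftrightarrow> vars s' VX = x div 2 ^ k \<and> (\<forall>i<k. arrs s' a i = of_bool (bit x i)) \<and>
    arrs s' HALF = arrs s HALF \<and> arrs s' PAR = arrs s PAR" for k and s' :: st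
  have "I (vars s VM) (den (decode a) s)"
    unfolding decode_def
  proof (rule den_For_invariant)
    show "I 0 (upd VI 0 s)" using assms by (simp add: I_def)
  next
    fix k s' assume I: "I k s'" "vars s' VI = k"
    have "x div 2 ^ k < 8 ^ m" using assms(3) by (meson div_le_dividend le_less_trans)
    then have "arrs s HALF (x div 2 ^ k) = x div 2 ^ Suc k" "arrs s PAR (x div 2 ^ k) = of_bool (bit x k)"
      using assms(1) by (simp_all add: env_def bit_iff_odd mod_2_eq_odd div_mult2_eq[symmetric] mult.commute)
    then show "I (Suc k) (upd VI (Suc k)
        (den (Sto a (Var VI) (Arr PAR (Var VX)) ;; Set VX (Arr HALF (Var VX))) s'))"
      using I assms(4) by (auto simp: I_def less_Suc_eq)
  qed
  then show "rep (den (decode a) s) a (arcs_of x)" "vars (den (decode a) s) VX = x div 2 ^ m"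
    using assms(1) by (simp_all add: I_def env_def rep_def arcs_of_iff)
qed

lemma unpack_correct:
  assumes "env s" "vars s VZ = z" "z < 8 ^ m"
  shows "rep (den unpack s) SNAP (arcs_of z)" "rep (den unpack s) NEW (fst (state_of (z div 2 ^ m)))"
    "rep (den unpack s) USED (snd (state_of (z div 2 ^ m)))" "vars (den unpack s) VS = z div 2 ^ m"
proof -
  define s1 where "s1 = den (decode SNAP) (upd VX z s)"
  define s2 where "s2 = den (decode NEW) (upd VS (vars s1 VX) s1)"
  define s3 where "s3 = den (decode USED) s2"
  have s3: "den unpack s = s3"
    using assms(2) by (simp add: unpack_def s1_def s2_def s3_def)
  have le: "z div k < 8 ^ m" for k using assms(3) by (meson div_le_dividend le_less_trans)
  have e1: "env s1" unfolding s1_def using assms(1) by (intro env_den) simp_all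
  have 1: "rep s1 SNAP (arcs_of z)" "vars s1 VX = z div 2 ^ m"
    unfolding s1_def using decode_correct[of "upd VX z s" z SNAP] assms by simp_all
  have e2: "env s2" unfolding s2_def using e1 by (intro env_den) simp_all
  have 2: "rep s2 NEW (arcs_of (z div 2 ^ m))" "vars s2 VX = z div 2 ^ m div 2 ^ m"
    unfolding s2_def using decode_correct[of "upd VS (vars s1 VX) s1" "z div 2 ^ m" NEW] e1 1 le by simp_all
  have "z div 2 ^ m div 2 ^ m < 8 ^ m" using le by (simp add: div_mult2_eq[symmetric])
  then have 3: "rep s3 USED (arcs_of (z div 2 ^ m div 2 ^ m))"
    unfolding s3_def using decode_correct[of s2 _ USED] e2 2 by simp
  show "rep (den unpack s) SNAP (arcs_of z)"
    unfolding s3 s3_def s2_def using 1 by (intro rep_den) simp_all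
  show "rep (den unpack s) NEW (fst (state_of (z div 2 ^ m)))"
    unfolding s3 s3_def state_of_def using 2 by (intro rep_den) simp_all
  show "rep (den unpack s) USED (snd (state_of (z div 2 ^ m)))"
    unfolding s3 state_of_def using 3 by simp
  show "vars (den unpack s) VS = z div 2 ^ m"
    unfolding s3 s3_def s2_def using 1 by (simp add: den_wv)
qed

lemma guard_correct:
  assumes "env s" "rep s SNAP F" "rep s USED U" "F \<subseteq> A" "U \<subseteq> A"
  shows "cev (guard und X) s = of_bool (arrs s MARK (vars s VS) \<noteq> 0 \<and> ok_snapshot und X F \<and> (once X \<longrightarrow> F \<inter> U = {}))"
proof -
  have SNAP: "arrs s SNAP i = of_bool (as ! i \<in> F)" if "i < m" for i using assms(2) that by (simp add: rep_def)
  have USED: "arrs s USED i = of_bool (as ! i \<in> U)" if "i < m" for i using assms(3) that by (simp add: rep_def)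
  have AS: "arrs s SRC i = fst (as ! i)" "arrs s DST i = snd (as ! i)" if "i < m" for i
    using assms(1) that by (simp_all add: env_def)
  have vm: "vars s VM = m" using assms(1) by (simp add: env_def)
  have once: "(\<exists>i<m. as ! i \<in> F \<and> as ! i \<in> U) \<longleftrightarrow> F \<inter> U \<noteq> {}"
    using ex_arc[OF assms(4), of "\<lambda>p. p \<in> U"] by blast
  have sym: "(\<exists>i<m. as ! i \<in> F \<and> \<not> (\<exists>j<m. as ! j \<in> F \<and> fst (as ! j) = snd (as ! i) \<and> snd (as ! j) = fst (as ! i)))
      \<longleftrightarrow> \<not> sym F"
    using ex_arc[OF assms(4), of "\<lambda>q. fst q = snd (as ! i) \<and> snd q = fst (as ! i)" for i]
      ex_arc[OF assms(4), of "\<lambda>q. (snd q, fst q) \<notin> F"]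
    unfolding ex_pair by (force simp: sym_def)
  have sep: "(\<exists>i<m. as ! i \<in> F \<and> (\<exists>j<m. as ! j \<in> F \<and> snd (as ! i) = fst (as ! j) \<and> fst (as ! i) \<noteq> snd (as ! j)))
      \<longleftrightarrow> \<not> (\<forall>u v w. (u, v) \<in> F \<and> (v, w) \<in> F \<longrightarrow> u = w)"
    unfolding ex_arc_arc[OF assms(4,4), of "\<lambda>p q. snd p = fst q \<and> fst p \<noteq> snd q"] by force
  have 1: "cev unused_e s = of_bool (F \<inter> U = {})"
  proof -
    have "cev unused_e s = of_bool (\<not> (\<exists>i<m. arrs s SNAP i \<noteq> 0 \<and> arrs s USED i \<noteq> 0))"
      by (simp add: unused_e_def vm)
    also have "(\<exists>i<m. arrs s SNAP i \<noteq> 0 \<and> arrs s USED i \<noteq> 0) \<longleftrightarrow> (\<exists>i<m. as ! i \<in> F \<and> as ! i \<in> U)"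
      by (intro ex_cong1 conj_cong refl) (simp_all add: SNAP USED)
    finally show ?thesis unfolding once by simp
  qed
  have 2: "cev sym_e s = of_bool (sym F)"
  proof -
    have "cev sym_e s = of_bool (\<not> (\<exists>i<m. arrs s SNAP i \<noteq> 0 \<and>
        \<not> (\<exists>j<m. arrs s SNAP j \<noteq> 0 \<and> arrs s SRC j = arrs s DST i \<and> arrs s DST j = arrs s SRC i)))"
      by (simp add: sym_e_def vm)
    also have "(\<exists>i<m. arrs s SNAP i \<noteq> 0 \<and>
        \<not> (\<exists>j<m. arrs s SNAP j \<noteq> 0 \<and> arrs s SRC j = arrs s DST i \<and> arrs s DST j = arrs s SRC i)) \<longleftrightarrow>
      (\<exists>i<m. as ! i \<in> F \<and> \<not> (\<exists>j<m. as ! j \<in> F \<and> fst (as ! j) = snd (as ! i) \<and> snd (as ! j) = fst (as ! i)))"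
      by (intro ex_cong1 conj_cong arg_cong[of _ _ Not] refl) (simp_all add: SNAP AS)
    finally show ?thesis unfolding sym by simp
  qed
  have 3: "cev separated_e s = of_bool (\<forall>u v w. (u, v) \<in> F \<and> (v, w) \<in> F \<longrightarrow> u = w)"
  proof -
    have "cev separated_e s = of_bool (\<not> (\<exists>i<m. arrs s SNAP i \<noteq> 0 \<and>
        (\<exists>j<m. arrs s SNAP j \<noteq> 0 \<and> arrs s DST i = arrs s SRC j \<and> arrs s SRC i \<noteq> arrs s DST j)))"
      by (simp add: separated_e_def vm)
    also have "(\<exists>i<m. arrs s SNAP i \<noteq> 0 \<and>
        (\<exists>j<m. arrs s SNAP j \<noteq> 0 \<and> arrs s DST i = arrs s SRC j \<and> arrs s SRC i \<noteq> arrs s DST j)) \<longleftrightarrow>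
      (\<exists>i<m. as ! i \<in> F \<and> (\<exists>j<m. as ! j \<in> F \<and> snd (as ! i) = fst (as ! j) \<and> fst (as ! i) \<noteq> snd (as ! j)))"
      by (intro ex_cong1 conj_cong arg_cong[of _ _ Not] refl) (simp_all add: SNAP AS)
    finally show ?thesis unfolding sep by (simp only: not_not)
  qed
  show ?thesis
    unfolding guard_def ok_snapshot_def by (cases und; cases "once X"; cases "separated X"; simp add: 1 2 3; blast)
qed

text \<open>The vector is indexed by the arcs of \<open>A\<close>, so a round yields the
  prolongation only up to intersection with \<open>A\<close>; \<open>OK\<close> tells whether
  anything was cut off.\<close>

lemma pass_correct:
  assumes "env s" "rep s SNAP F" "rep s NEW N" "F \<subseteq> A" "N \<subseteq> A"
  shows "rep (den pass s) NEW (prolong F N \<inter> A)"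
    "vars (den pass s) OK \<noteq> 0 \<longleftrightarrow> vars s OK \<noteq> 0 \<and> prolong F N \<subseteq> A"
proof -
  have SNAP: "arrs s SNAP i = of_bool (as ! i \<in> F)" if "i < m" for i using assms(2) that by (simp add: rep_def)
  have NEW: "arrs s NEW i = of_bool (as ! i \<in> N)" if "i < m" for i using assms(3) that by (simp add: rep_def)
  have AS: "arrs s SRC i = fst (as ! i)" "arrs s DST i = snd (as ! i)" if "i < m" for i
    using assms(1) that by (simp_all add: env_def)
  have vm: "vars s VM = m" using assms(1) by (simp add: env_def)
  define s1 where "s1 = s\<lparr>vars := (vars s)(VI := m),
    arrs := (arrs s)(OLD := \<lambda>j. if j < m then arrs s NEW j else arrs s OLD j)\<rparr>"
  have s1: "den (For VI VM (Sto OLD (Var VI) (Arr NEW (Var VI)))) s = s1"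
    using den_For_Sto[of s VM OLD "Arr NEW (Var VI)" VI "\<lambda>j. arrs s NEW j"] by (simp add: vm s1_def)
  have bad: "(\<exists>i<m. as ! i \<in> N \<and> (\<exists>j<m. as ! j \<in> F \<and> snd (as ! i) = fst (as ! j) \<and>
        fst (as ! i) \<noteq> snd (as ! j) \<and> (fst (as ! i), snd (as ! j)) \<notin> A)) \<longleftrightarrow> \<not> prolong F N \<subseteq> A"
  proof -
    have "prolong F N \<subseteq> A \<longleftrightarrow> \<not> (\<exists>u w. (\<exists>v. (u, v) \<in> N \<and> (v, w) \<in> F) \<and> u \<noteq> w \<and> (u, w) \<notin> A)"
      using assms(4,5) unfolding prolong_def by blast
    then show ?thesis
      unfolding ex_arc_arc[OF assms(5,4), of "\<lambda>p q. snd p = fst q \<and> fst p \<noteq> snd q \<and> (fst p, snd q) \<notin> A"]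
        ex_pair_pair[of N F "\<lambda>u w. u \<noteq> w \<and> (u, w) \<notin> A"] by simp
  qed
  define b where "b = (of_bool (vars s OK \<noteq> 0 \<and> prolong F N \<subseteq> A) :: nat)"
  define s2 where "s2 = upd OK b s1"
  have new: "as ! k \<in> N \<or> as ! k \<in> F \<or> (\<exists>i<m. as ! i \<in> N \<and> (\<exists>j<m. as ! j \<in> F \<and> snd (as ! i) = fst (as ! j) \<and>
        fst (as ! i) = fst (as ! k) \<and> snd (as ! j) = snd (as ! k))) \<longleftrightarrow> as ! k \<in> prolong F N" if "k < m" for k
  proof -
    have "(fst (as ! k), snd (as ! k)) \<in> A" using that by simp
    \<comment> \<open>An arc of \<open>A\<close> is no loop; this supplies the inequality in
      \<open>prolong\<close> that \<open>prolong_e\<close> leaves implicit.\<close>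
    then have "fst (as ! k) \<noteq> snd (as ! k)" using loopfree by metis
    then have "as ! k \<in> prolong F N \<longleftrightarrow> as ! k \<in> N \<or> as ! k \<in> F \<or>
        (\<exists>v. (fst (as ! k), v) \<in> N \<and> (v, snd (as ! k)) \<in> F)"
      by (cases "as ! k") (auto simp: prolong_def)
    also have "(\<exists>v. (fst (as ! k), v) \<in> N \<and> (v, snd (as ! k)) \<in> F) \<longleftrightarrow>
        (\<exists>u w. (\<exists>v. (u, v) \<in> N \<and> (v, w) \<in> F) \<and> u = fst (as ! k) \<and> w = snd (as ! k))" by blast
    finally show ?thesis
      unfolding ex_arc_arc[OF assms(5,4), of "\<lambda>p q. snd p = fst q \<and> fst p = fst (as ! k) \<and> snd q = snd (as ! k)"]
        ex_pair_pair[of N F "\<lambda>u w. u = fst (as ! k) \<and> w = snd (as ! k)"] by simp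
  qed
  have fields: "vars s1 VM = m" "vars s1 OK = vars s OK" "arrs s1 SRC = arrs s SRC" "arrs s1 DST = arrs s DST"
      "arrs s1 SNAP = arrs s SNAP" "\<And>i. i < m \<Longrightarrow> arrs s1 OLD i = of_bool (as ! i \<in> N)"
    by (simp_all add: s1_def vm NEW)
  have "cev contained_e s1 = of_bool (vars s1 OK \<noteq> 0 \<and> \<not> (\<exists>i<m. arrs s1 OLD i \<noteq> 0 \<and> (\<exists>j<m. arrs s1 SNAP j \<noteq> 0 \<and>
      arrs s1 DST i = arrs s1 SRC j \<and> arrs s1 SRC i \<noteq> arrs s1 DST j \<and>
      \<not> (\<exists>k<m. arrs s1 SRC k = arrs s1 SRC i \<and> arrs s1 DST k = arrs s1 DST j))))"
    by (simp only: contained_e_def ev.simps ev_connectives fields(1) of_bool_eq_0_iff not_not fun_upd_apply)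
      (simp only: zero_neq_one one_neq_zero zero_neq_numeral numeral_neq_zero one_eq_numeral_iff numeral_eq_one_iff num.distinct if_True if_False simp_thms)
  also have "(\<exists>i<m. arrs s1 OLD i \<noteq> 0 \<and> (\<exists>j<m. arrs s1 SNAP j \<noteq> 0 \<and>
      arrs s1 DST i = arrs s1 SRC j \<and> arrs s1 SRC i \<noteq> arrs s1 DST j \<and>
      \<not> (\<exists>k<m. arrs s1 SRC k = arrs s1 SRC i \<and> arrs s1 DST k = arrs s1 DST j))) \<longleftrightarrow>
    (\<exists>i<m. as ! i \<in> N \<and> (\<exists>j<m. as ! j \<in> F \<and> snd (as ! i) = fst (as ! j) \<and>
        fst (as ! i) \<noteq> snd (as ! j) \<and> \<not> (\<exists>k<m. fst (as ! k) = fst (as ! i) \<and> snd (as ! k) = snd (as ! j))))"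
    by (intro ex_cong1 conj_cong arg_cong[of _ _ Not] refl) (simp_all add: fields SNAP AS)
  finally have "cev contained_e s1 = b" unfolding ex_arc' bad b_def fields by simp
  then have pass: "den pass s = den (For VI VM (Sto NEW (Var VI) prolong_e)) s2"
    unfolding pass_def s2_def by (simp only: den.simps(2,4) s1)
  have P: "den (For VI VM (Sto NEW (Var VI) prolong_e)) s2 = s2\<lparr>vars := (vars s2)(VI := m),
    arrs := (arrs s2)(NEW := \<lambda>j. if j < m then of_bool (as ! j \<in> prolong F N) else arrs s2 NEW j)\<rparr>"
  proof -
    have vm2: "vars s2 VM = m" by (simp add: s2_def fields)
    have "den (For VI VM (Sto NEW (Var VI) prolong_e)) s2 = s2\<lparr>vars := (vars s2)(VI := vars s2 VM),
      arrs := (arrs s2)(NEW := \<lambda>j. if j < vars s2 VM then of_bool (as ! j \<in> prolong F N) else arrs s2 NEW j)\<rparr>"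
    proof (rule den_For_Sto)
      fix k f assume k: "k < vars s2 VM"
      \<comment> \<open>\<open>prolong_e\<close> reads \<open>OLD\<close> and not
        \<open>NEW\<close>, so the partly overwritten contents \<open>f\<close> have no influence on
        its value.\<close>
      define s3 where "s3 = s2\<lparr>vars := (vars s2)(VI := k), arrs := (arrs s2)(NEW := f)\<rparr>"
      have f3: "vars s3 VM = m" "vars s3 VI = k" "arrs s3 SRC = arrs s SRC" "arrs s3 DST = arrs s DST"
          "arrs s3 SNAP = arrs s SNAP" "\<And>i. i < m \<Longrightarrow> arrs s3 OLD i = of_bool (as ! i \<in> N)"
        using k by (simp_all add: s3_def s2_def fields)
      have km: "k < m" using k vm2 by simp
      have "cev prolong_e s3 = of_bool (arrs s3 OLD k \<noteq> 0 \<or> arrs s3 SNAP k \<noteq> 0 \<or> (\<exists>i<m. arrs s3 OLD i \<noteq> 0 \<and> (\<exists>j<m. arrs s3 SNAP j \<noteq> 0 \<and>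
           arrs s3 DST i = arrs s3 SRC j \<and> arrs s3 SRC i = arrs s3 SRC k \<and> arrs s3 DST j = arrs s3 DST k)))"
        by (simp only: prolong_e_def ev.simps ev_connectives f3(1,2) of_bool_eq_0_iff not_not fun_upd_apply)
          (simp only: zero_neq_one one_neq_zero if_True if_False simp_thms)
      also have "(\<exists>i<m. arrs s3 OLD i \<noteq> 0 \<and> (\<exists>j<m. arrs s3 SNAP j \<noteq> 0 \<and>
           arrs s3 DST i = arrs s3 SRC j \<and> arrs s3 SRC i = arrs s3 SRC k \<and> arrs s3 DST j = arrs s3 DST k)) \<longleftrightarrow>
         (\<exists>i<m. as ! i \<in> N \<and> (\<exists>j<m. as ! j \<in> F \<and> snd (as ! i) = fst (as ! j) \<and>
           fst (as ! i) = fst (as ! k) \<and> snd (as ! j) = snd (as ! k)))"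
        by (intro ex_cong1 conj_cong arg_cong[of _ _ Not] refl) (simp_all add: f3 SNAP AS km)
      finally show "cev prolong_e (s2\<lparr>vars := (vars s2)(VI := k), arrs := (arrs s2)(NEW := f)\<rparr>) = of_bool (as ! k \<in> prolong F N)"
        unfolding s3_def[symmetric] using new[OF km] by (simp only: f3 SNAP[OF km] km) simp
    qed
    then show ?thesis unfolding vm2 .
  qed
  show "rep (den pass s) NEW (prolong F N \<inter> A)"
    unfolding pass P by (simp add: rep_def)
  show "vars (den pass s) OK \<noteq> 0 \<longleftrightarrow> vars s OK \<noteq> 0 \<and> prolong F N \<subseteq> A"
    unfolding pass P by (simp add: s2_def b_def)
qed

lemma pass_rejected: "vars s OK = 0 \<Longrightarrow> vars (den pass s) OK = 0"
  by (simp add: pass_def den_wv contained_e_def)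

text \<open>Iterates of \<open>prolong\<close> increase, so once one of them leaves \<open>A\<close>
  all later ones do. From then on \<open>NEW\<close> carries no information, but \<open>OK\<close>
  stays 0.\<close>

lemma passes_correct:
  assumes "env s" "rep s SNAP F" "rep s NEW R" "F \<subseteq> A" "R \<subseteq> A"
  defines "s' \<equiv> den (For VQ KAP pass) s"
  shows "vars s' OK \<noteq> 0 \<longleftrightarrow> vars s OK \<noteq> 0 \<and> advance (nonstrict X) F R \<subseteq> A"
    "advance (nonstrict X) F R \<subseteq> A \<Longrightarrow> rep s' NEW (advance (nonstrict X) F R)"
proof -
  define I where "I k s' \<longleftrightarrow> env s' \<and> rep s' SNAP F \<and>
    (vars s' OK \<noteq> 0 \<longleftrightarrow> vars s OK \<noteq> 0 \<and> (prolong F ^^ k) R \<subseteq> A) \<and>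
    ((prolong F ^^ k) R \<subseteq> A \<longrightarrow> rep s' NEW ((prolong F ^^ k) R))" for k and s' :: st
  have "I (vars s KAP) s'"
    unfolding s'_def
  proof (rule den_For_invariant)
    show "I 0 (upd VQ 0 s)" using assms by (simp add: I_def)
  next
    fix k s1 assume I: "I k s1"
    have e: "env (den pass s1)" "rep (den pass s1) SNAP F"
      using I by (auto simp: I_def intro!: env_den rep_den)
    have mono: "(prolong F ^^ k) R \<subseteq> (prolong F ^^ Suc k) R" using prolong_mono by simp
    show "I (Suc k) (upd VQ (Suc k) (den pass s1))"
    proof (cases "(prolong F ^^ k) R \<subseteq> A")
      case False
      then have "vars (den pass s1) OK = 0" "\<not> (prolong F ^^ Suc k) R \<subseteq> A"
        using I mono pass_rejected by (auto simp: I_def)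
      then show ?thesis unfolding I_def using e by (simp del: funpow.simps)
    next
      case True
      then have r: "rep s1 NEW ((prolong F ^^ k) R)" "env s1" "rep s1 SNAP F"
        and ok: "vars s1 OK \<noteq> 0 \<longleftrightarrow> vars s OK \<noteq> 0"
        using I by (auto simp: I_def)
      have "prolong F ((prolong F ^^ k) R) \<inter> A = prolong F ((prolong F ^^ k) R)"
        if "prolong F ((prolong F ^^ k) R) \<subseteq> A" using that by blast
      then show ?thesis
        using pass_correct[OF r(2,3,1) assms(4) True] e ok by (auto simp: I_def)
    qed
  qed
  moreover have "advance (nonstrict X) F R = (prolong F ^^ vars s KAP) R"
  proof -
    \<comment> \<open>A snapshot has at most \<open>m\<close> arcs, so \<open>m\<close> rounds reach
      its transitive closure.\<close>
    have "card F \<le> m" using card_mono[OF _ assms(4)] distinct distinct_card by fastforce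
    then show ?thesis
      using advance_eq_prolong_funpow[of F R m "nonstrict X"] subset_loopfree assms(4,5)
        finite_subset[OF assms(4)] assms(1) by (simp add: env_def)
  qed
  ultimately show "vars s' OK \<noteq> 0 \<longleftrightarrow> vars s OK \<noteq> 0 \<and> advance (nonstrict X) F R \<subseteq> A"
    "advance (nonstrict X) F R \<subseteq> A \<Longrightarrow> rep s' NEW (advance (nonstrict X) F R)"
    by (simp_all add: I_def)
qed

lemma use_correct:
  assumes "env s" "rep s SNAP F" "rep s USED U"
  shows "rep (den (use X) s) USED (if once X then U \<union> F else U)"
proof (cases "once X")
  case True
  have vm: "vars s VM = m" using assms(1) by (simp add: env_def)
  have "den (use X) s = s\<lparr>vars := (vars s)(VI := vars s VM),
    arrs := (arrs s)(USED := \<lambda>j. if j < vars s VM then of_bool (as ! j \<in> U \<union> F) else arrs s USED j)\<rparr>"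
    unfolding use_def if_P[OF True] using assms vm by (intro den_For_Sto) (simp add: rep_def)
  then show ?thesis using True vm by (simp add: rep_def)
qed (use assms in \<open>simp add: use_def\<close>)

lemma encode_correct:
  assumes "env s" "rep s a N"
  shows "vars (den (encode a) s) VT = vars s VT + vars s VW * code N"
    "vars (den (encode a) s) VW = vars s VW * 2 ^ m"
proof -
  define I where "I k s' \<longleftrightarrow> vars s' VT = vars s VT + vars s VW * (\<Sum>i<k. of_bool (as ! i \<in> N) * 2 ^ i) \<and>
    vars s' VW = vars s VW * 2 ^ k \<and> arrs s' = arrs s" for k and s' :: st
  have "I (vars s VM) (den (encode a) s)"
    unfolding encode_def
  proof (rule den_For_invariant)
    show "I 0 (upd VI 0 s)" by (simp add: I_def)
  next
    fix k s' assume "k < vars s VM" "I k s'" "vars s' VI = k"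
    then show "I (Suc k) (upd VI (Suc k) (den (If (Arr a (Var VI)) (Set VT (Plus (Var VT) (Var VW))) Skip ;;
        Set VW (Plus (Var VW) (Var VW))) s'))"
      using assms by (auto simp: I_def rep_def env_def algebra_simps)
  qed
  then show "vars (den (encode a) s) VT = vars s VT + vars s VW * code N"
    "vars (den (encode a) s) VW = vars s VW * 2 ^ m"
    using assms(1) by (simp_all add: I_def env_def code_sum)
qed

lemma pack_correct:
  assumes "env s" "rep s NEW N" "rep s USED U"
  shows "vars (den pack s) VT = pair_code (N, U)"
proof -
  define s1 where "s1 = upd VT 0 (upd VW 1 s)"
  define s2 where "s2 = den (encode NEW) s1"
  have e1: "env s1" "rep s1 NEW N" "rep s1 USED U" using assms by (simp_all add: s1_def)
  then have e2: "env s2" "rep s2 USED U" unfolding s2_def by (auto intro!: env_den rep_den)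
  have 1: "vars s2 VT = code N" "vars s2 VW = 2 ^ m"
    using encode_correct[OF e1(1,2)] by (simp_all add: s2_def s1_def)
  have "den pack s = den (encode USED) s2"
    by (simp add: pack_def s1_def s2_def)
  then show ?thesis using encode_correct(1)[OF e2] 1 by (simp add: pair_code_def)
qed

text \<open>After a rejection the remaining commands still run, possibly on meaningless vectors;
  this is harmless because \<open>mark\<close> writes only when \<open>OK\<close> is nonzero. Hence
  claims about \<open>NEW\<close> and \<open>VT\<close> are made only under
  \<open>N \<subseteq> A\<close>.\<close>

lemma body_correct:
  assumes "env s" "vars s VZ = z" "z < 8 ^ m" "\<And>q. arrs s MARK q = of_bool (q \<in> M)"
  defines "s' \<equiv> den (body und X) s"
  shows "env s'"
    "arrs s' MARK q = of_bool (q \<in> (if z div 2 ^ m \<in> M \<and> valid und X z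
       then insert (pair_code (successor X z)) M else M))"
    "vars s' ANS = (if z div 2 ^ m \<in> M \<and> valid und X z \<and> fst (successor X z) = A then 1 else vars s ANS)"
proof -
  define F where "F = arcs_of z"
  obtain R U where RU: "state_of (z div 2 ^ m) = (R, U)" by fastforce
  have sub: "F \<subseteq> A" "R \<subseteq> A" "U \<subseteq> A"
    using RU arcs_of_subset by (auto simp: F_def state_of_def)
  define N where "N = advance (nonstrict X) F R"
  define U' where "U' = (if once X then U \<union> F else U)"
  have succ: "successor X z = (N, U')" by (simp add: successor_def RU N_def U'_def F_def)
  have val: "valid und X z \<longleftrightarrow> ok_snapshot und X F \<and> (once X \<longrightarrow> F \<inter> U = {}) \<and> N \<subseteq> A"
    by (simp add: valid_def RU N_def F_def)
  show "env s'" unfolding s'_def using assms(1) written_body[of und X] by (intro env_den) auto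
  define s1 where "s1 = den unpack s"
  have 1: "env s1" "rep s1 SNAP F" "rep s1 NEW R" "rep s1 USED U" "vars s1 VS = z div 2 ^ m"
    using unpack_correct[OF assms(1-3)] RU env_den[OF assms(1), of unpack]
    by (simp_all add: s1_def F_def)
  define s2 where "s2 = den (Set OK (guard und X)) s1"
  have "arrs s1 MARK q = of_bool (q \<in> M)" for q using assms(4) by (simp add: s1_def den_wa)
  then have g: "vars s2 OK \<noteq> 0 \<longleftrightarrow> z div 2 ^ m \<in> M \<and> ok_snapshot und X F \<and> (once X \<longrightarrow> F \<inter> U = {})"
    using guard_correct[OF 1(1,2,4) sub(1,3)] 1(5) by (simp add: s2_def; blast)
  have 2: "env s2" "rep s2 SNAP F" "rep s2 NEW R" "rep s2 USED U"
    using 1 by (simp_all add: s2_def)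
  define s3 where "s3 = den (For VQ KAP pass) s2"
  have 3: "env s3" "rep s3 SNAP F" "rep s3 USED U"
    unfolding s3_def using 2 by (auto intro!: env_den rep_den)
  have ok3: "vars s3 OK \<noteq> 0 \<longleftrightarrow> z div 2 ^ m \<in> M \<and> valid und X z"
    using passes_correct(1)[OF 2(1-3) sub(1,2)] g by (auto simp: s3_def val N_def)
  have new3: "N \<subseteq> A \<Longrightarrow> rep s3 NEW N"
    using passes_correct(2)[OF 2(1-3) sub(1,2)] by (simp add: s3_def N_def)
  define s4 where "s4 = den (use X) s3"
  have 4: "env s4" "rep s4 USED U'"
    unfolding s4_def U'_def using 3 use_correct[OF 3] written_use[of X] by (auto intro!: env_den)
  have new4: "N \<subseteq> A \<Longrightarrow> rep s4 NEW N"
    unfolding s4_def using new3 written_use[of X] by (auto intro!: rep_den)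
  define s5 where "s5 = den pack s4"
  have vm5: "vars s5 VM = m" using env_den[OF 4(1), of pack] by (simp add: s5_def env_def)
  have t5: "N \<subseteq> A \<Longrightarrow> vars s5 VT = pair_code (N, U')"
    unfolding s5_def by (rule pack_correct[OF 4(1) new4 4(2)])
  have new5: "N \<subseteq> A \<Longrightarrow> rep s5 NEW N" unfolding s5_def using new4 by (auto intro!: rep_den)
  have "OK \<notin> wv (use X)" "MARK \<notin> wa (use X)" "ANS \<notin> wv (use X)" using written_use[of X] by auto
  then have f5: "vars s5 OK = vars s3 OK" "arrs s5 MARK = arrs s MARK" "vars s5 ANS = vars s ANS"
    by (simp_all add: s5_def s4_def s3_def s2_def s1_def den_wv den_wa)
  have s': "s' = den mark s5"
    by (simp add: s'_def body_def s1_def s2_def s3_def s4_def s5_def)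
  have full: "(\<exists>i<m. arrs s5 NEW i = 0) \<longleftrightarrow> N \<noteq> A" if "N \<subseteq> A"
  proof -
    have "(\<exists>i<m. arrs s5 NEW i = 0) \<longleftrightarrow> \<not> (\<forall>p\<in>A. p \<in> N)"
      unfolding all_set_conv_all_nth using new5[OF that] by (auto simp: rep_def)
    then show ?thesis using that by blast
  qed
  show "arrs s' MARK q = of_bool (q \<in> (if z div 2 ^ m \<in> M \<and> valid und X z
       then insert (pair_code (successor X z)) M else M))"
  proof (cases "z div 2 ^ m \<in> M \<and> valid und X z")
    case True
    then have "vars s5 OK \<noteq> 0" "N \<subseteq> A" using ok3 f5 val by auto
    then show ?thesis using True t5 f5(2) assms(4) by (simp add: s' mark_def succ)
  next
    case False
    then have "vars s5 OK = 0" using ok3 f5 by auto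
    then show ?thesis using f5(2) assms(4) by (simp add: s' mark_def if_not_P[OF False])
  qed
  show "vars s' ANS = (if z div 2 ^ m \<in> M \<and> valid und X z \<and> fst (successor X z) = A then 1 else vars s ANS)"
  proof (cases "z div 2 ^ m \<in> M \<and> valid und X z")
    case True
    then have "vars s5 OK \<noteq> 0" "N \<subseteq> A" using ok3 f5 val by auto
    then show ?thesis using True full f5(3) vm5 by (simp add: s' mark_def succ)
  next
    case False
    then have "vars s5 OK = 0" using ok3 f5 by auto
    then show ?thesis using False f5(3) by (auto simp add: s' mark_def)
  qed
qed

text \<open>The array \<open>MARK\<close> after \<open>z\<close> rounds is the characteristic
  function of \<open>marked und X z\<close>, and \<open>ANS\<close> accumulates the existential in
  \<open>realizable_iff_marked\<close>.\<close>

lemma search_correct: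
  assumes "env s" "vars s ANS = 0" "\<And>q. arrs s MARK q = of_bool (q = 0)" "simple_digraph V A"
  shows "vars (den (For VZ KK (body und X)) s) ANS = of_bool (realizable und X V A)"
proof -
  define I where "I z s' \<longleftrightarrow> env s' \<and> (\<forall>q. arrs s' MARK q = of_bool (q \<in> marked und X z)) \<and>
    vars s' ANS = of_bool (\<exists>z'<z. z' div 2 ^ m \<in> marked und X z' \<and> valid und X z' \<and> fst (successor X z') = A)"
    for z and s' :: st
  have K: "vars s KK = 8 ^ m" using assms(1) by (simp add: env_def)
  have "I (vars s KK) (den (For VZ KK (body und X)) s)"
  proof (rule den_For_invariant)
    show "I 0 (upd VZ 0 s)" using assms by (simp add: I_def)
  next
    fix z s1 assume z: "z < vars s KK" "I z s1" "vars s1 VZ = z"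
    then have pre: "env s1" "vars s1 VZ = z" "z < 8 ^ m" "\<And>q. arrs s1 MARK q = of_bool (q \<in> marked und X z)"
      by (simp_all add: I_def K)
    note b = body_correct[OF pre]
    show "I (Suc z) (upd VZ (Suc z) (den (body und X) s1))"
      unfolding I_def using b z(2) by (auto simp: I_def less_Suc_eq)
  qed
  then show ?thesis
    unfolding realizable_iff_marked[OF assms(4)] by (simp add: I_def K)
qed

end

section \<open>Reading the arc list from the adjacency matrix\<close>

definition arcs_upto :: "nat \<Rightarrow> (nat \<times> nat) set \<Rightarrow> nat \<Rightarrow> (nat \<times> nat) list" where
  "arcs_upto n A k = filter (\<lambda>p. p \<in> A) (map (\<lambda>i. (i div n, i mod n)) [0..<k])"

lemma arcs_upto_0 [simp]: "arcs_upto n A 0 = []"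
  by (simp add: arcs_upto_def)

lemma arcs_upto_Suc:
  "arcs_upto n A (Suc k) = arcs_upto n A k @ (if (k div n, k mod n) \<in> A then [(k div n, k mod n)] else [])"
  by (simp add: arcs_upto_def)

lemma arcs_upto_all:
  assumes "simple_digraph {..<n} A"
  shows "set (arcs_upto n A (n * n)) = A" "distinct (arcs_upto n A (n * n))"
    "length (arcs_upto n A (n * n)) = card A"
proof -
  have "p \<in> (\<lambda>i. (i div n, i mod n)) ` {..<n * n}" if "p \<in> A" for p
  proof -
    obtain u v where p: "p = (u, v)" "u < n" "v < n" using \<open>p \<in> A\<close> assms by (auto simp: simple_digraph_def)
    have "u * n + v < (u + 1) * n" using p(3) by simp
    also have "\<dots> \<le> n * n" using p(2) by (intro mult_le_mono1) simp
    finally have "u * n + v < n * n" .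
    then show ?thesis using p by (intro image_eqI[of _ _ "u * n + v"]) simp_all
  qed
  then show 1: "set (arcs_upto n A (n * n)) = A"
    by (auto simp: arcs_upto_def atLeast0LessThan)
  have "inj_on (\<lambda>i. (i div n, i mod n)) {0..<n * n}"
    by (rule inj_onI) (metis div_mult_mod_eq prod.inject)
  then show 2: "distinct (arcs_upto n A (n * n))"
    by (simp add: arcs_upto_def distinct_map)
  show "length (arcs_upto n A (n * n)) = card A" using 1 2 distinct_card by metis
qed

text \<open>The pointer is one ahead of the matrix index, because cell 0 of the input holds
  \<open>n\<close>.\<close>

definition scanned :: "nat \<Rightarrow> (nat \<times> nat) set \<Rightarrow> nat \<Rightarrow> st \<Rightarrow> bool" where
  "scanned n A k s \<longleftrightarrow> vars s VM = length (arcs_upto n A k) \<and> vars s PTR = Suc k \<and> vars s VN = n \<and>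
     inp s = inp (start_state (encode_digraph n A)) \<and>
     (\<forall>i<length (arcs_upto n A k). arrs s SRC i = fst (arcs_upto n A k ! i) \<and> arrs s DST i = snd (arcs_upto n A k ! i))"

lemma cell_correct:
  assumes "scanned n A k s" "k < n * n" "vars s VU = k div n" "vars s VV = k mod n"
  shows "scanned n A (Suc k) (den cell s)"
proof -
  have "inp s (Suc k) = of_bool ((k div n, k mod n) \<in> A)"
    using assms(1,2) by (simp add: scanned_def start_state_def encode_digraph_def)
  then show ?thesis using assms
    by (auto simp: scanned_def cell_def arcs_upto_Suc nth_append less_Suc_eq)
qed

lemma scanned_upd [simp]: "x \<notin> {VM, PTR, VN} \<Longrightarrow> scanned n A k (upd x v s) \<longleftrightarrow> scanned n A k s"
  by (auto simp: scanned_def)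

lemma scan_correct:
  assumes "scanned n A 0 s"
  shows "scanned n A (n * n) (den (For VU VN (For VV VN cell)) s)"
proof -
  have n: "vars s VN = n" using assms by (simp add: scanned_def)
  have "scanned n A (vars s VN * n) (den (For VU VN (For VV VN cell)) s)"
  proof (rule den_For_invariant[where I = "\<lambda>u s. scanned n A (u * n) s"])
    show "scanned n A (0 * n) (upd VU 0 s)" using assms by simp
  next
    fix u s1 assume u: "u < vars s VN" "scanned n A (u * n) s1" "vars s1 VU = u"
    have n1: "vars s1 VN = n" using u(2) by (simp add: scanned_def)
    have "scanned n A (u * n + vars s1 VN) (den (For VV VN cell) s1) \<and> vars (den (For VV VN cell) s1) VU = u"
    proof (rule den_For_invariant[where I = "\<lambda>v s. scanned n A (u * n + v) s \<and> vars s VU = u"])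
      show "scanned n A (u * n + 0) (upd VV 0 s1) \<and> vars (upd VV 0 s1) VU = u" using u by simp
    next
      fix v s2 assume v: "v < vars s1 VN" "scanned n A (u * n + v) s2 \<and> vars s2 VU = u" "vars s2 VV = v"
      \<comment> \<open>The two loops traverse the single index \<open>u * n + v\<close>;
        \<open>v < n\<close> makes \<open>u\<close> and \<open>v\<close> its quotient and remainder,
        and staying below \<open>n * n\<close> keeps the pointer inside the matrix.\<close>
      have "u * n + v < (u + 1) * n" using v(1) n1 by simp
      also have "\<dots> \<le> n * n" using u(1) n by (intro mult_le_mono1) simp
      finally have "scanned n A (Suc (u * n + v)) (den cell s2)"
        using v n1 by (intro cell_correct) simp_all
      moreover have "vars (den cell s2) VU = u" using v by (simp add: den_wv cell_def)
      ultimately show "scanned n A (u * n + Suc v) (upd VV (Suc v) (den cell s2)) \<and>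
          vars (upd VV (Suc v) (den cell s2)) VU = u" by simp
    qed
    then show "scanned n A (Suc u * n) (upd VU (Suc u) (den (For VV VN cell) s1))"
      by (simp add: n1 add.commute)
  qed
  then show ?thesis using n by simp
qed

section \<open>Loop bounds and lookup tables\<close>

lemma powers_correct:
  assumes "vars s KK = 1"
  shows "vars (den (For VI M3 (Set KK (Plus (Var KK) (Var KK)))) s) KK = 2 ^ vars s M3"
  by (rule den_For_invariant[where I = "\<lambda>k s. vars s KK = 2 ^ k"]) (simp_all add: assms)

lemma tables_correct:
  assumes "arrs s PAR = (\<lambda>_. 0)" "y < vars s KK"
  shows "arrs (den tables s) HALF y = y div 2" "arrs (den tables s) PAR y = y mod 2"
proof -
  \<comment> \<open>The clause for \<open>PAR\<close> also covers the cells not yet reached: the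
    even ones are never written, so they must still be known to be 0.\<close>
  define I where "I k s \<longleftrightarrow> (\<forall>y<2 * k. arrs s HALF y = y div 2) \<and>
    (\<forall>y. arrs s PAR y = (if y < 2 * k then y mod 2 else 0))" for k and s :: st
  have "I (vars s KK) (den tables s)"
    unfolding tables_def
  proof (rule den_For_invariant)
    show "I 0 (upd VY 0 s)" using assms by (simp add: I_def)
  next
    fix k s' assume I: "I k s'" "vars s' VY = k"
    have less: "y < 2 * Suc k \<longleftrightarrow> y < 2 * k \<or> y = k + k \<or> y = Suc (k + k)" for y by auto
    have half: "(k + k) div 2 = k" "Suc (k + k) div 2 = k" "(k + k) mod 2 = 0" "Suc (k + k) mod 2 = 1"
      by presburger+
    show "I (Suc k) (upd VY (Suc k) (den (Sto HALF (Plus (Var VY) (Var VY)) (Var VY) ;;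
     Sto HALF (Plus (Plus (Var VY) (Var VY)) (Num 1)) (Var VY) ;;
     Sto PAR (Plus (Plus (Var VY) (Var VY)) (Num 1)) (Num 1)) s'))"
      using I unfolding I_def less by (auto simp: half)
  qed
  then show "arrs (den tables s) HALF y = y div 2" "arrs (den tables s) PAR y = y mod 2"
    using assms(2) by (simp_all add: I_def)
qed

lemma realizer_correct:
  assumes D: "simple_digraph {..<n} A"
  defines "s0 \<equiv> start_state (encode_digraph n A)"
  shows "bounded (n + 8 ^ card A) (realizer und X) s0"
    "vars (run_phases (realizer und X) s0) ANS = of_bool (realizable und X {..<n} A)"
proof -
  define as where "as = arcs_upto n A (n * n)"
  have as: "set as = A" "distinct as" "length as = card A"
    using arcs_upto_all[OF D] by (simp_all add: as_def)
  interpret nat_arc_list as und X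
    using as(2) D by unfold_locales (auto simp: as simple_digraph_def)
  define c1 where "c1 = For VU VN (For VV VN cell)"
  define c2 where "c2 = Set M3 (Plus (Var VM) (Plus (Var VM) (Var VM))) ;; Set KK (Num 1) ;;
           Set KAP (if nonstrict X then Var VM else Num 1)"
  define c3 where "c3 = For VI M3 (Set KK (Plus (Var KK) (Var KK)))"
  define s1 where "s1 = upd PTR 1 (upd VN n s0)"
  define s2 where "s2 = den c1 s1"
  define s3 where "s3 = den c2 s2"
  define s4 where "s4 = den c3 s3"
  define s5 where "s5 = den tables s4"
  define s6 where "s6 = upda MARK 0 1 s5"
  have w1: "wv c1 = {VU, VV, VM, PTR}" "wa c1 = {SRC, DST}" by (auto simp: c1_def cell_def)
  have w2: "wv c2 = {M3, KK, KAP}" "wa c2 = {}" by (auto simp: c2_def)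
  have w3: "wv c3 = {VI, KK}" "wa c3 = {}" by (auto simp: c3_def)
  have wt: "wv tables = {VY}" "wa tables = {HALF, PAR}" by (auto simp: tables_def)
  have in0: "inp s0 0 = n" by (simp add: s0_def start_state_def encode_digraph_def)
  have "scanned n A 0 s1" by (simp add: scanned_def s1_def s0_def start_state_def)
  then have sc: "scanned n A (n * n) s2" unfolding s2_def c1_def by (rule scan_correct)
  then have vm2: "vars s2 VM = m" by (simp add: scanned_def as_def)
  have 3: "vars s3 VM = m" "vars s3 M3 = 3 * m" "vars s3 KK = 1" "vars s3 KAP = (if nonstrict X then m else 1)"
    by (simp_all add: s3_def c2_def vm2)
  have K4: "vars s4 KK = 8 ^ m"
    using powers_correct[OF 3(3)] 3(2) by (simp add: s4_def c3_def power_mult)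
  have 4: "vars s4 VM = m" "vars s4 KAP = (if nonstrict X then m else 1)"
    by (simp_all add: s4_def den_wv w3 3)
  have "arrs s4 PAR = (\<lambda>_. 0)"
    by (simp add: s4_def s3_def s2_def s1_def den_wa w1 w2 w3 s0_def start_state_def)
  then have tab: "arrs s5 HALF y = y div 2" "arrs s5 PAR y = y mod 2" if "y < 8 ^ m" for y
    using tables_correct[of s4 y] that K4 by (simp_all add: s5_def)
  have "\<forall>i<m. arrs s5 SRC i = fst (as ! i) \<and> arrs s5 DST i = snd (as ! i)"
    using sc by (simp add: s5_def s4_def s3_def den_wa w2 w3 wt scanned_def as_def)
  then have "env s5"
    using tab by (simp add: env_def) (simp add: s5_def den_wv wt K4 4)
  then have "env s6" by (simp add: env_def s6_def)
  moreover have "vars s6 ANS = 0"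
    by (simp add: s6_def s5_def s4_def s3_def s2_def s1_def den_wv w1 w2 w3 wt s0_def start_state_def)
  moreover have "arrs s6 MARK q = of_bool (q = 0)" for q
    by (simp add: s6_def s5_def s4_def s3_def s2_def s1_def den_wa w1 w2 w3 wt s0_def start_state_def)
  ultimately have "vars (den (For VZ KK (body und X)) s6) ANS = of_bool (realizable und X {..<n} A)"
    using search_correct[of s6 "{..<n}"] D as(1) by simp
  then show "vars (run_phases (realizer und X) s0) ANS = of_bool (realizable und X {..<n} A)"
    by (simp add: realizer_def in0 s1_def[symmetric] c1_def[symmetric] c2_def[symmetric] c3_def[symmetric]
        s2_def[symmetric] s3_def[symmetric] s4_def[symmetric] s5_def[symmetric] s6_def[symmetric] del: One_nat_def)
  \<comment> \<open>\<open>3 * m\<close> is itself a loop bound and has to stay below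
    \<open>n + 8 ^ m\<close>; the estimate for \<open>m\<close> follows as well.\<close>
  have le: "3 * k \<le> 8 ^ k" for k :: nat
  proof (induction k)
    case (Suc k)
    have "1 \<le> (8::nat) ^ k" by simp
    moreover have "1 \<le> y \<Longrightarrow> 3 * k \<le> y \<Longrightarrow> 3 * Suc k \<le> 8 * y" for y :: nat
      by simp
    ultimately have "3 * Suc k \<le> 8 * 8 ^ k" using Suc by blast
    then show ?case by simp
  qed simp
  have "m \<le> n + 8 ^ m" using le[of m] by linarith
  moreover have "(1::nat) \<le> 8 ^ m" by simp
  then have "1 \<le> n + 8 ^ m" by (rule trans_le_add2)
  ultimately have b4: "\<forall>b\<in>{VM, KK, KAP}. vars s4 b \<le> n + 8 ^ m"
    using K4 4 by simp
  have b3: "vars s3 M3 \<le> n + 8 ^ m" using 3(2) le[of m] by simp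
  have b1: "vars s1 VN \<le> n + 8 ^ m" by (simp add: s1_def)
  have "den (Set VN (Inp (Num 0)) ;; Set PTR (Num 1)) s0 = s1" by (simp add: s1_def in0)
  then show "bounded (n + 8 ^ card A) (realizer und X) s0"
    using b1 b3 b4 unfolding realizer_def as(3)[symmetric]
    by (simp only: bounded.simps fst_conv snd_conv c1_def[symmetric] c2_def[symmetric] c3_def[symmetric]
        s2_def[symmetric] s3_def[symmetric] s4_def[symmetric]) simp
qed

theorem theorem5:
  fixes X :: variant
  shows "solvable_single_exp_arcs (undirected_realizable X) \<and>
         solvable_single_exp_arcs (directed_realizable X)"
proof -
  have "solvable_single_exp_arcs (realizable und X)" for und
    by (rule solvable_single_exp_arcsI[OF wf_realizer realizer_correct])
  from this[of True] this[of False] show ?thesis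
    by (simp add: realizable_def[abs_def])
qed

end
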